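(* Let $(\mathfrak A,\alpha)$ and $(\mathfrak B,\beta)$ be $\mathbb Z_2$-graded $C^*$-algebras. The seminorm on the algebraic Fermi tensor product $\mathfrak A\otimes_F\mathfrak B$ given by $$[c]_{\max}:=\sup\{\|\pi(c)\|\mid \pi \text{ is a representation of }\mathfrak A\otimes_F\mathfrak B\},\qquad c\in\mathfrak A\otimes_F\mathfrak B,$$ which is a priori possibly extended-valued, is a (finite) $C^*$-norm on $\mathfrak A\otimes_F\mathfrak B$.
   Context: A $\mathbb Z_2$-graded $C^*$-algebra is a pair $(\mathfrak A,\theta)$ with $\mathfrak A$ a $C^*$-algebra and $\theta$ a $*$-automorphism with $\theta^2=\mathrm{id}$. Put $\mathfrak A_{\pm}=\{a:\theta(a)=\pm a\}$, so $\mathfrak A=\mathfrak A_+\oplus\mathfrak A_-$; elements of $\mathfrak A_+\cup\mathfrak A_-$ are homogeneous, with grade $\partial(a)=\pm1$ for $a\in\mathfrak A_\pm$. For homogeneous $a,b$ (possibly in different algebras), $\epsilon(a,b)=-1$ if $\partial(a)=\partial(b)=-1$ and $\epsilon(a,b)=1$ otherwise. The algebraic Fermi tensor product $\mathfrak A\otimes_F\mathfrak B$ is the algebraic tensor product vector space, with product and involution obtained by bilinear (resp. antilinear) extension from $$(a\otimes_F b)(A\otimes_F B)=\epsilon(b,A)\,aA\otimes_F bB,\qquad (a\otimes_F b)^*=\epsilon(a,b)\,a^*\otimes_F b^*$$ for homogeneous $a,A\in\mathfrak A$, $b,B\in\mathfrak B$. A representation is a $*$-homomorphism into the algebra of bounded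 operators on a Hilbert space. A $C^*$-norm on a $*$-algebra is a submultiplicative norm with $\|c^*c\|=\|c\|^2$. *)

theory Defs
  imports "HOL-Analysis.Analysis" "HOL-Library.Poly_Mapping"
begin

section \<open>Complex vector spaces and \<open>C\<^sup>*\<close>-algebras\<close>

class complex_vector = ab_group_add +
  fixes scaleC :: "complex \<Rightarrow> 'a \<Rightarrow> 'a" (infixr "*\<^sub>C" 75)
  assumes scaleC_add_right: "z *\<^sub>C (x + y) = z *\<^sub>C x + z *\<^sub>C y"
    and scaleC_add_left: "(z + w) *\<^sub>C x = z *\<^sub>C x + w *\<^sub>C x"
    and scaleC_scaleC: "z *\<^sub>C (w *\<^sub>C x) = (z * w) *\<^sub>C x"
    and scaleC_one: "1 *\<^sub>C x = x"

global_interpretation complex_vector: vector_space "scaleC :: complex \<Rightarrow> 'a \<Rightarrow> 'a::complex_vector"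
  by unfold_locales (simp_all add: scaleC_add_right scaleC_add_left scaleC_scaleC scaleC_one)

abbreviation clinear :: "('a::complex_vector \<Rightarrow> 'b::complex_vector) \<Rightarrow> bool"
  where "clinear \<equiv> Vector_Spaces.linear scaleC scaleC"

text \<open>No unit is assumed, and the zero algebra is not excluded.\<close>

class cstar_algebra = complex_vector + real_normed_algebra + banach +
  fixes star :: "'a \<Rightarrow> 'a"
  assumes scaleR_scaleC: "r *\<^sub>R x = complex_of_real r *\<^sub>C x"
    and norm_scaleC: "norm (z *\<^sub>C x) = cmod z * norm x"
    and mult_scaleC_left: "(z *\<^sub>C x) * y = z *\<^sub>C (x * y)"
    and mult_scaleC_right: "x * (z *\<^sub>C y) = z *\<^sub>C (x * y)"
    and star_star: "star (star x) = x"
    and star_add: "star (x + y) = star x + star y"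
    and star_scaleC: "star (z *\<^sub>C x) = cnj z *\<^sub>C star x"
    and star_mult: "star (x * y) = star y * star x"
    and norm_star_mult_self: "norm (star x * x) = (norm x)\<^sup>2"

definition star_automorphism :: "('a::cstar_algebra \<Rightarrow> 'a) \<Rightarrow> bool"
  where "star_automorphism \<theta> \<longleftrightarrow> bij \<theta> \<and> clinear \<theta> \<and>
    (\<forall>x y. \<theta> (x * y) = \<theta> x * \<theta> y) \<and> (\<forall>x. \<theta> (star x) = star (\<theta> x))"

definition z2_grading :: "('a::cstar_algebra \<Rightarrow> 'a) \<Rightarrow> bool"
  where "z2_grading \<theta> \<longleftrightarrow> star_automorphism \<theta> \<and> \<theta> \<circ> \<theta> = id"

definition graded_part :: "('a::complex_vector \<Rightarrow> 'a) \<Rightarrow> complex \<Rightarrow> 'a set"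
  where "graded_part \<theta> s = {a. \<theta> a = s *\<^sub>C a}"

definition grade_sign :: "complex \<Rightarrow> complex \<Rightarrow> complex"
  where "grade_sign s t = (if s = -1 \<and> t = -1 then -1 else 1)"


section \<open>The algebraic tensor product\<close>

instantiation complex :: complex_vector
begin
definition scaleC_complex :: "complex \<Rightarrow> complex \<Rightarrow> complex"
  where "scaleC_complex z w = z * w"
instance by standard (simp_all add: scaleC_complex_def algebra_simps)
end

instantiation poly_mapping :: (type, complex_vector) complex_vector
begin
lift_definition scaleC_poly_mapping :: "complex \<Rightarrow> ('a \<Rightarrow>\<^sub>0 'b) \<Rightarrow> ('a \<Rightarrow>\<^sub>0 'b)"
  is "\<lambda>z f k. z *\<^sub>C f k"
  by (erule finite_subset[rotated]) auto
instance
  by standard (transfer; simp add: fun_eq_iff scaleC_add_right scaleC_add_left scaleC_scaleC scaleC_one)+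
end

definition tensor_relations :: "('a::complex_vector \<times> 'b::complex_vector \<Rightarrow>\<^sub>0 complex) set"
  where "tensor_relations =
    {Poly_Mapping.single (a + a', b) 1 - Poly_Mapping.single (a, b) 1 - Poly_Mapping.single (a', b) 1 | a a' b. True} \<union>
    {Poly_Mapping.single (a, b + b') 1 - Poly_Mapping.single (a, b) 1 - Poly_Mapping.single (a, b') 1 | a b b'. True} \<union>
    {Poly_Mapping.single (z *\<^sub>C a, b) 1 - z *\<^sub>C Poly_Mapping.single (a, b) 1 | z a b. True} \<union>
    {Poly_Mapping.single (a, z *\<^sub>C b) 1 - z *\<^sub>C Poly_Mapping.single (a, b) 1 | z a b. True}"

definition tensor_rel :: "('a::complex_vector \<times> 'b::complex_vector \<Rightarrow>\<^sub>0 complex) \<Rightarrow>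
    ('a \<times> 'b \<Rightarrow>\<^sub>0 complex) \<Rightarrow> bool"
  where "tensor_rel p q \<longleftrightarrow> p - q \<in> complex_vector.span tensor_relations"

lemma equivp_tensor_rel: "equivp tensor_rel"
proof (rule equivpI)
  show "reflp tensor_rel"
    by (simp add: reflp_def tensor_rel_def complex_vector.span_zero)
  show "symp tensor_rel"
    unfolding symp_def tensor_rel_def using complex_vector.span_neg by fastforce
  show "transp tensor_rel"
    unfolding transp_def tensor_rel_def using complex_vector.span_add by fastforce
qed

quotient_type (overloaded) ('a, 'b) tensor =
  "'a::complex_vector \<times> 'b::complex_vector \<Rightarrow>\<^sub>0 complex" / tensor_rel
  by (rule equivp_tensor_rel)

instantiation tensor :: (complex_vector, complex_vector) complex_vector
begin

lift_definition zero_tensor :: "('a, 'b) tensor" is 0 .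

lift_definition plus_tensor :: "('a, 'b) tensor \<Rightarrow> ('a, 'b) tensor \<Rightarrow> ('a, 'b) tensor" is "(+)"
proof -
  fix p p' q q' :: "'a \<times> 'b \<Rightarrow>\<^sub>0 complex"
  assume "tensor_rel p p'" "tensor_rel q q'"
  then have "(p - p') + (q - q') \<in> complex_vector.span tensor_relations"
    unfolding tensor_rel_def by (rule complex_vector.span_add)
  then show "tensor_rel (p + q) (p' + q')"
    unfolding tensor_rel_def by (simp add: algebra_simps)
qed

lift_definition uminus_tensor :: "('a, 'b) tensor \<Rightarrow> ('a, 'b) tensor" is uminus
proof -
  fix p p' :: "'a \<times> 'b \<Rightarrow>\<^sub>0 complex"
  assume "tensor_rel p p'"
  then have "- (p - p') \<in> complex_vector.span tensor_relations"
    unfolding tensor_rel_def by (rule complex_vector.span_neg)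
  then show "tensor_rel (- p) (- p')"
    unfolding tensor_rel_def by (simp add: algebra_simps)
qed

lift_definition minus_tensor :: "('a, 'b) tensor \<Rightarrow> ('a, 'b) tensor \<Rightarrow> ('a, 'b) tensor" is "(-)"
proof -
  fix p p' q q' :: "'a \<times> 'b \<Rightarrow>\<^sub>0 complex"
  assume "tensor_rel p p'" "tensor_rel q q'"
  then have "(p - p') - (q - q') \<in> complex_vector.span tensor_relations"
    unfolding tensor_rel_def by (rule complex_vector.span_diff)
  then show "tensor_rel (p - q) (p' - q')"
    unfolding tensor_rel_def by (simp add: algebra_simps)
qed

lift_definition scaleC_tensor :: "complex \<Rightarrow> ('a, 'b) tensor \<Rightarrow> ('a, 'b) tensor" is "scaleC"
  unfolding tensor_rel_def complex_vector.scale_right_diff_distrib[symmetric]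
  by (rule complex_vector.span_scale)

instance
proof
  fix x y w :: "('a, 'b) tensor" and z v :: complex
  have R: "tensor_rel p p" for p :: "'a \<times> 'b \<Rightarrow>\<^sub>0 complex"
    by (simp add: tensor_rel_def complex_vector.span_zero)
  show "x + y + w = x + (y + w)" by transfer (simp add: R add.assoc)
  show "x + y = y + x" by transfer (simp add: R add.commute)
  show "0 + x = x" by transfer (simp add: R)
  show "- x + x = 0" by transfer (simp add: R)
  show "x - y = x + - y" by transfer (simp add: R)
  show "z *\<^sub>C (x + y) = z *\<^sub>C x + z *\<^sub>C y" by transfer (simp add: R scaleC_add_right)
  show "(z + v) *\<^sub>C x = z *\<^sub>C x + v *\<^sub>C x" by transfer (simp add: R scaleC_add_left)
  show "z *\<^sub>C v *\<^sub>C x = (z * v) *\<^sub>C x" by transfer (simp add: R scaleC_scaleC)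
  show "1 *\<^sub>C x = x" by transfer (simp add: R scaleC_one)
qed

end

lift_definition tensor :: "'a::complex_vector \<Rightarrow> 'b::complex_vector \<Rightarrow> ('a, 'b) tensor" (infixr "\<otimes>" 70)
  is "\<lambda>a b. Poly_Mapping.single (a, b) 1" .

definition cbilinear :: "('a::complex_vector \<Rightarrow> 'b::complex_vector \<Rightarrow> 'c::complex_vector) \<Rightarrow> bool"
  where "cbilinear f \<longleftrightarrow> (\<forall>a. clinear (f a)) \<and> (\<forall>b. clinear (\<lambda>a. f a b))"

definition antilinear :: "('a::complex_vector \<Rightarrow> 'b::complex_vector) \<Rightarrow> bool"
  where "antilinear f \<longleftrightarrow> (\<forall>x y. f (x + y) = f x + f y) \<and> (\<forall>z x. f (z *\<^sub>C x) = cnj z *\<^sub>C f x)"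

lemma clinear_iff: "clinear f \<longleftrightarrow> (\<forall>x y. f (x + y) = f x + f y) \<and> (\<forall>z x. f (z *\<^sub>C x) = z *\<^sub>C f x)"
  by (simp add: Vector_Spaces.linear_iff complex_vector.vector_space_axioms)

text \<open>Extension of maps from pure tensors, simultaneously for linear (\<open>\<sigma> = id\<close>) and
  antilinear (\<open>\<sigma> = cnj\<close>) maps.\<close>

definition free_extension :: "(complex \<Rightarrow> complex) \<Rightarrow> ('a \<Rightarrow> 'b \<Rightarrow> 'c::complex_vector) \<Rightarrow>
    ('a \<times> 'b \<Rightarrow>\<^sub>0 complex) \<Rightarrow> 'c"
  where "free_extension \<sigma> f p =
    (\<Sum>k\<in>Poly_Mapping.keys p. \<sigma> (Poly_Mapping.lookup p k) *\<^sub>C f (fst k) (snd k))"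

lemma tensor_extension_exists:
  fixes f :: "'a::complex_vector \<Rightarrow> 'b::complex_vector \<Rightarrow> 'c::complex_vector"
  assumes \<sigma>: "\<sigma> = id \<or> \<sigma> = cnj"
    and add_left: "\<And>a a' b. f (a + a') b = f a b + f a' b"
    and add_right: "\<And>a b b'. f a (b + b') = f a b + f a b'"
    and scale_left: "\<And>z a b. f (z *\<^sub>C a) b = \<sigma> z *\<^sub>C f a b"
    and scale_right: "\<And>z a b. f a (z *\<^sub>C b) = \<sigma> z *\<^sub>C f a b"
  shows "\<exists>g. (\<forall>x y. g (x + y) = g x + g y) \<and> (\<forall>z x. g (z *\<^sub>C x) = \<sigma> z *\<^sub>C g x) \<and>
    (\<forall>a b. g (a \<otimes> b) = f a b)"
proof -
  have \<sigma>_simps: "\<sigma> (z + w) = \<sigma> z + \<sigma> w" "\<sigma> (z * w) = \<sigma> z * \<sigma> w" "\<sigma> 0 = 0" "\<sigma> 1 = 1" for z w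
    using \<sigma> by auto
  let ?e = "free_extension \<sigma> f"
  have e_add: "?e (p + q) = ?e p + ?e q" for p q
    unfolding free_extension_def
    by (rule setsum_keys_plus_distrib) (simp_all add: \<sigma>_simps scaleC_add_left)
  have e_scale: "?e (z *\<^sub>C p) = \<sigma> z *\<^sub>C ?e p" for z p
  proof -
    have "?e (z *\<^sub>C p) = (\<Sum>k\<in>Poly_Mapping.keys p.
        \<sigma> (Poly_Mapping.lookup (z *\<^sub>C p) k) *\<^sub>C f (fst k) (snd k))"
      unfolding free_extension_def
      by (rule sum.mono_neutral_left)
        (auto simp: in_keys_iff scaleC_poly_mapping.rep_eq scaleC_complex_def \<sigma>_simps)
    also have "\<dots> = \<sigma> z *\<^sub>C ?e p"
      by (simp add: free_extension_def scaleC_poly_mapping.rep_eq scaleC_complex_def \<sigma>_simps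
          complex_vector.scale_sum_right)
    finally show ?thesis .
  qed
  have e_diff: "?e (p - q) = ?e p - ?e q" for p q
    using e_add[of "p - q" q] by simp
  have e_single: "?e (Poly_Mapping.single (a, b) 1) = f a b" for a b
    by (simp add: free_extension_def \<sigma>_simps)
  have e_rel: "?e p = 0" if "p \<in> complex_vector.span tensor_relations" for p
    using that
  proof (induction rule: complex_vector.span_induct_alt)
    case base
    show ?case by (simp add: free_extension_def)
  next
    case (step z x y)
    have "?e x = 0"
      using step(1) unfolding tensor_relations_def
      by (auto simp: e_diff e_scale e_single add_left add_right scale_left scale_right)
    then show ?case
      using step by (simp add: e_add e_scale)
  qed
  define g where "g t = ?e (rep_tensor t)" for t
  have g_abs: "g (abs_tensor p) = ?e p" for p
  proof -
    have "tensor_rel (rep_tensor (abs_tensor p)) p"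
      by (metis Quotient3_tensor rep_abs_rsp_left equivp_tensor_rel equivp_reflp)
    then show ?thesis
      using e_rel e_diff by (fastforce simp: g_def tensor_rel_def)
  qed
  have "g (x + y) = g x + g y" for x y
    by (induction x; induction y) (simp add: plus_tensor.abs_eq g_abs e_add)
  moreover have "g (z *\<^sub>C x) = \<sigma> z *\<^sub>C g x" for z x
    by (induction x) (simp add: scaleC_tensor.abs_eq g_abs e_scale)
  moreover have "g (a \<otimes> b) = f a b" for a b
    by (simp add: tensor.abs_eq g_abs e_single)
  ultimately show ?thesis by blast
qed

lemma tensor_add_left: "(a + a') \<otimes> b = a \<otimes> b + a' \<otimes> b"
proof -
  have "tensor_rel (Poly_Mapping.single (a + a', b) 1)
      (Poly_Mapping.single (a, b) 1 + Poly_Mapping.single (a', b) 1)"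
    unfolding tensor_rel_def diff_diff_eq[symmetric]
    by (rule complex_vector.span_base) (unfold tensor_relations_def, blast)
  then show ?thesis
    by (simp add: tensor.abs_eq plus_tensor.abs_eq tensor.abs_eq_iff)
qed

lemma tensor_add_right: "a \<otimes> (b + b') = a \<otimes> b + a \<otimes> b'"
proof -
  have "tensor_rel (Poly_Mapping.single (a, b + b') 1)
      (Poly_Mapping.single (a, b) 1 + Poly_Mapping.single (a, b') 1)"
    unfolding tensor_rel_def diff_diff_eq[symmetric]
    by (rule complex_vector.span_base) (unfold tensor_relations_def, blast)
  then show ?thesis
    by (simp add: tensor.abs_eq plus_tensor.abs_eq tensor.abs_eq_iff)
qed

lemma tensor_scaleC_left: "(z *\<^sub>C a) \<otimes> b = z *\<^sub>C (a \<otimes> b)"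
proof -
  have "tensor_rel (Poly_Mapping.single (z *\<^sub>C a, b) 1) (z *\<^sub>C Poly_Mapping.single (a, b) 1)"
    unfolding tensor_rel_def
    by (rule complex_vector.span_base) (unfold tensor_relations_def, blast)
  then show ?thesis
    by (simp add: tensor.abs_eq scaleC_tensor.abs_eq tensor.abs_eq_iff)
qed

lemma tensor_scaleC_right: "a \<otimes> (z *\<^sub>C b) = z *\<^sub>C (a \<otimes> b)"
proof -
  have "tensor_rel (Poly_Mapping.single (a, z *\<^sub>C b) 1) (z *\<^sub>C Poly_Mapping.single (a, b) 1)"
    unfolding tensor_rel_def
    by (rule complex_vector.span_base) (unfold tensor_relations_def, blast)
  then show ?thesis
    by (simp add: tensor.abs_eq scaleC_tensor.abs_eq tensor.abs_eq_iff)
qed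

lemma tensor_induct [case_names tensor add]:
  assumes t: "\<And>a b. P (a \<otimes> b)" and add: "\<And>x y. P x \<Longrightarrow> P y \<Longrightarrow> P (x + y)"
  shows "P t"
proof (induction t)
  fix p :: "'a \<times> 'b \<Rightarrow>\<^sub>0 complex"
  show "P (abs_tensor p)"
  proof (induction p rule: update_induct)
    case const
    have "P (0 \<otimes> 0)" by (rule t)
    also have "0 \<otimes> 0 = (0 :: ('a, 'b) tensor)"
      using tensor_scaleC_left[of 0 0 0] by simp
    finally show ?case by (metis zero_tensor.abs_eq)
  next
    case (update p k z)
    have "P (abs_tensor p + (z *\<^sub>C fst k) \<otimes> snd k)"
      by (intro add t update)
    also have "abs_tensor p + (z *\<^sub>C fst k) \<otimes> snd k =
        abs_tensor (p + z *\<^sub>C Poly_Mapping.single k 1)"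
      unfolding tensor_scaleC_left by (simp add: tensor.abs_eq plus_tensor.abs_eq scaleC_tensor.abs_eq)
    also have "p + z *\<^sub>C Poly_Mapping.single k 1 = Poly_Mapping.update k z p"
      using update(1)
      by (intro poly_mapping_eqI)
        (auto simp: lookup_add scaleC_poly_mapping.rep_eq scaleC_complex_def lookup_update
          lookup_single in_keys_iff when_def)
    finally show ?case by simp
  qed
qed

section \<open>The algebraic Fermi tensor product\<close>

text \<open>The signs \<open>r, s, t, u\<close> are the grades of \<open>a, b, A, B\<close>. The zero vector is homogeneous of both
  grades; the two prescriptions then agree, both sides being zero. Existence and uniqueness of the
  two maps are part of \<open>fermi_mult_correct\<close> and \<open>fermi_star_correct\<close>.\<close>

definition is_fermi_mult :: "('a::cstar_algebra \<Rightarrow> 'a) \<Rightarrow> ('b::cstar_algebra \<Rightarrow> 'b) \<Rightarrow>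
    (('a, 'b) tensor \<Rightarrow> ('a, 'b) tensor \<Rightarrow> ('a, 'b) tensor) \<Rightarrow> bool"
  where "is_fermi_mult \<alpha> \<beta> m \<longleftrightarrow> cbilinear m \<and>
    (\<forall>r\<in>{1, -1}. \<forall>s\<in>{1, -1}. \<forall>t\<in>{1, -1}. \<forall>u\<in>{1, -1}.
      \<forall>a\<in>graded_part \<alpha> r. \<forall>b\<in>graded_part \<beta> s. \<forall>A\<in>graded_part \<alpha> t. \<forall>B\<in>graded_part \<beta> u.
        m (a \<otimes> b) (A \<otimes> B) = grade_sign s t *\<^sub>C ((a * A) \<otimes> (b * B)))"

definition is_fermi_star :: "('a::cstar_algebra \<Rightarrow> 'a) \<Rightarrow> ('b::cstar_algebra \<Rightarrow> 'b) \<Rightarrow>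
    (('a, 'b) tensor \<Rightarrow> ('a, 'b) tensor) \<Rightarrow> bool"
  where "is_fermi_star \<alpha> \<beta> f \<longleftrightarrow> antilinear f \<and>
    (\<forall>r\<in>{1, -1}. \<forall>s\<in>{1, -1}. \<forall>a\<in>graded_part \<alpha> r. \<forall>b\<in>graded_part \<beta> s.
      f (a \<otimes> b) = grade_sign r s *\<^sub>C (star a \<otimes> star b))"

definition fermi_mult :: "('a::cstar_algebra \<Rightarrow> 'a) \<Rightarrow> ('b::cstar_algebra \<Rightarrow> 'b) \<Rightarrow>
    ('a, 'b) tensor \<Rightarrow> ('a, 'b) tensor \<Rightarrow> ('a, 'b) tensor"
  where "fermi_mult \<alpha> \<beta> = (THE m. is_fermi_mult \<alpha> \<beta> m)"

definition fermi_star :: "('a::cstar_algebra \<Rightarrow> 'a) \<Rightarrow> ('b::cstar_algebra \<Rightarrow> 'b) \<Rightarrow>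
    ('a, 'b) tensor \<Rightarrow> ('a, 'b) tensor"
  where "fermi_star \<alpha> \<beta> = (THE f. is_fermi_star \<alpha> \<beta> f)"

lemma z2_gradingD:
  assumes "z2_grading \<theta>"
  shows "\<theta> (x + y) = \<theta> x + \<theta> y" "\<theta> (z *\<^sub>C x) = z *\<^sub>C \<theta> x" "\<theta> (x * y) = \<theta> x * \<theta> y"
    "\<theta> (star x) = star (\<theta> x)" "\<theta> (\<theta> x) = x" "\<theta> (- x) = - \<theta> x" "\<theta> (x - y) = \<theta> x - \<theta> y" "\<theta> 0 = 0"
proof -
  have l: "clinear \<theta>"
    using assms by (simp add: z2_grading_def star_automorphism_def)
  then show "\<theta> (x + y) = \<theta> x + \<theta> y" "\<theta> (z *\<^sub>C x) = z *\<^sub>C \<theta> x"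
    by (auto simp: clinear_iff)
  interpret Vector_Spaces.linear scaleC scaleC \<theta> by (fact l)
  show "\<theta> (- x) = - \<theta> x" "\<theta> (x - y) = \<theta> x - \<theta> y" "\<theta> 0 = 0"
    by (simp_all add: neg diff zero)
  show "\<theta> (x * y) = \<theta> x * \<theta> y" "\<theta> (star x) = star (\<theta> x)" "\<theta> (\<theta> x) = x"
    using assms by (auto simp: z2_grading_def star_automorphism_def fun_eq_iff)
qed

definition graded_comp :: "('a::complex_vector \<Rightarrow> 'a) \<Rightarrow> complex \<Rightarrow> 'a \<Rightarrow> 'a"
  where "graded_comp \<theta> s a = (1/2) *\<^sub>C (a + s *\<^sub>C \<theta> a)"

lemma scaleC_minus_one: "(-1) *\<^sub>C x = - (x :: 'a::complex_vector)"
  by (metis complex_vector.scale_minus_left scaleC_one)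

lemma scaleC_half_double: "(1/2) *\<^sub>C (x + x) = (x :: 'a::complex_vector)"
proof -
  have "(1/2) *\<^sub>C (x + x) = (1/2 + 1/2) *\<^sub>C x"
    by (simp only: scaleC_add_right scaleC_add_left)
  then show ?thesis by (simp add: scaleC_one)
qed

lemma graded_comp_sum:
  "graded_comp \<theta> 1 a + graded_comp \<theta> (-1) a = (a :: 'a::complex_vector)"
proof -
  have "graded_comp \<theta> 1 a + graded_comp \<theta> (-1) a = (1/2) *\<^sub>C (a + a)"
    unfolding graded_comp_def scaleC_add_right[symmetric] by (simp add: scaleC_minus_one scaleC_one)
  then show ?thesis by (simp only: scaleC_half_double)
qed

lemma graded_comp_in:
  assumes "z2_grading \<theta>" "s \<in> {1, -1}"
  shows "graded_comp \<theta> s a \<in> graded_part \<theta> s"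
proof -
  have "(1/2) *\<^sub>C (\<theta> a - a) = - ((1/2) *\<^sub>C (a - \<theta> a))"
    by (metis complex_vector.scale_minus_right minus_diff_eq)
  then show ?thesis
    using assms(2) by (auto simp: graded_comp_def graded_part_def z2_gradingD[OF assms(1)] add.commute)
qed

lemma graded_comp_linear:
  assumes "z2_grading \<theta>"
  shows "graded_comp \<theta> s (a + b) = graded_comp \<theta> s a + graded_comp \<theta> s b"
    "graded_comp \<theta> s (z *\<^sub>C a) = z *\<^sub>C graded_comp \<theta> s a"
proof -
  show "graded_comp \<theta> s (a + b) = graded_comp \<theta> s a + graded_comp \<theta> s b"
    unfolding graded_comp_def z2_gradingD(1)[OF assms] scaleC_add_right by (simp only: ac_simps)
  show "graded_comp \<theta> s (z *\<^sub>C a) = z *\<^sub>C graded_comp \<theta> s a"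
    unfolding graded_comp_def z2_gradingD(2)[OF assms] scaleC_add_right scaleC_scaleC by (simp only: ac_simps)
qed

lemma graded_comp_same:
  assumes "s \<in> {1, -1}" "a \<in> graded_part \<theta> s"
  shows "graded_comp \<theta> s a = a" "graded_comp \<theta> (- s) a = 0"
  using assms
  by (auto simp: graded_comp_def graded_part_def scaleC_half_double)

lemma tensor_graded_induct [consumes 2, case_names tensor add]:
  fixes \<alpha> :: "'a::cstar_algebra \<Rightarrow> 'a" and \<beta> :: "'b::cstar_algebra \<Rightarrow> 'b"
  assumes \<alpha>: "z2_grading \<alpha>" and \<beta>: "z2_grading \<beta>"
    and t: "\<And>r s a b. r \<in> {1, -1} \<Longrightarrow> s \<in> {1, -1} \<Longrightarrow> a \<in> graded_part \<alpha> r \<Longrightarrow> b \<in> graded_part \<beta> s \<Longrightarrow> P (a \<otimes> b)"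
    and add: "\<And>x y. P x \<Longrightarrow> P y \<Longrightarrow> P (x + y)"
  shows "P x"
proof (induction x rule: tensor_induct)
  case (tensor a b)
  have P: "P (graded_comp \<alpha> r a \<otimes> graded_comp \<beta> s b)" if "r \<in> {1, -1}" "s \<in> {1, -1}" for r s
    using that by (intro t[of r s] graded_comp_in \<alpha> \<beta>)
  have "P ((graded_comp \<alpha> 1 a + graded_comp \<alpha> (-1) a) \<otimes> (graded_comp \<beta> 1 b + graded_comp \<beta> (-1) b))"
    unfolding tensor_add_left tensor_add_right by (intro add P) auto
  then show ?case by (simp only: graded_comp_sum)
qed (rule add)

lemma cbilinear_iff: "cbilinear m \<longleftrightarrow>
    (\<forall>x y w. m (x + y) w = m x w + m y w \<and> m w (x + y) = m w x + m w y) \<and>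
    (\<forall>z x w. m (z *\<^sub>C x) w = z *\<^sub>C m x w \<and> m w (z *\<^sub>C x) = z *\<^sub>C m w x)"
  unfolding cbilinear_def clinear_iff by blast

lemma fermi_mult_exists:
  fixes \<alpha> :: "'a::cstar_algebra \<Rightarrow> 'a" and \<beta> :: "'b::cstar_algebra \<Rightarrow> 'b"
  assumes \<alpha>: "z2_grading \<alpha>" and \<beta>: "z2_grading \<beta>"
  shows "\<exists>m. is_fermi_mult \<alpha> \<beta> m"
proof -
  note lin = z2_gradingD[OF \<alpha>] z2_gradingD[OF \<beta>] graded_comp_linear[OF \<beta>] tensor_add_left tensor_add_right
    tensor_scaleC_left tensor_scaleC_right mult_scaleC_left mult_scaleC_right
    scaleC_add_right distrib_left distrib_right
  define f :: "'a \<Rightarrow> 'b \<Rightarrow> 'a \<Rightarrow> 'b \<Rightarrow> ('a, 'b) tensor" where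
    "f a b A B = (a * A) \<otimes> (graded_comp \<beta> 1 b * B) + (a * \<alpha> A) \<otimes> (graded_comp \<beta> (-1) b * B)" for a b A B
  have "\<exists>g. (\<forall>x y. g (x + y) = g x + g y) \<and> (\<forall>z x. g (z *\<^sub>C x) = id z *\<^sub>C g x) \<and>
      (\<forall>A B. g (A \<otimes> B) = f a b A B)" for a b
    by (rule tensor_extension_exists) (auto simp: f_def lin algebra_simps)
  then obtain g where g: "\<And>a b x y. g a b (x + y) = g a b x + g a b y"
      "\<And>a b z x. g a b (z *\<^sub>C x) = z *\<^sub>C g a b x" "\<And>a b A B. g a b (A \<otimes> B) = f a b A B"
    by (metis id_apply)
  have g_add1: "g (a + a') b y = g a b y + g a' b y" for a a' b y
    by (induction y rule: tensor_induct) (auto simp: g f_def lin algebra_simps)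
  have g_add2: "g a (b + b') y = g a b y + g a b' y" for a b b' y
    by (induction y rule: tensor_induct) (auto simp: g f_def lin algebra_simps)
  have g_sc1: "g (z *\<^sub>C a) b y = z *\<^sub>C g a b y" for z a b y
    by (induction y rule: tensor_induct) (auto simp: g f_def lin algebra_simps)
  have g_sc2: "g a (z *\<^sub>C b) y = z *\<^sub>C g a b y" for z a b y
    by (induction y rule: tensor_induct) (auto simp: g f_def lin algebra_simps)
  have "\<exists>h. (\<forall>x x'. h (x + x') = h x + h x') \<and> (\<forall>z x. h (z *\<^sub>C x) = id z *\<^sub>C h x) \<and>
      (\<forall>a b. h (a \<otimes> b) = g a b y)" for y
    by (rule tensor_extension_exists) (auto simp: g_add1 g_add2 g_sc1 g_sc2)
  then obtain h where h: "\<And>y x x'. h y (x + x') = h y x + h y x'"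
      "\<And>y z x. h y (z *\<^sub>C x) = z *\<^sub>C h y x" "\<And>y a b. h y (a \<otimes> b) = g a b y"
    by (metis id_apply)
  have h_add: "h (y + y') x = h y x + h y' x" for y y' x
    by (induction x rule: tensor_induct) (auto simp: h g algebra_simps)
  have h_sc: "h (z *\<^sub>C y) x = z *\<^sub>C h y x" for z y x
    by (induction x rule: tensor_induct) (auto simp: h g scaleC_add_right)
  have zero: "a \<otimes> (0::'b) = 0" for a :: 'a
    using tensor_scaleC_right[of a 0 "0::'b"] by simp
  have neg: "(- a) \<otimes> (b::'b) = - (a \<otimes> b)" for a :: 'a and b
    using tensor_scaleC_left[of "-1" a b] by (simp add: scaleC_minus_one)
  have f_hom: "f a b A B = grade_sign s t *\<^sub>C ((a * A) \<otimes> (b * B))"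
    if "s \<in> {1, -1}" "t \<in> {1, -1}" "b \<in> graded_part \<beta> s" "A \<in> graded_part \<alpha> t" for a b A B s t
    using that(1,2,4) graded_comp_same[OF that(1,3)]
    by (auto simp: f_def grade_sign_def graded_part_def zero neg scaleC_minus_one scaleC_one)
  have "is_fermi_mult \<alpha> \<beta> (\<lambda>x y. h y x)"
    unfolding is_fermi_mult_def cbilinear_iff using f_hom by (simp add: h h_add h_sc g)
  then show ?thesis by blast
qed

lemma is_fermi_multD:
  assumes "is_fermi_mult \<alpha> \<beta> m" "r \<in> {1, -1}" "s \<in> {1, -1}" "t \<in> {1, -1}" "u \<in> {1, -1}"
    "a \<in> graded_part \<alpha> r" "b \<in> graded_part \<beta> s" "A \<in> graded_part \<alpha> t" "B \<in> graded_part \<beta> u"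
  shows "m (a \<otimes> b) (A \<otimes> B) = grade_sign s t *\<^sub>C ((a * A) \<otimes> (b * B))"
  by (rule assms(1)[unfolded is_fermi_mult_def, THEN conjunct2, rule_format,
        OF assms(2) assms(3) assms(4) assms(5) assms(6) assms(7) assms(8) assms(9)])

lemma is_fermi_starD:
  assumes "is_fermi_star \<alpha> \<beta> f" "r \<in> {1, -1}" "s \<in> {1, -1}"
    "a \<in> graded_part \<alpha> r" "b \<in> graded_part \<beta> s"
  shows "f (a \<otimes> b) = grade_sign r s *\<^sub>C (star a \<otimes> star b)"
  by (rule assms(1)[unfolded is_fermi_star_def, THEN conjunct2, rule_format,
        OF assms(2) assms(3) assms(4) assms(5)])

lemma fermi_mult_correct:
  assumes \<alpha>: "z2_grading \<alpha>" and \<beta>: "z2_grading \<beta>"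
  shows "is_fermi_mult \<alpha> \<beta> (fermi_mult \<alpha> \<beta>)"
  unfolding fermi_mult_def
proof (rule theI'[of "is_fermi_mult \<alpha> \<beta>"])
  show "\<exists>!m. is_fermi_mult \<alpha> \<beta> m"
  proof (rule ex_ex1I)
    show "\<exists>m. is_fermi_mult \<alpha> \<beta> m"
      by (rule fermi_mult_exists[OF assms])
    fix m m' assume m: "is_fermi_mult \<alpha> \<beta> m" and m': "is_fermi_mult \<alpha> \<beta> m'"
    have "m x y = m' x y" for x y
      using \<alpha> \<beta>
    proof (induction x rule: tensor_graded_induct)
      case (tensor r s a b)
      show ?case using \<alpha> \<beta>
      proof (induction y rule: tensor_graded_induct)
        case (tensor t u A B)
        then show ?case
          using \<open>r \<in> _\<close> \<open>s \<in> _\<close> \<open>a \<in> _\<close> \<open>b \<in> _\<close>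
          by (simp only: is_fermi_multD[OF m, of r s t u] is_fermi_multD[OF m', of r s t u])
      next
        case (add y y')
        then show ?case using m m' by (simp add: is_fermi_mult_def cbilinear_iff)
      qed
    next
      case (add x x')
      then show ?case using m m' by (simp add: is_fermi_mult_def cbilinear_iff)
    qed
    then show "m = m'" by (simp add: fun_eq_iff)
  qed
qed

lemma fermi_star_correct:
  fixes \<alpha> :: "'a::cstar_algebra \<Rightarrow> 'a" and \<beta> :: "'b::cstar_algebra \<Rightarrow> 'b"
  assumes \<alpha>: "z2_grading \<alpha>" and \<beta>: "z2_grading \<beta>"
  shows "is_fermi_star \<alpha> \<beta> (fermi_star \<alpha> \<beta>)"
  unfolding fermi_star_def
proof (rule theI'[of "is_fermi_star \<alpha> \<beta>"])
  show "\<exists>!f. is_fermi_star \<alpha> \<beta> f"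
  proof (rule ex_ex1I)
    fix f f' assume f: "is_fermi_star \<alpha> \<beta> f" and f': "is_fermi_star \<alpha> \<beta> f'"
    have "f x = f' x" for x
      using \<alpha> \<beta>
    proof (induction x rule: tensor_graded_induct)
      case (tensor r s a b)
      then show ?case
        by (simp only: is_fermi_starD[OF f, of r s] is_fermi_starD[OF f', of r s])
    next
      case (add x x')
      then show ?case using f f' by (simp add: is_fermi_star_def antilinear_def)
    qed
    then show "f = f'" by (simp add: fun_eq_iff)
  next
    note lin = z2_gradingD[OF \<alpha>] z2_gradingD[OF \<beta>] graded_comp_linear[OF \<beta>] tensor_add_left tensor_add_right
      tensor_scaleC_left tensor_scaleC_right star_add star_scaleC scaleC_add_right
    define f :: "'a \<Rightarrow> 'b \<Rightarrow> ('a, 'b) tensor" where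
      "f a b = star a \<otimes> star (graded_comp \<beta> 1 b) + star (\<alpha> a) \<otimes> star (graded_comp \<beta> (-1) b)" for a b
    have "\<exists>g. (\<forall>x y. g (x + y) = g x + g y) \<and> (\<forall>z x. g (z *\<^sub>C x) = cnj z *\<^sub>C g x) \<and>
        (\<forall>a b. g (a \<otimes> b) = f a b)"
      by (rule tensor_extension_exists) (auto simp: f_def lin algebra_simps)
    then obtain g where g: "\<And>x y. g (x + y) = g x + g y" "\<And>z x. g (z *\<^sub>C x) = cnj z *\<^sub>C g x"
        "\<And>a b. g (a \<otimes> b) = f a b"
      by metis
    have zero: "a \<otimes> star (0::'b) = 0" for a :: 'a
      using tensor_scaleC_right[of a 0 "0::'b"] star_scaleC[of 0 "0::'b"] by simp
    have neg: "star (- a) \<otimes> (b::'b) = - (star a \<otimes> b)" for a :: 'a and b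
      using tensor_scaleC_left[of "-1" "star a" b] star_scaleC[of "-1" a] by (simp add: scaleC_minus_one)
    have "f a b = grade_sign r s *\<^sub>C (star a \<otimes> star b)"
      if "r \<in> {1, -1}" "s \<in> {1, -1}" "a \<in> graded_part \<alpha> r" "b \<in> graded_part \<beta> s" for r s a b
      using that(1-3) graded_comp_same[OF that(2,4)]
      by (auto simp: f_def grade_sign_def graded_part_def zero neg scaleC_minus_one scaleC_one)
    then have "is_fermi_star \<alpha> \<beta> g"
      unfolding is_fermi_star_def antilinear_def by (simp add: g)
    then show "\<exists>f. is_fermi_star \<alpha> \<beta> f" by blast
  qed
qed

text \<open>A multiplication and an involution on a complex vector space that make it a (not necessarily
  unital) complex \<open>*\<close>-algebra.\<close>

definition star_algebra :: "('t::complex_vector \<Rightarrow> 't \<Rightarrow> 't) \<Rightarrow> ('t \<Rightarrow> 't) \<Rightarrow> bool"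
  where "star_algebra mul ast \<longleftrightarrow> cbilinear mul \<and>
    (\<forall>x y w. mul (mul x y) w = mul x (mul y w)) \<and>
    antilinear ast \<and> (\<forall>x. ast (ast x) = x) \<and> (\<forall>x y. ast (mul x y) = mul (ast y) (ast x))"

lemma graded_part_mult:
  assumes "z2_grading \<theta>" "a \<in> graded_part \<theta> r" "b \<in> graded_part \<theta> s"
  shows "a * b \<in> graded_part \<theta> (r * s)"
  using assms(2,3)
  by (simp add: graded_part_def z2_gradingD[OF assms(1)] mult_scaleC_left mult_scaleC_right)

lemma graded_part_star:
  assumes "z2_grading \<theta>" "r \<in> {1, -1}" "a \<in> graded_part \<theta> r"
  shows "star a \<in> graded_part \<theta> r"
  using assms(2,3) by (auto simp: graded_part_def z2_gradingD[OF assms(1)] star_scaleC)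

lemma fermi_star_algebra:
  fixes \<alpha> :: "'a::cstar_algebra \<Rightarrow> 'a" and \<beta> :: "'b::cstar_algebra \<Rightarrow> 'b"
  assumes \<alpha>: "z2_grading \<alpha>" and \<beta>: "z2_grading \<beta>"
  shows "star_algebra (fermi_mult \<alpha> \<beta>) (fermi_star \<alpha> \<beta>)"
proof -
  let ?m = "fermi_mult \<alpha> \<beta>" and ?s = "fermi_star \<alpha> \<beta>"
  note m = fermi_mult_correct[OF \<alpha> \<beta>] and s = fermi_star_correct[OF \<alpha> \<beta>]
  note mD = is_fermi_multD[OF m] and sD = is_fermi_starD[OF s]
  have bil: "cbilinear ?m" and anti: "antilinear ?s"
    using m s by (auto simp: is_fermi_mult_def is_fermi_star_def)
  have lin: "?m (x + y) w = ?m x w + ?m y w" "?m w (x + y) = ?m w x + ?m w y"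
      "?m (z *\<^sub>C x) w = z *\<^sub>C ?m x w" "?m w (z *\<^sub>C x) = z *\<^sub>C ?m w x"
      "?s (x + y) = ?s x + ?s y" "?s (z *\<^sub>C x) = cnj z *\<^sub>C ?s x" for x y w z
    using bil anti unfolding cbilinear_iff antilinear_def by auto
  have pm: "r * s \<in> {1, -1}" if "r \<in> {1, -1}" "s \<in> {1, -1}" for r s :: complex
    using that by auto
  note gm = graded_part_mult[OF \<alpha>] graded_part_mult[OF \<beta>]
  note gs = graded_part_star[OF \<alpha>] graded_part_star[OF \<beta>]
  have assoc: "?m (?m x y) w = ?m x (?m y w)" for x y w
    using \<alpha> \<beta>
  proof (induction x rule: tensor_graded_induct)
    case (tensor r s a b)
    note 1 = this
    show ?case using \<alpha> \<beta>
    proof (induction y rule: tensor_graded_induct)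
      case (tensor t u A B)
      note 2 = this
      show ?case using \<alpha> \<beta>
      proof (induction w rule: tensor_graded_induct)
        case (tensor v q X Y)
        note 3 = this
        have "?m (?m (a \<otimes> b) (A \<otimes> B)) (X \<otimes> Y) =
            (grade_sign s t * grade_sign (s * u) v) *\<^sub>C ((a * A * X) \<otimes> (b * B * Y))"
          using mD[OF 1(1,2) 2(1,2) 1(3,4) 2(3,4)]
            mD[OF pm[OF 1(1) 2(1)] pm[OF 1(2) 2(2)] 3(1,2) gm(1)[OF 1(3) 2(3)] gm(2)[OF 1(4) 2(4)] 3(3,4)]
          by (simp add: lin scaleC_scaleC)
        moreover have "?m (a \<otimes> b) (?m (A \<otimes> B) (X \<otimes> Y)) =
            (grade_sign u v * grade_sign s (t * v)) *\<^sub>C ((a * (A * X)) \<otimes> (b * (B * Y)))"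
          using mD[OF 2(1,2) 3(1,2) 2(3,4) 3(3,4)]
            mD[OF 1(1,2) pm[OF 2(1) 3(1)] pm[OF 2(2) 3(2)] 1(3,4) gm(1)[OF 2(3) 3(3)] gm(2)[OF 2(4) 3(4)]]
          by (simp add: lin scaleC_scaleC)
        moreover have "grade_sign s t * grade_sign (s * u) v = grade_sign u v * grade_sign s (t * v)"
          using 1(1,2) 2(1,2) 3(1,2) by (auto simp: grade_sign_def)
        ultimately show ?case by (simp add: mult.assoc)
      qed (simp add: lin)
    qed (simp add: lin)
  qed (simp add: lin)
  have invol: "?s (?s x) = x" for x
    using \<alpha> \<beta>
  proof (induction x rule: tensor_graded_induct)
    case (tensor r s a b)
    have "cnj (grade_sign r s) * grade_sign r s = 1"
      by (simp add: grade_sign_def)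
    then show ?case
      using sD[OF tensor] sD[OF tensor(1,2) gs(1)[OF tensor(1,3)] gs(2)[OF tensor(2,4)]]
      by (simp add: lin scaleC_scaleC star_star scaleC_one)
  qed (simp add: lin)
  have anti_mult: "?s (?m x y) = ?m (?s y) (?s x)" for x y
    using \<alpha> \<beta>
  proof (induction x rule: tensor_graded_induct)
    case (tensor r s a b)
    note 1 = this
    show ?case using \<alpha> \<beta>
    proof (induction y rule: tensor_graded_induct)
      case (tensor t u A B)
      note 2 = this
      have "?s (?m (a \<otimes> b) (A \<otimes> B)) =
          (cnj (grade_sign s t) * grade_sign (r * t) (s * u)) *\<^sub>C ((star A * star a) \<otimes> (star B * star b))"
        using mD[OF 1(1,2) 2(1,2) 1(3,4) 2(3,4)]
          sD[OF pm[OF 1(1) 2(1)] pm[OF 1(2) 2(2)] gm(1)[OF 1(3) 2(3)] gm(2)[OF 1(4) 2(4)]]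
        by (simp add: lin scaleC_scaleC star_mult)
      moreover have "?m (?s (A \<otimes> B)) (?s (a \<otimes> b)) =
          (grade_sign t u * grade_sign r s * grade_sign u r) *\<^sub>C ((star A * star a) \<otimes> (star B * star b))"
        using sD[OF 1] sD[OF 2] mD[OF 2(1,2) 1(1,2) gs(1)[OF 2(1,3)] gs(2)[OF 2(2,4)]
            gs(1)[OF 1(1,3)] gs(2)[OF 1(2,4)]]
        by (simp add: lin scaleC_scaleC)
      moreover have "cnj (grade_sign s t) * grade_sign (r * t) (s * u) =
          grade_sign t u * grade_sign r s * grade_sign u r"
        using 1(1,2) 2(1,2) by (auto simp: grade_sign_def)
      ultimately show ?case by simp
    qed (simp add: lin)
  qed (simp add: lin)
  show ?thesis
    unfolding star_algebra_def using bil anti assoc invol anti_mult by blast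
qed

section \<open>Hilbert spaces and representations\<close>

text \<open>Hilbert spaces are carrier-based, so that one formula can quantify over all of them (with
  vectors drawn from a given type).\<close>

record 'h inner_space =
  hcarrier :: "'h set"
  hzero :: 'h
  hadd :: "'h \<Rightarrow> 'h \<Rightarrow> 'h"
  hscale :: "complex \<Rightarrow> 'h \<Rightarrow> 'h"
  hinner :: "'h \<Rightarrow> 'h \<Rightarrow> complex"

definition hnorm :: "'h inner_space \<Rightarrow> 'h \<Rightarrow> real"
  where "hnorm H x = sqrt (Re (hinner H x x))"

definition hdist :: "'h inner_space \<Rightarrow> 'h \<Rightarrow> 'h \<Rightarrow> real"
  where "hdist H x y = hnorm H (hadd H x (hscale H (-1) y))"

locale pre_hilbert_space =
  fixes H :: "'h inner_space"
  assumes hzero_closed [simp]: "hzero H \<in> hcarrier H"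
    and hadd_closed [simp]: "\<lbrakk>x \<in> hcarrier H; y \<in> hcarrier H\<rbrakk> \<Longrightarrow> hadd H x y \<in> hcarrier H"
    and hscale_closed [simp]: "x \<in> hcarrier H \<Longrightarrow> hscale H z x \<in> hcarrier H"
    and hadd_assoc: "\<lbrakk>x \<in> hcarrier H; y \<in> hcarrier H; w \<in> hcarrier H\<rbrakk> \<Longrightarrow>
      hadd H (hadd H x y) w = hadd H x (hadd H y w)"
    and hadd_commute: "\<lbrakk>x \<in> hcarrier H; y \<in> hcarrier H\<rbrakk> \<Longrightarrow> hadd H x y = hadd H y x"
    and hadd_zero: "x \<in> hcarrier H \<Longrightarrow> hadd H x (hzero H) = x"
    and hadd_minus: "x \<in> hcarrier H \<Longrightarrow> hadd H x (hscale H (-1) x) = hzero H"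
    and hscale_add_right: "\<lbrakk>x \<in> hcarrier H; y \<in> hcarrier H\<rbrakk> \<Longrightarrow>
      hscale H z (hadd H x y) = hadd H (hscale H z x) (hscale H z y)"
    and hscale_add_left: "x \<in> hcarrier H \<Longrightarrow> hscale H (z + z') x = hadd H (hscale H z x) (hscale H z' x)"
    and hscale_hscale: "x \<in> hcarrier H \<Longrightarrow> hscale H z (hscale H z' x) = hscale H (z * z') x"
    and hscale_one: "x \<in> hcarrier H \<Longrightarrow> hscale H 1 x = x"
    and hinner_add_left: "\<lbrakk>x \<in> hcarrier H; y \<in> hcarrier H; w \<in> hcarrier H\<rbrakk> \<Longrightarrow>
      hinner H (hadd H x y) w = hinner H x w + hinner H y w"
    and hinner_scale_left: "\<lbrakk>x \<in> hcarrier H; y \<in> hcarrier H\<rbrakk> \<Longrightarrow>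
      hinner H (hscale H z x) y = z * hinner H x y"
    and hinner_commute: "\<lbrakk>x \<in> hcarrier H; y \<in> hcarrier H\<rbrakk> \<Longrightarrow> hinner H y x = cnj (hinner H x y)"
    and hinner_nonneg: "x \<in> hcarrier H \<Longrightarrow> 0 \<le> Re (hinner H x x)"
    and hinner_eq_zero: "\<lbrakk>x \<in> hcarrier H; hinner H x x = 0\<rbrakk> \<Longrightarrow> x = hzero H"

locale hilbert_space = pre_hilbert_space +
  assumes hcomplete: "\<lbrakk>range s \<subseteq> hcarrier H; \<And>e. 0 < e \<Longrightarrow> \<exists>N. \<forall>m\<ge>N. \<forall>n\<ge>N. hdist H (s m) (s n) < e\<rbrakk> \<Longrightarrow>
    \<exists>x\<in>hcarrier H. (\<lambda>n. hdist H (s n) x) \<longlonglongrightarrow> 0"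

definition bounded_operators :: "'h inner_space \<Rightarrow> ('h \<Rightarrow> 'h) set"
  where "bounded_operators H = {T. (\<forall>v\<in>hcarrier H. T v \<in> hcarrier H) \<and>
    (\<forall>v\<in>hcarrier H. \<forall>w\<in>hcarrier H. T (hadd H v w) = hadd H (T v) (T w)) \<and>
    (\<forall>z. \<forall>v\<in>hcarrier H. T (hscale H z v) = hscale H z (T v)) \<and>
    (\<exists>M. \<forall>v\<in>hcarrier H. hnorm H (T v) \<le> M * hnorm H v)}"

definition op_norm :: "'h inner_space \<Rightarrow> ('h \<Rightarrow> 'h) \<Rightarrow> real"
  where "op_norm H T = (SUP v\<in>{v \<in> hcarrier H. hnorm H v \<le> 1}. hnorm H (T v))"

text \<open>The values of operators outside the carrier are irrelevant, so equality of operators is tested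
  on the carrier. The last clause says that \<open>\<pi> (ast c)\<close> is the adjoint of \<open>\<pi> c\<close>.\<close>

definition representation :: "('t::complex_vector \<Rightarrow> 't \<Rightarrow> 't) \<Rightarrow> ('t \<Rightarrow> 't) \<Rightarrow>
    'h inner_space \<Rightarrow> ('t \<Rightarrow> 'h \<Rightarrow> 'h) \<Rightarrow> bool"
  where "representation mul ast H \<pi> \<longleftrightarrow> hilbert_space H \<and> (\<forall>c. \<pi> c \<in> bounded_operators H) \<and>
    (\<forall>c d. \<forall>v\<in>hcarrier H. \<pi> (c + d) v = hadd H (\<pi> c v) (\<pi> d v)) \<and>
    (\<forall>z c. \<forall>v\<in>hcarrier H. \<pi> (z *\<^sub>C c) v = hscale H z (\<pi> c v)) \<and>
    (\<forall>c d. \<forall>v\<in>hcarrier H. \<pi> (mul c d) v = \<pi> c (\<pi> d v)) \<and>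
    (\<forall>c. \<forall>v\<in>hcarrier H. \<forall>w\<in>hcarrier H. hinner H (\<pi> (ast c) v) w = hinner H v (\<pi> c w))"

text \<open>The supremum ranges over the Hilbert spaces whose vectors are taken from the type
  \<^typ>\<open>nat \<Rightarrow> complex \<times> 't\<close>. This is no restriction: by \<open>op_norm_le_max_seminorm\<close> below, it also
  dominates every representation on a Hilbert space with vectors in an arbitrary type.\<close>

definition max_seminorm :: "('t::complex_vector \<Rightarrow> 't \<Rightarrow> 't) \<Rightarrow> ('t \<Rightarrow> 't) \<Rightarrow> 't \<Rightarrow> ennreal"
  where "max_seminorm mul ast c =
    (SUP (H, \<pi>) \<in> {(H :: (nat \<Rightarrow> complex \<times> 't) inner_space, \<pi>). representation mul ast H \<pi>}.
      ennreal (op_norm H (\<pi> c)))"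

definition cstar_norm :: "('t::complex_vector \<Rightarrow> 't \<Rightarrow> 't) \<Rightarrow> ('t \<Rightarrow> 't) \<Rightarrow> ('t \<Rightarrow> real) \<Rightarrow> bool"
  where "cstar_norm mul ast N \<longleftrightarrow>
    star_algebra mul ast \<and> (\<forall>c. 0 \<le> N c) \<and> (\<forall>c. N c = 0 \<longleftrightarrow> c = 0) \<and> (\<forall>c d. N (c + d) \<le> N c + N d) \<and>
    (\<forall>z c. N (z *\<^sub>C c) = cmod z * N c) \<and> (\<forall>c d. N (mul c d) \<le> N c * N d) \<and>
    (\<forall>c. N (mul (ast c) c) = (N c)\<^sup>2)"

context pre_hilbert_space
begin

lemma hinner_add_right: "\<lbrakk>x \<in> hcarrier H; y \<in> hcarrier H; w \<in> hcarrier H\<rbrakk> \<Longrightarrow>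
    hinner H w (hadd H x y) = hinner H w x + hinner H w y"
  using hinner_commute[of w "hadd H x y"] hinner_commute[of w x] hinner_commute[of w y]
  by (metis complex_cnj_add complex_cnj_cnj hadd_closed hinner_add_left)

lemma hinner_scale_right: "\<lbrakk>x \<in> hcarrier H; w \<in> hcarrier H\<rbrakk> \<Longrightarrow>
    hinner H w (hscale H z x) = cnj z * hinner H w x"
  by (metis complex_cnj_mult hinner_commute hinner_scale_left hscale_closed)

lemma hinner_zero: "x \<in> hcarrier H \<Longrightarrow> hinner H (hzero H) x = 0" "x \<in> hcarrier H \<Longrightarrow> hinner H x (hzero H) = 0"
  using hinner_add_left[of "hzero H" "hzero H" x] hinner_add_right[of "hzero H" "hzero H" x]
  by (simp_all add: hadd_zero)

lemmas hinner_simps = hinner_add_left hinner_add_right hinner_scale_left hinner_scale_right hinner_zero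

lemma Re_hinner_commute: "\<lbrakk>x \<in> hcarrier H; y \<in> hcarrier H\<rbrakk> \<Longrightarrow> Re (hinner H x y) = Re (hinner H y x)"
  by (metis complex_cnj(1) complex_cnj_cnj hinner_commute cnj.sel(1))

lemma hinner_self: "x \<in> hcarrier H \<Longrightarrow> hinner H x x = complex_of_real ((hnorm H x)\<^sup>2)"
proof -
  assume x: "x \<in> hcarrier H"
  have "Im (hinner H x x) = 0"
    using hinner_commute[OF x x] by (metis cnj.sel(2) neg_equal_zero)
  then show ?thesis
    using hinner_nonneg[OF x] by (simp add: hnorm_def complex_eq_iff)
qed

lemma hnorm_nonneg: "x \<in> hcarrier H \<Longrightarrow> 0 \<le> hnorm H x"
  by (simp add: hnorm_def hinner_nonneg)

lemma hnorm_sq: "x \<in> hcarrier H \<Longrightarrow> (hnorm H x)\<^sup>2 = Re (hinner H x x)"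
  by (simp add: hnorm_def hinner_nonneg)

lemma hnorm_eq_0: "x \<in> hcarrier H \<Longrightarrow> hnorm H x = 0 \<Longrightarrow> x = hzero H"
  using hinner_eq_zero hinner_self by simp

lemma hnorm_zero: "hnorm H (hzero H) = 0"
  by (simp add: hnorm_def hinner_zero)

lemma hnorm_scale: "x \<in> hcarrier H \<Longrightarrow> hnorm H (hscale H z x) = cmod z * hnorm H x"
proof -
  assume x: "x \<in> hcarrier H"
  have "hinner H (hscale H z x) (hscale H z x) = complex_of_real ((cmod z * hnorm H x)\<^sup>2)"
  proof -
    have "hinner H (hscale H z x) (hscale H z x) = (z * cnj z) * hinner H x x"
      using x by (simp add: hinner_simps)
    also have "\<dots> = complex_of_real ((cmod z * hnorm H x)\<^sup>2)"
      unfolding complex_norm_square[symmetric] hinner_self[OF x] by (simp add: power_mult_distrib)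
    finally show ?thesis .
  qed
  then show ?thesis
    using x by (simp add: hnorm_def[of H "hscale H z x"] hnorm_nonneg real_sqrt_abs)
qed

lemma hdist_sq: "\<lbrakk>x \<in> hcarrier H; y \<in> hcarrier H\<rbrakk> \<Longrightarrow>
    (hdist H x y)\<^sup>2 = Re (hinner H x x) + Re (hinner H y y) - 2 * Re (hinner H x y)"
  using Re_hinner_commute[of x y] by (simp add: hdist_def hnorm_sq hinner_simps)

lemma hdist_nonneg: "\<lbrakk>x \<in> hcarrier H; y \<in> hcarrier H\<rbrakk> \<Longrightarrow> 0 \<le> hdist H x y"
  by (simp add: hdist_def hnorm_nonneg)

lemma hdist_commute: "\<lbrakk>x \<in> hcarrier H; y \<in> hcarrier H\<rbrakk> \<Longrightarrow> hdist H x y = hdist H y x"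
  by (rule power2_eq_imp_eq) (simp_all add: hdist_sq hdist_nonneg Re_hinner_commute[of x y])

lemma hdist_self: "x \<in> hcarrier H \<Longrightarrow> hdist H x x = 0"
  by (simp add: hdist_def hadd_minus hnorm_zero)

lemma hdist_eq_0:
  assumes x: "x \<in> hcarrier H" and y: "y \<in> hcarrier H" and "hdist H x y = 0"
  shows "x = y"
proof -
  let ?m = "hscale H (-1) y"
  have 0: "hadd H x ?m = hzero H"
    using assms by (intro hnorm_eq_0) (auto simp: hdist_def)
  have "x = hadd H x (hadd H ?m y)"
    using x y by (simp add: hadd_commute[of ?m y] hadd_minus hadd_zero)
  also have "\<dots> = hadd H (hadd H x ?m) y"
    using x y by (simp add: hadd_assoc)
  also have "\<dots> = y"
    using y by (simp add: 0 hadd_commute[of "hzero H"] hadd_zero)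
  finally show ?thesis .
qed

lemma hinner_ext:
  assumes x: "x \<in> hcarrier H" and y: "y \<in> hcarrier H"
    and eq: "\<And>w. w \<in> hcarrier H \<Longrightarrow> hinner H x w = hinner H y w"
  shows "x = y"
proof (rule hdist_eq_0[OF x y])
  have "(hdist H x y)\<^sup>2 = 0"
    using x y by (simp add: hdist_sq eq)
      (metis Re_hinner_commute add_diff_cancel_right' diff_self eq mult_2)
  then show "hdist H x y = 0" by simp
qed

lemma Re_hinner_le:
  assumes x: "x \<in> hcarrier H" and y: "y \<in> hcarrier H"
  shows "Re (hinner H x y) \<le> hnorm H x * hnorm H y"
proof (cases "hnorm H y = 0")
  case True
  then show ?thesis using hnorm_eq_0[OF y] x by (simp add: hinner_zero)
next
  case False
  define t where "t = Re (hinner H x y) / (hnorm H y)\<^sup>2"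
  let ?u = "hadd H x (hscale H (complex_of_real (- t)) y)"
  have "0 \<le> Re (hinner H ?u ?u)"
    using x y by (simp add: hinner_nonneg)
  also have "\<dots> = (hnorm H x)\<^sup>2 - 2 * t * Re (hinner H x y) + t\<^sup>2 * (hnorm H y)\<^sup>2"
    using x y Re_hinner_commute[OF x y]
    by (simp add: hinner_simps hinner_self[OF x] hinner_self[OF y] algebra_simps power2_eq_square)
  also have "\<dots> = (hnorm H x)\<^sup>2 - (Re (hinner H x y))\<^sup>2 / (hnorm H y)\<^sup>2"
    using False by (simp add: t_def field_simps power2_eq_square)
  finally have "(Re (hinner H x y))\<^sup>2 \<le> (hnorm H x * hnorm H y)\<^sup>2"
    using False by (simp add: field_simps power_mult_distrib)
  then show ?thesis
    using power2_le_imp_le hnorm_nonneg[OF x] hnorm_nonneg[OF y] by (meson mult_nonneg_nonneg)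
qed

lemma hnorm_add_le:
  assumes x: "x \<in> hcarrier H" and y: "y \<in> hcarrier H"
  shows "hnorm H (hadd H x y) \<le> hnorm H x + hnorm H y"
proof (rule power2_le_imp_le)
  have "(hnorm H (hadd H x y))\<^sup>2 = (hnorm H x)\<^sup>2 + (hnorm H y)\<^sup>2 + 2 * Re (hinner H x y)"
    using x y Re_hinner_commute[OF x y] by (simp add: hnorm_sq hinner_simps)
  also have "\<dots> \<le> (hnorm H x + hnorm H y)\<^sup>2"
    using Re_hinner_le[OF x y] by (simp add: power2_eq_square algebra_simps)
  finally show "(hnorm H (hadd H x y))\<^sup>2 \<le> (hnorm H x + hnorm H y)\<^sup>2" .
qed (use x y in \<open>simp add: hnorm_nonneg\<close>)

lemma hdist_triangle:
  assumes x: "x \<in> hcarrier H" and y: "y \<in> hcarrier H" and w: "w \<in> hcarrier H"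
  shows "hdist H x w \<le> hdist H x y + hdist H y w"
proof -
  have "hadd H x (hscale H (-1) w) = hadd H (hadd H x (hscale H (-1) y)) (hadd H y (hscale H (-1) w))"
    using x y w by (intro hinner_ext) (simp_all add: hinner_simps)
  then show ?thesis
    unfolding hdist_def using x y w by (simp add: hnorm_add_le)
qed

lemma hdist_add:
  assumes "x \<in> hcarrier H" "y \<in> hcarrier H" "x' \<in> hcarrier H" "y' \<in> hcarrier H"
  shows "hdist H (hadd H x y) (hadd H x' y') \<le> hdist H x x' + hdist H y y'"
proof -
  have "hadd H (hadd H x y) (hscale H (-1) (hadd H x' y')) =
      hadd H (hadd H x (hscale H (-1) x')) (hadd H y (hscale H (-1) y'))"
    using assms by (intro hinner_ext) (simp_all add: hinner_simps algebra_simps)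
  then show ?thesis
    unfolding hdist_def using assms by (simp add: hnorm_add_le)
qed

lemma hdist_scale:
  assumes "x \<in> hcarrier H" "y \<in> hcarrier H"
  shows "hdist H (hscale H z x) (hscale H z y) = cmod z * hdist H x y"
proof -
  have "hadd H (hscale H z x) (hscale H (-1) (hscale H z y)) = hscale H z (hadd H x (hscale H (-1) y))"
    using assms by (intro hinner_ext) (simp_all add: hinner_simps algebra_simps)
  then show ?thesis
    unfolding hdist_def using assms by (simp add: hnorm_scale)
qed

lemma hscale_zero: "x \<in> hcarrier H \<Longrightarrow> hscale H 0 x = hzero H"
  by (intro hinner_ext) (simp_all add: hinner_simps)

lemma hdist_bounded_operator:
  assumes T: "T \<in> bounded_operators H"
  obtains M where "\<And>x y. \<lbrakk>x \<in> hcarrier H; y \<in> hcarrier H\<rbrakk> \<Longrightarrow> hdist H (T x) (T y) \<le> M * hdist H x y"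
proof -
  obtain M where M: "\<And>v. v \<in> hcarrier H \<Longrightarrow> hnorm H (T v) \<le> M * hnorm H v"
    using T unfolding bounded_operators_def by blast
  show thesis
  proof
    fix x y assume xy: "x \<in> hcarrier H" "y \<in> hcarrier H"
    have "hadd H (T x) (hscale H (-1) (T y)) = T (hadd H x (hscale H (-1) y))"
      using T xy by (simp add: bounded_operators_def)
    then show "hdist H (T x) (T y) \<le> M * hdist H x y"
      unfolding hdist_def using M xy by simp
  qed
qed

lemma op_norm_bdd:
  assumes T: "T \<in> bounded_operators H"
  shows "bdd_above ((\<lambda>v. hnorm H (T v)) ` {v \<in> hcarrier H. hnorm H v \<le> 1})"
proof -
  obtain M where M: "\<And>v. v \<in> hcarrier H \<Longrightarrow> hnorm H (T v) \<le> M * hnorm H v"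
    using T unfolding bounded_operators_def by blast
  have "hnorm H (T v) \<le> \<bar>M\<bar>" if v: "v \<in> hcarrier H" "hnorm H v \<le> 1" for v
  proof -
    have "hnorm H (T v) \<le> M * hnorm H v" using M v by blast
    also have "\<dots> \<le> \<bar>M\<bar> * 1"
      using v hnorm_nonneg[OF v(1)] by (intro mult_mono) auto
    finally show ?thesis by simp
  qed
  then show ?thesis by (intro bdd_aboveI2) auto
qed

lemma hnorm_le_op_norm:
  assumes "T \<in> bounded_operators H" "v \<in> hcarrier H" "hnorm H v \<le> 1"
  shows "hnorm H (T v) \<le> op_norm H T"
  unfolding op_norm_def using assms by (intro cSUP_upper op_norm_bdd) auto

end

text \<open>Transport of a closed invariant subspace \<open>K\<close> along an injection into another type.\<close>

definition transport_space :: "'h inner_space \<Rightarrow> 'h set \<Rightarrow> ('h \<Rightarrow> 'k) \<Rightarrow> 'k inner_space"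
  where "transport_space H K j = (let g = inv_into K j in
    \<lparr>hcarrier = j ` K, hzero = j (hzero H), hadd = (\<lambda>u v. j (hadd H (g u) (g v))),
     hscale = (\<lambda>z u. j (hscale H z (g u))), hinner = (\<lambda>u v. hinner H (g u) (g v))\<rparr>)"

lemma representation_transport:
  fixes H :: "'h inner_space" and j :: "'h \<Rightarrow> 'k"
  assumes rep: "representation mul ast H \<pi>" and j: "inj_on j K" and K: "K \<subseteq> hcarrier H"
    and zero: "hzero H \<in> K" and add: "\<And>x y. \<lbrakk>x \<in> K; y \<in> K\<rbrakk> \<Longrightarrow> hadd H x y \<in> K"
    and scale: "\<And>z x. x \<in> K \<Longrightarrow> hscale H z x \<in> K" and \<pi>: "\<And>c x. x \<in> K \<Longrightarrow> \<pi> c x \<in> K"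
    and closed: "\<And>s x. \<lbrakk>range s \<subseteq> K; x \<in> hcarrier H; (\<lambda>n. hdist H (s n) x) \<longlonglongrightarrow> 0\<rbrakk> \<Longrightarrow> x \<in> K"
  shows "representation mul ast (transport_space H K j) (\<lambda>c u. j (\<pi> c (inv_into K j u)))"
    and "\<And>x. x \<in> K \<Longrightarrow> hnorm (transport_space H K j) (j x) = hnorm H x"
proof -
  let ?H = "transport_space H K j" and ?g = "inv_into K j"
  interpret hilbert_space H
    using rep by (simp add: representation_def)
  have sel: "hcarrier ?H = j ` K" "hzero ?H = j (hzero H)" "hadd ?H = (\<lambda>u v. j (hadd H (?g u) (?g v)))"
      "hscale ?H = (\<lambda>z u. j (hscale H z (?g u)))" "hinner ?H = (\<lambda>u v. hinner H (?g u) (?g v))"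
    by (simp_all add: transport_space_def Let_def)
  have g [simp]: "?g (j x) = x" if "x \<in> K" for x
    using j that by simp
  have C: "x \<in> hcarrier H" if "x \<in> K" for x
    using that K by blast
  have n: "hnorm ?H (j x) = hnorm H x" if "x \<in> K" for x
    using that by (simp add: hnorm_def sel)
  then show "\<And>x. x \<in> K \<Longrightarrow> hnorm ?H (j x) = hnorm H x" by blast
  have d: "hdist ?H (j x) (j y) = hdist H x y" if "x \<in> K" "y \<in> K" for x y
  proof -
    have "hdist ?H (j x) (j y) = hnorm ?H (j (hadd H x (hscale H (-1) y)))"
      using that by (simp add: hdist_def sel scale)
    then show ?thesis
      using that by (simp add: n add scale hdist_def)
  qed
  have "pre_hilbert_space ?H"
  proof (unfold_locales, goal_cases)
    case (14 x y) then show ?case by (auto simp: sel intro!: hinner_commute C)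
  next
    case (15 x) then show ?case by (auto simp: sel intro!: hinner_nonneg C)
  next
    case (16 x) then show ?case by (auto simp: sel intro!: arg_cong[of _ _ j] hinner_eq_zero C)
  qed (auto simp: sel zero add scale C hadd_assoc hadd_zero hadd_minus hscale_add_right hscale_add_left
      hscale_hscale hscale_one hinner_add_left hinner_scale_left intro!: arg_cong[of _ _ j] hadd_commute)
  moreover have "hilbert_space_axioms ?H"
  proof
    fix s :: "nat \<Rightarrow> 'k"
    assume s: "range s \<subseteq> hcarrier ?H"
      and cauchy: "\<And>e. 0 < e \<Longrightarrow> \<exists>N. \<forall>m\<ge>N. \<forall>n\<ge>N. hdist ?H (s m) (s n) < e"
    define t where "t n = ?g (s n)" for n
    have t: "t n \<in> K" "s n = j (t n)" for n
      using s unfolding t_def sel by (auto simp: subset_iff inv_into_into f_inv_into_f)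
    have "\<exists>x\<in>hcarrier H. (\<lambda>n. hdist H (t n) x) \<longlonglongrightarrow> 0"
      using cauchy by (intro hcomplete) (auto simp: t d C)
    then obtain x where x: "x \<in> hcarrier H" "(\<lambda>n. hdist H (t n) x) \<longlonglongrightarrow> 0" by blast
    then have "x \<in> K" using t by (intro closed[of t]) auto
    then show "\<exists>x\<in>hcarrier ?H. (\<lambda>n. hdist ?H (s n) x) \<longlonglongrightarrow> 0"
      using x t by (intro bexI[of _ "j x"]) (auto simp: d sel)
  qed
  ultimately have "hilbert_space ?H"
    by (simp add: hilbert_space_def)
  moreover have "(\<lambda>u. j (\<pi> c (?g u))) \<in> bounded_operators ?H" for c
  proof -
    have b: "\<pi> c \<in> bounded_operators H"
      using rep by (simp add: representation_def)
    then obtain M where M: "\<And>v. v \<in> hcarrier H \<Longrightarrow> hnorm H (\<pi> c v) \<le> M * hnorm H v"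
      unfolding bounded_operators_def by blast
    have "\<exists>M. \<forall>v\<in>hcarrier ?H. hnorm ?H (j (\<pi> c (?g v))) \<le> M * hnorm ?H v"
      using M by (intro exI[of _ M]) (auto simp: sel(1) n \<pi> C)
    then show ?thesis
      using b by (auto simp: bounded_operators_def sel \<pi> add scale C)
  qed
  ultimately show "representation mul ast ?H (\<lambda>c u. j (\<pi> c (?g u)))"
    using rep unfolding representation_def by (auto simp: sel \<pi> C)
qed

lemma op_norm_le_max_seminorm:
  fixes H :: "'h inner_space" and \<pi> :: "'t::complex_vector \<Rightarrow> 'h \<Rightarrow> 'h"
  assumes rep: "representation mul ast H \<pi>"
  shows "ennreal (op_norm H (\<pi> c)) \<le> max_seminorm mul ast c"
proof -
  interpret hilbert_space H
    using rep by (simp add: representation_def)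
  have b: "\<pi> c \<in> bounded_operators H" for c
    using rep by (simp add: representation_def)
  have bD1: "\<pi> c v \<in> hcarrier H" "\<pi> c (hscale H z v) = hscale H z (\<pi> c v)"
    if "v \<in> hcarrier H" for c v z
    using b[of c] that by (auto simp: bounded_operators_def)
  have bD2: "\<pi> c (hadd H v w) = hadd H (\<pi> c v) (\<pi> c w)"
    if "v \<in> hcarrier H" "w \<in> hcarrier H" for c v w
    using b[of c] that by (auto simp: bounded_operators_def)
  note bD = bD1 bD2
  have r: "\<pi> (c + d) v = hadd H (\<pi> c v) (\<pi> d v)" "\<pi> (z *\<^sub>C c) v = hscale H z (\<pi> c v)"
      "\<pi> (mul c d) v = \<pi> c (\<pi> d v)" if "v \<in> hcarrier H" for c d z v
    using rep that by (auto simp: representation_def)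
  have key: "ennreal (hnorm H (\<pi> c v)) \<le> max_seminorm mul ast c"
    if v: "v \<in> hcarrier H" "hnorm H v \<le> 1" for v
  proof -
    define D where "D p = hadd H (hscale H (fst p) v) (\<pi> (snd p) v)" for p
    define L where "L s x \<longleftrightarrow> (\<lambda>n. hdist H (D (s n)) x) \<longlonglongrightarrow> 0" for s :: "nat \<Rightarrow> complex \<times> 't" and x
    define K where "K = {x \<in> hcarrier H. \<exists>s. L s x}"
    define j where "j x = (SOME s. L s x)" for x
    have D: "D p \<in> hcarrier H" for p
      using v by (simp add: D_def bD)
    have KC: "x \<in> hcarrier H" if "x \<in> K" for x using that by (simp add: K_def)
    have Lj: "L (j x) x" if "x \<in> K" for x
      using that unfolding K_def j_def by (auto intro: someI[where P = "\<lambda>s. L s x"])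
    have LI: "L s x" if "\<And>n. hdist H (D (s n)) x \<le> f n" "f \<longlonglongrightarrow> 0" "x \<in> hcarrier H" for s x f
      unfolding L_def using that D
      by (intro tendsto_sandwich[OF _ _ tendsto_const that(2)]) (auto simp: hdist_nonneg)
    have inj: "inj_on j K"
    proof (rule inj_onI)
      fix x y assume xy: "x \<in> K" "y \<in> K" "j x = j y"
      let ?f = "\<lambda>n. hdist H (D (j x n)) x + hdist H (D (j x n)) y"
      have "?f \<longlonglongrightarrow> 0 + 0"
        using Lj[OF xy(1)] Lj[OF xy(2)] unfolding L_def xy(3) by (rule tendsto_add)
      moreover have "hdist H x y \<le> ?f n" for n
        using hdist_triangle[OF KC[OF xy(1)] D KC[OF xy(2)], of "j x n"]
          hdist_commute[OF KC[OF xy(1)] D, of "j x n"] by simp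
      ultimately have "hdist H x y \<le> 0"
        by (intro LIMSEQ_le_const[of ?f 0 "hdist H x y"]) auto
      then show "x = y"
        using hdist_nonneg hdist_eq_0 KC xy by (meson order_antisym)
    qed
    have memK: "x \<in> K" if "x \<in> hcarrier H" "L s x" for s x
      using that by (auto simp: K_def)
    have D_in: "D p \<in> K" for p
      using D by (intro memK[of _ "\<lambda>_. p"]) (auto simp: L_def hdist_self)
    have D0: "D (0, 0) = hzero H" 
      using v r(2)[OF v(1), of 0 0] by (simp add: D_def hscale_zero bD hadd_zero)
    have D1: "D (1, 0) = v"
      using v r(2)[OF v(1), of 0 0] by (simp add: D_def hscale_zero bD hadd_zero hscale_one)
    have add: "hadd H x y \<in> K" if xy: "x \<in> K" "y \<in> K" for x y
    proof (rule memK)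
      show "hadd H x y \<in> hcarrier H" using KC xy by simp
      have e: "D (p + q) = hadd H (D p) (D q)" for p q
        using v by (intro hinner_ext) (simp_all add: D_def bD r hinner_simps algebra_simps)
      show "L (\<lambda>n. j x n + j y n) (hadd H x y)"
      proof (rule LI)
        show "hdist H (D (j x n + j y n)) (hadd H x y) \<le> hdist H (D (j x n)) x + hdist H (D (j y n)) y" for n
          unfolding e using D KC xy by (intro hdist_add) auto
        show "(\<lambda>n. hdist H (D (j x n)) x + hdist H (D (j y n)) y) \<longlonglongrightarrow> 0"
          using tendsto_add[OF Lj[OF xy(1), unfolded L_def] Lj[OF xy(2), unfolded L_def]] by simp
      qed (use KC xy in simp)
    qed
    have scale: "hscale H z x \<in> K" if x: "x \<in> K" for z x
    proof (rule memK)
      show "hscale H z x \<in> hcarrier H" using KC x by simp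
      have e: "D (z * fst p, z *\<^sub>C snd p) = hscale H z (D p)" for p
        using v by (intro hinner_ext) (simp_all add: D_def bD r hinner_simps algebra_simps)
      show "L (\<lambda>n. (z * fst (j x n), z *\<^sub>C snd (j x n))) (hscale H z x)"
        unfolding L_def e using tendsto_mult_left[OF Lj[OF x, unfolded L_def], of "cmod z"] D KC x
        by (simp add: hdist_scale)
    qed
    have inv: "\<pi> a x \<in> K" if x: "x \<in> K" for a x
    proof (rule memK)
      show "\<pi> a x \<in> hcarrier H" using KC x bD by simp
      have e: "D (0, fst p *\<^sub>C a + mul a (snd p)) = \<pi> a (D p)" for p
        using v by (intro hinner_ext) (simp_all add: D_def bD r hinner_simps algebra_simps)
      obtain M where M: "\<And>x y. \<lbrakk>x \<in> hcarrier H; y \<in> hcarrier H\<rbrakk> \<Longrightarrow>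
          hdist H (\<pi> a x) (\<pi> a y) \<le> M * hdist H x y"
        using hdist_bounded_operator[OF b] by blast
      show "L (\<lambda>n. (0, fst (j x n) *\<^sub>C a + mul a (snd (j x n)))) (\<pi> a x)"
      proof (rule LI)
        show "hdist H (D (0, fst (j x n) *\<^sub>C a + mul a (snd (j x n)))) (\<pi> a x) \<le> M * hdist H (D (j x n)) x" for n
          unfolding e using D KC x by (intro M) auto
        show "(\<lambda>n. M * hdist H (D (j x n)) x) \<longlonglongrightarrow> 0"
          using tendsto_mult_left[OF Lj[OF x, unfolded L_def], of M] by simp
      qed (use KC x bD in simp)
    qed
    have closed: "x \<in> K" if s: "range s \<subseteq> K" "x \<in> hcarrier H" "(\<lambda>n. hdist H (s n) x) \<longlonglongrightarrow> 0" for s x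
    proof -
      have sK: "s n \<in> K" for n using s(1) by auto
      have "\<exists>p. hdist H (D p) (s n) < 1 / Suc n" for n
      proof -
        have "\<exists>m. hdist H (D (j (s n) m)) (s n) < 1 / Suc n"
          using order_tendstoD(2)[OF Lj[OF sK[of n], unfolded L_def], of "1 / Suc n"]
          by (auto simp: eventually_sequentially)
        then show ?thesis by blast
      qed
      then obtain p where p: "\<And>n. hdist H (D (p n)) (s n) < 1 / Suc n" by metis
      have "L p x"
      proof (rule LI)
        show "hdist H (D (p n)) x \<le> 1 / Suc n + hdist H (s n) x" for n
          using hdist_triangle[OF D KC[OF sK] s(2), of "p n" n] p[of n] by simp
        show "(\<lambda>n. 1 / Suc n + hdist H (s n) x) \<longlonglongrightarrow> 0"
          using tendsto_add[OF LIMSEQ_Suc[OF lim_1_over_n] s(3)] by simp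
      qed (rule s(2))
      then show ?thesis using s(2) by (intro memK)
    qed
    let ?H = "transport_space H K j" and ?\<pi> = "\<lambda>c u. j (\<pi> c (inv_into K j u))"
    have zero: "hzero H \<in> K" using D_in[of "(0, 0)"] D0 by simp
    have vK: "v \<in> K" using D_in[of "(1, 0)"] D1 by simp
    have K: "K \<subseteq> hcarrier H" using KC by blast
    note tr = representation_transport[OF rep inj K zero add scale inv closed]
    interpret H': hilbert_space ?H
      using tr(1) by (simp add: representation_def)
    have "hnorm H (\<pi> c v) = hnorm ?H (?\<pi> c (j v))"
      using inj vK inv by (simp add: tr(2))
    also have "\<dots> \<le> op_norm ?H (?\<pi> c)"
    proof (rule H'.hnorm_le_op_norm)
      show "?\<pi> c \<in> bounded_operators ?H"
        using tr(1) by (simp add: representation_def)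
      show "j v \<in> hcarrier ?H"
        using vK by (simp add: transport_space_def Let_def)
      show "hnorm ?H (j v) \<le> 1"
        using v vK by (simp add: tr(2))
    qed
    finally have "ennreal (hnorm H (\<pi> c v)) \<le> ennreal (op_norm ?H (?\<pi> c))"
      by (rule ennreal_leI)
    also have "\<dots> \<le> max_seminorm mul ast c"
      unfolding max_seminorm_def using tr(1) by (intro SUP_upper2[of "(?H, ?\<pi>)"]) auto
    finally show ?thesis .
  qed
  show ?thesis
  proof (cases "max_seminorm mul ast c" rule: ennreal_cases)
    case (real m)
    have "op_norm H (\<pi> c) \<le> m"
      unfolding op_norm_def
    proof (rule cSUP_least)
      show "{v \<in> hcarrier H. hnorm H v \<le> 1} \<noteq> {}"
        using hzero_closed hnorm_zero by (metis (mono_tags, lifting) empty_iff mem_Collect_eq zero_le_one)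
      show "hnorm H (\<pi> c v) \<le> m" if "v \<in> {v \<in> hcarrier H. hnorm H v \<le> 1}" for v
        using key[of v] that real by simp
    qed
    then show ?thesis using real by (simp add: ennreal_leI)
  qed simp
qed

end

theory Submission
  imports Defs
begin

text \<open>Left multiplication by \<open>a\<close> and the graded multiplication by \<open>b\<close> on the second factor are adjointable
  multipliers of the Fermi tensor product. As \<open>1 - a\<^sup>*a\<close> is a square for \<open>\<parallel>a\<parallel> < 1\<close>, every positive
  functional \<open>\<omega>\<close> satisfies \<open>\<omega>((cx)\<^sup>*(cx)) \<le> K\<^sub>c \<omega>(x\<^sup>*x)\<close> with a constant independent of \<open>\<omega>\<close>. For the vector
  functionals of a representation this is finiteness of the seminorm; for an arbitrary \<open>\<omega>\<close> it makes
  the GNS representation bounded. No continuity of \<open>\<omega>\<close> or of the gradings is needed. Definiteness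
  follows from the product functionals \<open>\<phi> \<otimes> \<psi>\<close> of even positive functionals, which are positive and
  separate points; the existence of enough \<open>\<phi>\<close> and \<open>\<psi>\<close> is Kaplansky's positivity of \<open>x\<^sup>*x\<close> combined
  with the Hahn--Banach theorem.\<close>

section \<open>Positivity in \<open>C\<^sup>*\<close>-algebras\<close>

text \<open>No spectral theory is available, and its only substitute is a square root found as the
  fixed point of a contraction. Positivity is a norm condition on selfadjoint elements: sums of
  positive elements are then positive by the triangle inequality, and the effort goes into
  \<open>star x * x\<close>. The other obstacle is the absence of units. A GNS representation comes
  without a cyclic vector, so \<open>c\<close> is tested on the class of \<open>ast c\<close>; what
  has to be separated from zero is the product of \<open>c\<close> and \<open>ast c\<close>. A
  representation may be degenerate, so the bound on the vectors \<open>\<pi> x v\<close> has to be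
  turned into a bound on all vectors. Functionals are made even because the signs of the Fermi
  product would otherwise enter the form defined by a product functional. Averaging over the grading
  keeps a positive functional nonzero at the chosen \<open>star a * a\<close>. The supremum ranges
  over Hilbert spaces on one fixed type, whereas the GNS space consists of functions on the tensor
  product; \<open>op_norm_le_max_seminorm\<close> connects the two.\<close>

lemma star_zero [simp]: "star (0 :: 'a::cstar_algebra) = 0"
  using star_scaleC[of 0 "0 :: 'a"] by simp

lemma star_minus: "star (- x) = - star (x :: 'a::cstar_algebra)"
  using star_scaleC[of "-1" x] by (simp add: scaleC_minus_one)

lemma star_diff: "star (x - y) = star x - star (y :: 'a::cstar_algebra)"
  using star_add[of x "- y"] by (simp add: star_minus)

lemma star_scaleR: "star (r *\<^sub>R x) = r *\<^sub>R star (x :: 'a::cstar_algebra)"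
  by (simp add: scaleR_scaleC star_scaleC)

lemma norm_star: "norm (star x) = norm (x :: 'a::cstar_algebra)"
proof -
  have le: "norm y \<le> norm (star y)" for y :: 'a
  proof (cases "norm y = 0")
    case False
    have "(norm y)\<^sup>2 \<le> norm (star y) * norm y"
      unfolding norm_star_mult_self[symmetric] by (rule norm_mult_ineq)
    then show ?thesis using False by (simp add: power2_eq_square)
  qed simp
  show ?thesis using le[of x] le[of "star x"] by (simp add: star_star)
qed

lemma continuous_star: "continuous_on S (star :: 'a::cstar_algebra \<Rightarrow> 'a)"
proof -
  have "bounded_linear (star :: 'a \<Rightarrow> 'a)"
    by (rule bounded_linear_intro[where K = 1]) (simp_all add: star_add star_scaleR norm_star)
  then show ?thesis by (intro linear_continuous_on)
qed

text \<open>In the unitization \<open>1 - w\<close> is a square root of \<open>1 - x\<close>.\<close>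

lemma selfadjoint_sqrt:
  fixes x :: "'a::cstar_algebra"
  assumes x: "star x = x" "norm x < 1"
  obtains w where "star w = w" "w + w = x + w * w" "\<And>c. c * x = x * c \<Longrightarrow> c * w = w * c"
proof -
  \<comment> \<open>The set is closed and mapped into itself by \<open>f\<close>, so the fixed point
    is selfadjoint and commutes with whatever commutes with \<open>x\<close>. On the ball of radius
    \<open>norm x\<close> the two terms of a difference of squares are balanced by the factor 1/2,
    which leaves the contraction constant \<open>norm x\<close>.\<close>
  define S where "S = {w. norm w \<le> norm x} \<inter> {w. star w = w} \<inter> (\<Inter>c\<in>{c. c * x = x * c}. {w. c * w = w * c})"
  define f where "f w = (1/2) *\<^sub>R (x + w * w)" for w
  have S: "w \<in> S \<longleftrightarrow> norm w \<le> norm x \<and> star w = w \<and> (\<forall>c. c * x = x * c \<longrightarrow> c * w = w * c)" for w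
    by (auto simp: S_def)
  have "closed S"
    unfolding S_def
    by (intro closed_Int closed_INT ballI closed_Collect_le closed_Collect_eq continuous_star continuous_intros)
  then have "complete S" by (simp add: complete_eq_closed)
  moreover have "0 \<in> S" by (simp add: S)
  moreover have "f ` S \<subseteq> S"
  proof
    fix v assume "v \<in> f ` S"
    then obtain w where w: "w \<in> S" "v = f w" by blast
    then have w': "norm w \<le> norm x" "star w = w" "\<And>c. c * x = x * c \<Longrightarrow> c * w = w * c"
      unfolding S by blast+
    have "norm v = norm (x + w * w) / 2" by (simp add: w f_def)
    also have "norm (x + w * w) \<le> norm x + norm w * norm w"
      by (meson norm_triangle_ineq norm_mult_ineq add_left_mono order_trans)
    also have "norm w * norm w \<le> norm x * 1"
      using w' x by (intro mult_mono) simp_all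
    finally have "norm v \<le> norm x" by simp
    moreover have "star v = v"
      unfolding w(2) f_def star_scaleR star_add star_mult by (simp only: w'(2) x(1))
    moreover have "c * v = v * c" if c: "c * x = x * c" for c
    proof -
      have cw: "c * w = w * c" using w'(3) c .
      have "c * (w * w) = w * w * c" by (metis cw mult.assoc)
      then show ?thesis using c by (simp add: w(2) f_def distrib_left distrib_right)
    qed
    ultimately show "v \<in> S" by (simp add: S)
  qed
  moreover have "dist (f v) (f w) \<le> norm x * dist v w" if vw: "v \<in> S" "w \<in> S" for v w
  proof -
    have "f v - f w = (1/2) *\<^sub>R (v * (v - w) + (v - w) * w)"
      by (simp add: f_def algebra_simps)
    then have "dist (f v) (f w) = norm (v * (v - w) + (v - w) * w) / 2"
      by (simp add: dist_norm)
    also have "norm (v * (v - w) + (v - w) * w) \<le> norm v * norm (v - w) + norm (v - w) * norm w"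
      by (meson norm_triangle_ineq norm_mult_ineq add_mono order_trans)
    also have "\<dots> \<le> norm x * norm (v - w) + norm (v - w) * norm x"
      using vw by (intro add_mono mult_mono) (auto simp: S)
    finally show ?thesis by (simp add: dist_norm)
  qed
  ultimately have "\<exists>!w. w \<in> S \<and> f w = w"
    using x(2) by (intro Banach_fix[of S "norm x" f]) auto
  then obtain w where w: "w \<in> S" "f w = w" by blast
  have "star w = w" "\<And>c. c * x = x * c \<Longrightarrow> c * w = w * c"
    using w(1) unfolding S by blast+
  moreover have "w + w = x + w * w"
    using arg_cong[OF w(2), of "\<lambda>v. 2 *\<^sub>R v"] by (simp add: f_def scaleR_2)
  ultimately show thesis using that by blast
qed

section \<open>The positive cone of a unital algebra\<close>

lemma star_one [simp]: "star (1 :: 'a::{cstar_algebra,real_normed_algebra_1}) = 1"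
  by (metis mult_1 mult.right_neutral star_mult star_star)

lemma star_of_real [simp]: "star (of_real r :: 'a::{cstar_algebra,real_normed_algebra_1}) = of_real r"
  by (simp add: of_real_def star_scaleR)

lemma star_power: "star (x ^ n) = star (x :: 'a::{cstar_algebra,real_normed_algebra_1}) ^ n"
  by (induction n) (simp_all add: star_mult power_commutes)

text \<open>The element \<open>v = a + \<i> *\<^sub>C b\<close> is normal, \<open>star v * v\<close>
  is the scalar \<open>c\<close>, and \<open>a * a - b * b\<close> is the real part of
  \<open>v * v\<close>. The C*-identity therefore gives what a functional calculus for commuting
  \<open>a\<close> and \<open>b\<close> would give.\<close>

lemma norm_diff_squares_le:
  fixes a b :: "'a::{cstar_algebra,real_normed_algebra_1}"
  assumes "star a = a" "star b = b" "a * b = b * a" "a * a + b * b = of_real c" "0 \<le> c"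
  shows "norm (a * a - b * b) \<le> c"
proof -
  define v where "v = a + \<i> *\<^sub>C b"
  have sv: "star v = a - \<i> *\<^sub>C b"
    using assms by (simp add: v_def star_add star_scaleC)
  have "star v * v = a * a + b * b"
    unfolding sv using assms(3)
    by (simp add: v_def algebra_simps mult_scaleC_left mult_scaleC_right scaleC_scaleC scaleC_minus_one)
  then have nv: "(norm v)\<^sup>2 = c"
    using norm_star_mult_self[of v] assms(4,5) by simp
  have "v * v + star v * star v = 2 *\<^sub>R (a * a - b * b)"
    unfolding sv using assms(3)
    by (simp add: v_def algebra_simps mult_scaleC_left mult_scaleC_right scaleC_scaleC scaleC_minus_one scaleR_2)
  then have "2 * norm (a * a - b * b) = norm (v * v + star v * star v)"
    by simp
  also have "\<dots> \<le> norm v * norm v + norm (star v) * norm (star v)"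
    by (meson norm_triangle_ineq norm_mult_ineq add_mono order_trans)
  also have "\<dots> = 2 * c" using nv by (simp add: norm_star power2_eq_square)
  finally show ?thesis by simp
qed

text \<open>For selfadjoint \<open>h\<close> the inequality says that the spectrum lies in the
  interval from 0 to 2t. In this form the cone properties follow from the triangle
  inequality.\<close>

definition cpos :: "'a::{cstar_algebra,real_normed_algebra_1} \<Rightarrow> bool"
  where "cpos h \<longleftrightarrow> star h = h \<and> (\<exists>t. norm (of_real t - h) \<le> t)"

lemma cposI: "star h = h \<Longrightarrow> norm (of_real t - h) \<le> t \<Longrightarrow> cpos h"
  by (auto simp: cpos_def)

lemma cpos_large:
  assumes "cpos h"
  obtains t0 where "0 \<le> t0" "\<And>t. t0 \<le> t \<Longrightarrow> norm (of_real t - h) \<le> t"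
proof -
  obtain t0 where t0: "norm (of_real t0 - h) \<le> t0" using assms by (auto simp: cpos_def)
  show thesis
  proof (rule that[of t0])
    show "0 \<le> t0" using norm_ge_zero t0 by (rule order_trans)
    fix t assume "t0 \<le> t"
    have "of_real t - h = of_real (t - t0) + (of_real t0 - h)" by simp
    then have "norm (of_real t - h) \<le> norm (of_real (t - t0) :: 'a) + norm (of_real t0 - h)"
      by (metis norm_triangle_ineq)
    then show "norm (of_real t - h) \<le> t" using t0 \<open>t0 \<le> t\<close> by (simp del: of_real_diff)
  qed
qed

lemma cpos_add:
  assumes "cpos h" "cpos k"
  shows "cpos (h + k)"
proof -
  obtain s t where s: "norm (of_real s - h) \<le> s" and t: "norm (of_real t - k) \<le> t"
    using assms by (auto simp: cpos_def)
  have eq: "of_real (s + t) - (h + k) = (of_real s - h) + (of_real t - k)" by simp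
  have "norm (of_real (s + t) - (h + k)) \<le> s + t"
    unfolding eq using s t by (intro norm_triangle_le add_mono)
  then show ?thesis
    using assms by (intro cposI[of _ "s + t"]) (auto simp: cpos_def star_add)
qed

lemma cpos_scaleR:
  assumes "cpos h" "0 \<le> r"
  shows "cpos (r *\<^sub>R h)"
proof -
  obtain s where s: "norm (of_real s - h) \<le> s" using assms by (auto simp: cpos_def)
  have "of_real (r * s) - r *\<^sub>R h = r *\<^sub>R (of_real s - h)"
    by (simp add: of_real_def algebra_simps)
  then have "norm (of_real (r * s) - r *\<^sub>R h) \<le> r * s"
    using s assms(2) by (simp add: mult_left_mono)
  then show ?thesis
    using assms by (intro cposI[of _ "r * s"]) (auto simp: cpos_def star_scaleR)
qed

lemma cpos_of_real: "0 \<le> r \<Longrightarrow> cpos (of_real r)"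
  by (rule cposI[of _ r]) auto

lemma cpos_of_real_iff: "cpos (of_real r :: 'a::{cstar_algebra,real_normed_algebra_1}) \<longleftrightarrow> 0 \<le> r"
proof
  assume "cpos (of_real r :: 'a)"
  then obtain t where "norm (of_real t - of_real r :: 'a) \<le> t" by (auto simp: cpos_def)
  then have "\<bar>t - r\<bar> \<le> t" by (metis norm_of_real of_real_diff)
  then show "0 \<le> r" by linarith
qed (rule cpos_of_real)

lemma cpos_norm: "star h = h \<Longrightarrow> cpos (of_real (norm h) - h)"
  by (rule cposI[of _ "norm h"]) (simp_all add: star_diff)

text \<open>Writing \<open>h + e\<close> as (t + e)(1 - x) gives \<open>norm x\<close> at most t/(t
  + e), strictly below 1, as the fixed point construction demands. The shift by \<open>e\<close> is
  harmless because the result is only used for norm estimates in which \<open>e\<close> tends to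
  0.\<close>

lemma cpos_sqrt:
  assumes h: "cpos h" and e: "0 < e"
  obtains y where "star y = y" "y * y = h + of_real e" "\<And>c. c * h = h * c \<Longrightarrow> c * y = y * c"
proof -
  obtain t where t: "norm (of_real t - h) \<le> t" and sh: "star h = h" using h by (auto simp: cpos_def)
  have t0: "0 \<le> t" using norm_ge_zero t by (rule order_trans)
  define T where "T = t + e"
  have T: "0 < T" using t0 e by (simp add: T_def)
  define x where "x = (1 / T) *\<^sub>R (of_real t - h)"
  have "norm x < 1"
    using t e T by (simp add: x_def T_def)
  moreover have "star x = x" by (simp add: x_def star_scaleR star_diff sh)
  ultimately obtain w where w: "star w = w" "w + w = x + w * w" "\<And>c. c * x = x * c \<Longrightarrow> c * w = w * c"
    using selfadjoint_sqrt by metis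
  show thesis
  proof (rule that[of "sqrt T *\<^sub>R (1 - w)"])
    show "star (sqrt T *\<^sub>R (1 - w)) = sqrt T *\<^sub>R (1 - w)" by (simp add: star_scaleR star_diff w)
    have "sqrt T *\<^sub>R (1 - w) * sqrt T *\<^sub>R (1 - w) = T *\<^sub>R (1 - (w + w) + w * w)"
      using T by (simp add: algebra_simps)
    also have "\<dots> = T *\<^sub>R (1 - x)" by (simp add: w(2))
    also have "\<dots> = h + of_real e"
      using T by (simp add: x_def algebra_simps) (simp add: T_def of_real_def algebra_simps)
    finally show "sqrt T *\<^sub>R (1 - w) * sqrt T *\<^sub>R (1 - w) = h + of_real e" .
    fix c assume c: "c * h = h * c"
    have "c * x = x * c"
      using c by (simp add: x_def algebra_simps of_real_def)
    then show "c * sqrt T *\<^sub>R (1 - w) = sqrt T *\<^sub>R (1 - w) * c"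
      using w(3)[of c] by (simp add: algebra_simps)
  qed
qed

text \<open>Up to \<open>e\<close>, both \<open>r - h\<close> and \<open>r + h\<close> have square
  roots \<open>a\<close> and \<open>b\<close>. Each root commutes with everything that commutes with
  its square, so \<open>a\<close> and \<open>b\<close> commute; the sum of their squares is the
  scalar 2(r + e) and the difference is -2h.\<close>

lemma norm_le_of_cpos:
  fixes h :: "'a::{cstar_algebra,real_normed_algebra_1}"
  assumes m: "cpos (of_real r - h)" and p: "cpos (of_real r + h)" and r: "0 \<le> r"
  shows "norm h \<le> r"
proof (rule field_le_epsilon)
  fix e :: real assume e: "0 < e"
  obtain a where a: "star a = a" "a * a = of_real r - h + of_real e"
    "\<And>c. c * (of_real r - h) = (of_real r - h) * c \<Longrightarrow> c * a = a * c"
    using cpos_sqrt[OF m e] by metis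
  obtain b where b: "star b = b" "b * b = of_real r + h + of_real e"
    "\<And>c. c * (of_real r + h) = (of_real r + h) * c \<Longrightarrow> c * b = b * c"
    using cpos_sqrt[OF p e] by metis
  have r': "c * of_real r = of_real r * c" for c :: 'a by (simp add: of_real_def)
  have "h * a = a * h" by (rule a(3)) (simp add: left_diff_distrib right_diff_distrib r'[of h])
  then have "a * (of_real r + h) = (of_real r + h) * a"
    by (simp add: distrib_left distrib_right r'[of a])
  then have "a * b = b * a" by (rule b(3))
  moreover have "a * a + b * b = of_real (r + e + (r + e))" by (simp add: a(2) b(2)) (simp only: mult_2 ac_simps)
  moreover have "0 \<le> r + e + (r + e)" using r e by simp
  ultimately have "norm (a * a - b * b) \<le> r + e + (r + e)"
    by (rule norm_diff_squares_le[OF a(1) b(1)])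
  also have "a * a - b * b = (-2) *\<^sub>R h" by (simp only: a(2) b(2)) (simp add: scaleR_2)
  finally show "norm h \<le> r + e" by simp
qed

text \<open>After scaling \<open>h\<close> to \<open>k\<close> of norm below 1, the root
  \<open>1 - w\<close> of \<open>1 - k * k\<close> commutes with \<open>k\<close>, and the two
  squares add up to 1. Their difference \<open>1 - 2 *\<^sub>R (k * k)\<close> then has norm at most
  1, which is positivity of \<open>k * k\<close> with t = 1/2.\<close>

lemma cpos_square:
  assumes h: "star h = h"
  shows "cpos (h * h)"
proof -
  define r where "r = norm h + 1"
  have r: "0 < r" "norm h < r" by (simp_all add: r_def add_nonneg_pos)
  define k where "k = (1 / r) *\<^sub>R h"
  have k: "star k = k" "norm k < 1" using h r by (simp_all add: k_def star_scaleR)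
  have "norm (k * k) \<le> norm k * norm k" by (rule norm_mult_ineq)
  also have "\<dots> < 1" using k(2) by (metis mult_strict_mono norm_ge_zero mult_1 zero_less_one)
  finally have "norm (k * k) < 1" .
  moreover have "star (k * k) = k * k" by (simp add: star_mult k)
  ultimately obtain w where w: "star w = w" "w + w = k * k + w * w" "\<And>c. c * (k * k) = k * k * c \<Longrightarrow> c * w = w * c"
    using selfadjoint_sqrt by metis
  have kw: "k * w = w * k" by (rule w(3)) (simp add: mult.assoc)
  have yy: "(1 - w) * (1 - w) = 1 - k * k"
  proof -
    have "(1 - w) * (1 - w) = 1 - (w + w) + w * w" by (simp add: algebra_simps)
    then show ?thesis by (simp add: w(2))
  qed
  have "norm ((1 - w) * (1 - w) - k * k) \<le> 1"
    by (rule norm_diff_squares_le) (simp_all add: yy k w star_diff algebra_simps kw)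
  then have n: "norm (1 - 2 *\<^sub>R (k * k)) \<le> 1" unfolding yy by (simp add: scaleR_2 algebra_simps)
  have "of_real (r\<^sup>2 / 2) - h * h = (r\<^sup>2 / 2) *\<^sub>R (1 - 2 *\<^sub>R (k * k))"
    using r by (simp add: k_def of_real_def algebra_simps power2_eq_square)
  then have "norm (of_real (r\<^sup>2 / 2) - h * h) = (r\<^sup>2 / 2) * norm (1 - 2 *\<^sub>R (k * k))" by simp
  also have "\<dots> \<le> (r\<^sup>2 / 2) * 1" using n by (intro mult_left_mono) auto
  finally show ?thesis
    by (intro cposI[of _ "r\<^sup>2 / 2"]) (simp_all add: star_mult h)
qed

text \<open>The C*-identity gives the exponents 2^k by repeated squaring. Any other n is completed
  to 2^n by m further factors, and a loss in the n-th power would show up as a loss in the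
  2^n-th.\<close>

lemma norm_power_selfadjoint:
  fixes u :: "'a::{cstar_algebra,real_normed_algebra_1}"
  assumes u: "star u = u"
  shows "norm (u ^ n) = norm u ^ n"
proof (cases "norm u = 0")
  case False
  have two: "norm (u ^ (2 ^ k)) = norm u ^ (2 ^ k)" for k
  proof (induction k)
    case (Suc k)
    have "norm (u ^ 2 ^ Suc k) = norm (star (u ^ 2 ^ k) * u ^ 2 ^ k)"
      by (simp add: star_power u mult_2 power_add)
    also have "\<dots> = (norm u ^ 2 ^ k)\<^sup>2" by (simp add: norm_star_mult_self Suc)
    finally show ?case by (simp add: power_mult[symmetric] mult.commute)
  qed simp
  define m where "m = 2 ^ n - n"
  have m: "2 ^ n = n + m" by (simp add: m_def less_imp_le)
  have "norm u ^ n * norm u ^ m = norm (u ^ n * u ^ m)"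
    using two[of n] by (simp add: m power_add)
  also have "\<dots> \<le> norm (u ^ n) * norm u ^ m"
    by (meson norm_mult_ineq norm_power_ineq mult_left_mono norm_ge_zero order_trans)
  finally have "norm u ^ n \<le> norm (u ^ n)" using False by simp
  then show ?thesis using norm_power_ineq[of u n] by simp
qed (cases n; simp)

text \<open>Both \<open>(1 - x\<^sup>*x)\<^sup>n\<close> and \<open>(1 - x x\<^sup>*)\<^sup>n\<close> grow at the same exponential rate, and for
  selfadjoint elements this rate is the norm.\<close>

lemma norm_one_minus_star_mult:
  fixes x :: "'a::{cstar_algebra,real_normed_algebra_1}"
  assumes M: "norm (1 - x * star x) \<le> M" "1 \<le> M"
  shows "norm (1 - star x * x) \<le> M"
proof (rule ccontr)
  define u v where "u = 1 - star x * x" and "v = 1 - x * star x"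
  assume "\<not> norm (1 - star x * x) \<le> M"
  then have uM: "M < norm u" by (simp add: u_def)
  define K where "K = norm x * norm x"
  have comm: "u ^ n * star x = star x * v ^ n" for n
  proof (induction n)
    case (Suc n)
    have "u * star x = star x * v" by (simp add: u_def v_def algebra_simps)
    then have "u ^ Suc n * star x = u ^ n * star x * v"
      by (simp add: power_Suc2 mult.assoc del: power_Suc)
    then show ?case by (simp add: Suc power_Suc2 mult.assoc del: power_Suc)
  qed simp
  \<comment> \<open>Splitting off one factor of \<open>u ^ Suc n\<close> leaves \<open>u ^ n\<close>
    minus \<open>star x * v ^ n * x\<close>, and the powers of \<open>v\<close> are controlled by
    \<open>M\<close>. Each step costs at most \<open>K * M ^ Suc n\<close>, so the powers of
    \<open>u\<close> outgrow those of \<open>M\<close> by no more than a linear factor.\<close>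
  have bound: "norm (u ^ n) \<le> 1 + of_nat n * K * M ^ n" for n
  proof (induction n)
    case (Suc n)
    have "u ^ Suc n = u ^ n - u ^ n * star x * x"
      by (simp add: power_Suc2 u_def algebra_simps del: power_Suc)
    also have "\<dots> = u ^ n - star x * v ^ n * x" by (simp only: comm)
    finally have "norm (u ^ Suc n) \<le> norm (u ^ n) + norm (star x * v ^ n * x)"
      by (metis norm_triangle_ineq4)
    also have "norm (star x * v ^ n * x) \<le> norm (star x) * norm v ^ n * norm x"
      by (intro order_trans[OF norm_mult_ineq] mult_right_mono mult_left_mono norm_power_ineq norm_ge_zero)
    also have "\<dots> \<le> K * M ^ Suc n"
    proof -
      have "norm v ^ n \<le> M ^ n" using M(1) by (intro power_mono) (auto simp: v_def)
      also have "\<dots> \<le> M ^ Suc n" using M(2) by (intro power_increasing) auto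
      finally have "norm x * norm x * norm v ^ n \<le> norm x * norm x * M ^ Suc n"
        by (intro mult_left_mono) auto
      then show ?thesis by (simp add: norm_star K_def mult_ac del: power_Suc)
    qed
    also have "norm (u ^ n) \<le> 1 + of_nat n * K * M ^ Suc n"
    proof -
      have "K * M ^ n \<le> K * M ^ Suc n"
        using M(2) by (intro mult_left_mono power_increasing) (auto simp: K_def)
      then have "of_nat n * (K * M ^ n) \<le> of_nat n * (K * M ^ Suc n)" by (rule mult_left_mono) auto
      then show ?thesis using Suc by (simp add: mult.assoc)
    qed
    finally show ?case by (simp add: algebra_simps)
  qed simp
  have su: "star u = u" by (simp add: u_def star_diff star_mult star_star)
  \<comment> \<open>After division by \<open>norm u ^ n\<close> the bound tends to 0, because
    \<open>norm u\<close> exceeds both \<open>M\<close> and 1. The condition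
    \<open>1 \<le> M\<close> reflects that 0 may lie in only one of the two spectra: for a
    coisometry that is not unitary, \<open>1 - x * star x\<close> vanishes while
    \<open>1 - star x * x\<close> is a nonzero projection.\<close>
  define r where "r = M / norm u"
  have "0 < norm u" using M(2) uM by linarith
  then have r: "0 < r" "r < 1" using M(2) uM by (simp_all add: r_def)
  have "1 \<le> (1 / norm u) ^ n + K * (of_nat n * r ^ n)" for n
  proof -
    have "norm u ^ n \<le> 1 + of_nat n * K * M ^ n"
      using bound[of n] by (simp add: norm_power_selfadjoint[OF su])
    then have "norm u ^ n / norm u ^ n \<le> (1 + of_nat n * K * M ^ n) / norm u ^ n"
      by (rule divide_right_mono) simp
    then show ?thesis using \<open>0 < norm u\<close> by (simp add: r_def power_divide add_divide_distrib mult_ac)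
  qed
  moreover have "(\<lambda>n. (1 / norm u) ^ n + K * (of_nat n * r ^ n)) \<longlonglongrightarrow> 0 + K * 0"
    using r uM M(2) \<open>0 < norm u\<close>
    by (intro tendsto_add tendsto_mult tendsto_const LIMSEQ_realpow_zero powser_times_n_limit_0) auto
  ultimately have "(1::real) \<le> 0 + K * 0"
    by (intro LIMSEQ_le_const) auto
  then show False by simp
qed

text \<open>Up to signs, \<open>h\<close> and \<open>k\<close> are twice the real and imaginary
  parts of \<open>z\<close>. In the sum of their squares the mixed terms cancel, so the symmetric
  combination is positive before anything is known about \<open>star z * z\<close> alone.\<close>

lemma cpos_mult_star_add: "cpos (z * star z + star z * z)"
proof -
  define h k where "h = z + star z" and "k = \<i> *\<^sub>C (z - star z)"
  have "star h = h" by (simp add: h_def star_add star_star add.commute)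
  moreover have "star k = k"
    by (simp add: k_def star_scaleC star_diff star_star complex_vector.scale_right_diff_distrib)
  ultimately have "cpos ((1/2) *\<^sub>R (h * h + k * k))"
    by (intro cpos_scaleR cpos_add cpos_square) auto
  also have "(1/2) *\<^sub>R (h * h + k * k) = (1/2) *\<^sub>R (2 *\<^sub>R (z * star z + star z * z))"
    by (simp add: h_def k_def mult_scaleC_left mult_scaleC_right scaleC_scaleC scaleC_minus_one algebra_simps scaleR_2)
  finally show ?thesis by simp
qed

text \<open>Kaplansky's argument: were \<open>u = 1 - x\<^sup>*x\<close> of norm \<open>> 1\<close>, then \<open>z = x u\<^sup>n\<close> would have
  \<open>z\<^sup>*z\<close> of large norm and almost negative; but \<open>z z\<^sup>* + z\<^sup>*z\<close> is positive, and \<open>z\<^sup>*z\<close> has the same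
  lower bounds as \<open>z z\<^sup>*\<close>.\<close>

theorem cpos_star_mult: "cpos (star x * x)"
proof -
  \<comment> \<open>For \<open>norm x < 1\<close> the element \<open>u = 1 - a\<close> is a square
    \<open>y * y\<close>, and positivity of \<open>a\<close> with t = 1 amounts to
    \<open>norm u \<le> 1\<close>.\<close>
  have small: "cpos (star x * x)" if x: "norm x < 1" for x :: 'a
  proof -
    define a u where "a = star x * x" and "u = 1 - a"
    have "norm a < 1"
      using x by (simp add: a_def norm_star_mult_self power_less_one_iff)
    moreover have sa: "star a = a" by (simp add: a_def star_mult star_star)
    ultimately obtain w where w: "star w = w" "w + w = a + w * w" "\<And>c. c * a = a * c \<Longrightarrow> c * w = w * c"
      using selfadjoint_sqrt by metis
    define y where "y = 1 - w"
    have y: "star y = y" by (simp add: y_def star_diff w)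
    have yy: "y * y = u"
    proof -
      have "y * y = 1 - (w + w) + w * w" by (simp add: y_def algebra_simps)
      then show ?thesis by (simp add: w(2) u_def)
    qed
    have su: "star u = u" by (simp add: u_def star_diff sa)
    have uy: "(1 - u) * y = y * (1 - u)" unfolding yy[symmetric] by (simp add: algebra_simps)
    have uyn: "(1 - u) * y ^ n = y ^ n * (1 - u)" for n
      by (rule power_commuting_commutes[OF uy[symmetric], symmetric])
    \<comment> \<open>The element is a telescoping sum of the terms
      \<open>(1 - u) * (1 - u) * u ^ k\<close> for k < n, each being the square of the selfadjoint
      \<open>(1 - u) * y ^ k\<close>.\<close>
    have step: "cpos ((1 - u) - (1 - u) * u ^ n)" for n
    proof (induction n)
      case 0
      show ?case using cpos_of_real[of 0] by simp
    next
      case (Suc n)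
      have "cpos (((1 - u) * y ^ n) * ((1 - u) * y ^ n))"
        by (intro cpos_square) (simp add: star_mult star_power star_diff su y uyn)
      also have "((1 - u) * y ^ n) * ((1 - u) * y ^ n) = (1 - u) * (1 - u) * (y ^ n * y ^ n)"
        by (metis uyn mult.assoc)
      also have "y ^ n * y ^ n = u ^ n"
        by (metis yy power2_eq_square power_mult mult.commute)
      also have "(1 - u) * (1 - u) * u ^ n = (1 - u) * u ^ n - (1 - u) * u ^ Suc n"
        by (simp add: algebra_simps)
      finally have "cpos ((1 - u) - (1 - u) * u ^ n + ((1 - u) * u ^ n - (1 - u) * u ^ Suc n))"
        by (intro cpos_add Suc)
      then show ?case by simp
    qed
    have bound: "norm ((1 - u) * u ^ (n + n)) \<le> 1" for n
    proof -
      define z P where "z = x * u ^ n" and "P = (1 - u) * u ^ (n + n)"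
      have zz: "star z * z = P"
      proof -
        have "star z * z = u ^ n * (star x * x) * u ^ n"
          by (simp add: z_def star_mult star_power su mult.assoc)
        also have "star x * x = 1 - u" by (simp add: u_def a_def)
        also have "u ^ n * (1 - u) = (1 - u) * u ^ n"
          by (simp add: algebra_simps power_commutes)
        finally show ?thesis by (simp add: P_def power_add mult.assoc)
      qed
      have "cpos (u + ((1 - u) - P))"
        unfolding P_def using cpos_square[OF y] by (intro cpos_add step) (simp add: yy)
      then have minus: "cpos (of_real 1 - P)" by (simp add: algebra_simps)
      \<comment> \<open>Since \<open>star z * z\<close> is \<open>P\<close>, it cancels, and the
        upper bound 1 for \<open>P\<close> becomes the lower bound -1 for \<open>z * star z\<close>.
        What remains is to carry this lower bound over to \<open>star z * z\<close>.\<close>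
      have "cpos (of_real 1 - P + (z * star z + star z * z))"
        by (intro cpos_add minus cpos_mult_star_add)
      then have "cpos (1 + z * star z)" by (simp add: zz algebra_simps)
      then obtain t0 where t0: "\<And>t. t0 \<le> t \<Longrightarrow> norm (of_real t - (1 + z * star z)) \<le> t"
        using cpos_large by metis
      \<comment> \<open>Read at t = s + 1, positivity of \<open>1 + z * star z\<close> bounds
        \<open>norm (of_real s - z * star z)\<close> by s + 1. Division by s produces the hypothesis
        of \<open>norm_one_minus_star_mult\<close> with M = 1 + 1/s; the maximum with 1 keeps s
        positive.\<close>
      define s where "s = max t0 1"
      have s: "0 < s" "t0 \<le> s + 1" by (auto simp: s_def)
      have ns: "norm (of_real s - c) \<le> s + 1 \<longleftrightarrow> norm (1 - (1 / s) *\<^sub>R c) \<le> 1 + 1 / s" for c :: 'a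
      proof -
        have eq: "1 - (1 / s) *\<^sub>R c = (1 / s) *\<^sub>R (of_real s - c)"
          using s(1) by (simp add: of_real_def scaleR_diff_right)
        show ?thesis unfolding eq norm_scaleR using s(1) by (simp add: field_simps)
      qed
      define x' where "x' = (1 / sqrt s) *\<^sub>R z"
      have x': "x' * star x' = (1 / s) *\<^sub>R (z * star z)" "star x' * x' = (1 / s) *\<^sub>R (star z * z)"
        using s(1) by (simp_all add: x'_def star_scaleR)
      have "norm (of_real s - z * star z) \<le> s + 1"
        using t0[OF s(2)] by simp
      then have "norm (1 - x' * star x') \<le> 1 + 1 / s" by (simp add: ns x')
      then have "norm (1 - star x' * x') \<le> 1 + 1 / s"
        using s(1) by (intro norm_one_minus_star_mult) auto
      then have "norm (of_real s - P) \<le> s + 1" by (simp add: ns x' zz)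
      then have plus: "cpos (of_real 1 + P)"
        by (intro cposI[of _ "s + 1"]) (simp_all add: zz[symmetric] star_add star_mult star_star)
      show ?thesis
        using norm_le_of_cpos[OF minus plus] by (simp add: P_def)
    qed
    have "norm u \<le> 1"
    proof (rule ccontr)
      assume "\<not> norm u \<le> 1"
      then have u1: "1 < norm u" by simp
      \<comment> \<open>If \<open>norm u\<close> exceeds 1, the norm of
        \<open>(1 - u) * u ^ (n + n)\<close> is at least
        \<open>norm u ^ (n + n) * (norm u - 1)\<close>, which grows beyond the uniform bound
        1.\<close>
      then obtain n where n: "1 / (norm u - 1) < norm u ^ n" using real_arch_pow by blast
      also have "\<dots> \<le> norm u ^ (n + n)" using u1 by (intro power_increasing) auto
      finally have "1 < norm u ^ (n + n) * (norm u - 1)" using u1 by (simp add: field_simps)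
      also have "\<dots> = norm (u ^ Suc (n + n)) - norm (u ^ (n + n))"
        by (simp only: norm_power_selfadjoint[OF su]) (simp add: algebra_simps)
      also have "\<dots> \<le> norm ((1 - u) * u ^ (n + n))"
        using norm_triangle_ineq2[of "u ^ Suc (n + n)" "u ^ (n + n)"]
        by (simp add: left_diff_distrib norm_minus_commute)
      also have "\<dots> \<le> 1" by (rule bound)
      finally show False by simp
    qed
    then have "cpos a" by (intro cposI[of _ 1]) (simp_all add: sa u_def)
    then show ?thesis by (simp add: a_def)
  qed
  define r where "r = norm x + 1"
  have r: "0 < r" "norm x < r" by (simp_all add: r_def add_nonneg_pos)
  have "cpos (star ((1 / r) *\<^sub>R x) * ((1 / r) *\<^sub>R x))" using r by (intro small) simp
  then have "cpos (r\<^sup>2 *\<^sub>R (star ((1 / r) *\<^sub>R x) * ((1 / r) *\<^sub>R x)))" by (rule cpos_scaleR) simp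
  then show ?thesis using r by (simp add: star_scaleR power2_eq_square)
qed

section \<open>Positive functionals\<close>

definition sublinear :: "('v::real_vector \<Rightarrow> real) \<Rightarrow> bool"
  where "sublinear f \<longleftrightarrow> (\<forall>x y. f (x + y) \<le> f x + f y) \<and> (\<forall>r>0. \<forall>x. f (r *\<^sub>R x) = r * f x) \<and> f 0 = 0"

lemma sublinear_lower:
  assumes "sublinear f"
  shows "- f (- x) \<le> f x"
proof -
  have "f (x + (- x)) \<le> f x + f (- x)" using assms unfolding sublinear_def by blast
  then show ?thesis using assms by (simp add: sublinear_def)
qed

text \<open>Zorn's lemma applies because every sublinear functional below \<open>q\<close> satisfies
  the lower bound \<open>- q (- x)\<close>, so the pointwise infimum of a chain is finite. Minimal
  functionals will turn out to be linear.\<close>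

lemma minimal_sublinear:
  fixes q :: "'v::real_vector \<Rightarrow> real"
  assumes q: "sublinear q"
  obtains f where "sublinear f" "f \<le> q" "\<And>g. sublinear g \<Longrightarrow> g \<le> f \<Longrightarrow> g = f"
proof -
  define A where "A = {f. sublinear f \<and> f \<le> q}"
  have "\<exists>m\<in>A. \<forall>a\<in>A. a \<le> m \<longrightarrow> a = m"
  \<comment> \<open>The order is reversed, so the maximal element delivered here is a minimal
    functional.\<close>
  proof (rule predicate_Zorn[where P = "\<lambda>f g. g \<le> f"])
    show "partial_order_on A (relation_of (\<lambda>f g. g \<le> f) A)"
      by (auto simp: partial_order_on_def preorder_on_def refl_on_def trans_def antisym_def relation_of_def
          intro: order_trans)
    fix C assume "C \<in> Chains (relation_of (\<lambda>f g. g \<le> f) A)"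
    then have C: "C \<subseteq> A" "\<And>f g. f \<in> C \<Longrightarrow> g \<in> C \<Longrightarrow> f \<le> g \<or> g \<le> f"
      by (auto simp: Chains_def relation_of_def)
    show "\<exists>u\<in>A. \<forall>f\<in>C. u \<le> f"
    proof (cases "C = {}")
      case True
      then show ?thesis using q by (auto simp: A_def)
    next
      case False
      define u where "u x = (INF f\<in>C. f x)" for x
      have sub: "sublinear f" "f \<le> q" if "f \<in> C" for f using that C(1) by (auto simp: A_def)
      have lower: "- q (- x) \<le> f x" if "f \<in> C" for f x
        using sublinear_lower[OF sub(1)[OF that], of x] sub(2)[OF that] by (auto simp: le_fun_def intro: order_trans[rotated])
      then have bdd: "bdd_below ((\<lambda>f. f x) ` C)" for x by (auto intro!: bdd_belowI2)
      have u_le: "u x \<le> f x" if "f \<in> C" for f x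
        unfolding u_def using that by (intro cINF_lower bdd)
      have u_ge: "c \<le> u x" if "\<And>f. f \<in> C \<Longrightarrow> c \<le> f x" for c x
        unfolding u_def using that False by (intro cINF_greatest) auto
      have "u (x + y) \<le> u x + u y" for x y
      proof -
        \<comment> \<open>In a chain the smaller of \<open>f\<close> and \<open>g\<close> bounds
          both summands at once; for an arbitrary family the infimum need not be
          subadditive.\<close>
        have fg: "u (x + y) \<le> f x + g y" if fg: "f \<in> C" "g \<in> C" for f g
        proof -
          obtain h where h: "h \<in> C" "h \<le> f" "h \<le> g" using C(2)[OF fg] fg by auto
          have "u (x + y) \<le> h (x + y)" by (rule u_le[OF h(1)])
          also have "\<dots> \<le> h x + h y" using sub(1)[OF h(1)] by (simp add: sublinear_def)
          also have "\<dots> \<le> f x + g y" using h by (intro add_mono) (auto simp: le_fun_def)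
          finally show ?thesis .
        qed
        have "u (x + y) - g y \<le> u x" if "g \<in> C" for g
          using fg that by (intro u_ge) (simp add: diff_le_eq)
        then have "u (x + y) - u x \<le> u y"
          by (intro u_ge) (simp add: diff_le_eq add.commute)
        then show ?thesis by simp
      qed
      moreover have hom: "u (r *\<^sub>R x) = r * u x" if r: "0 < r" for r x
      proof (rule antisym)
        have "u (r *\<^sub>R x) / r \<le> u x"
        proof (rule u_ge)
          fix f assume f: "f \<in> C"
          have "u (r *\<^sub>R x) \<le> f (r *\<^sub>R x)" by (rule u_le[OF f])
          also have "\<dots> = r * f x" using sub(1)[OF f] r by (simp add: sublinear_def)
          finally show "u (r *\<^sub>R x) / r \<le> f x" using r by (simp add: field_simps)
        qed
        then show "u (r *\<^sub>R x) \<le> r * u x" using r by (simp add: field_simps)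
        show "r * u x \<le> u (r *\<^sub>R x)"
        proof (rule u_ge)
          fix f assume f: "f \<in> C"
          have "r * u x \<le> r * f x" using r u_le[OF f] by (intro mult_left_mono) auto
          then show "r * u x \<le> f (r *\<^sub>R x)" using sub(1)[OF f] r by (simp add: sublinear_def)
        qed
      qed
      moreover have "u 0 = 0"
      proof -
        have "f 0 = 0" if "f \<in> C" for f using sub(1)[OF that] by (simp add: sublinear_def)
        then have "u 0 = (INF f\<in>C. 0)" unfolding u_def by (intro INF_cong) auto
        then show ?thesis using False by simp
      qed
      ultimately have "sublinear u" by (auto simp: sublinear_def)
      moreover have "u \<le> q"
      proof (rule le_funI)
        fix x
        obtain f where f: "f \<in> C" using False by blast
        show "u x \<le> q x" using u_le[OF f, of x] sub(2)[OF f] by (auto simp: le_fun_def intro: order_trans)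
      qed
      ultimately show ?thesis
        using u_le by (intro bexI[of _ u]) (auto simp: A_def le_fun_def)
    qed
  qed
  then show thesis using that by (auto simp: A_def intro: order_trans)
qed

text \<open>Adds the constraint that the functional takes at least the value \<open>f y\<close> at \<open>y\<close>.\<close>

lemma sublinear_pinch:
  fixes f :: "'v::real_vector \<Rightarrow> real"
  assumes f: "sublinear f"
  obtains g where "sublinear g" "g \<le> f" "\<And>x. g x \<le> f (x + y) - f y"
proof -
  have f_add: "f (a + b) \<le> f a + f b" and f_hom: "0 < r \<Longrightarrow> f (r *\<^sub>R a) = r * f a" and f0: "f 0 = 0" for a b r
    using f by (auto simp: sublinear_def)
  have f_hom0: "0 \<le> r \<Longrightarrow> f (r *\<^sub>R a) = r * f a" for r a
    using f_hom[of r a] f0 by (cases "r = 0") auto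
  \<comment> \<open>This is the largest sublinear functional below \<open>f\<close> whose value at
    \<open>- y\<close> is at most \<open>- f y\<close>. Every linear functional below it takes at
    least the value \<open>f y\<close> at \<open>y\<close>.\<close>
  define g where "g x = (INF t\<in>{0..}. f (x + t *\<^sub>R y) - t * f y)" for x
  have lower: "- f (- x) \<le> f (x + t *\<^sub>R y) - t * f y" if "0 \<le> t" for x t
    using f_add[of "- x" "x + t *\<^sub>R y"] f_hom0[OF that, of y] by simp
  have g_le: "g x \<le> f (x + t *\<^sub>R y) - t * f y" if "0 \<le> t" for x t
    unfolding g_def using that by (intro cINF_lower bdd_belowI2[where m = "- f (- x)"] lower) auto
  have g_ge: "c \<le> g x" if "\<And>t. 0 \<le> t \<Longrightarrow> c \<le> f (x + t *\<^sub>R y) - t * f y" for c x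
    unfolding g_def using that by (intro cINF_greatest) auto
  have "g (a + b) \<le> g a + g b" for a b
  proof -
    have st: "g (a + b) \<le> (f (a + s *\<^sub>R y) - s * f y) + (f (b + t *\<^sub>R y) - t * f y)"
      if "0 \<le> s" "0 \<le> t" for s t
      using g_le[of "s + t" "a + b"] f_add[of "a + s *\<^sub>R y" "b + t *\<^sub>R y"] that
      by (simp add: algebra_simps)
    have "g (a + b) - (f (b + t *\<^sub>R y) - t * f y) \<le> g a" if "0 \<le> t" for t
      using st that by (intro g_ge) (simp add: diff_le_eq)
    then have "g (a + b) - g a \<le> g b"
      by (intro g_ge) (simp add: diff_le_eq add.commute algebra_simps)
    then show ?thesis by simp
  qed
  moreover have hom_le: "g (r *\<^sub>R x) \<le> r * g x" if r: "0 < r" for r x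
  proof -
    have "g (r *\<^sub>R x) / r \<le> g x"
    proof (rule g_ge)
      fix t :: real assume t: "0 \<le> t"
      have "g (r *\<^sub>R x) \<le> f (r *\<^sub>R x + (r * t) *\<^sub>R y) - r * t * f y"
        using r t by (intro g_le) auto
      also have "r *\<^sub>R x + (r * t) *\<^sub>R y = r *\<^sub>R (x + t *\<^sub>R y)" by (simp add: algebra_simps)
      finally have "g (r *\<^sub>R x) \<le> r * f (x + t *\<^sub>R y) - r * t * f y"
        by (simp only: f_hom[OF r])
      then show "g (r *\<^sub>R x) / r \<le> f (x + t *\<^sub>R y) - t * f y"
        using r by (simp add: field_simps)
    qed
    then show ?thesis using r by (simp add: field_simps)
  qed
  moreover have "r * g x \<le> g (r *\<^sub>R x)" if r: "0 < r" for r x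
    using hom_le[of "1 / r" "r *\<^sub>R x"] r by (simp add: field_simps)
  moreover have "g 0 = 0"
    using g_le[of 0 0] g_ge[of 0 0] lower[of _ 0] f0 by fastforce
  ultimately have "sublinear g" by (force simp: sublinear_def intro: antisym)
  moreover have "g \<le> f" using g_le[of 0] by (simp add: le_fun_def)
  moreover have "g x \<le> f (x + y) - f y" for x using g_le[of 1 x] by simp
  ultimately show thesis by (rule that)
qed

text \<open>No extension from subspaces takes place. Pinching \<open>q\<close> at \<open>p\<close>
  forces the value \<open>q p\<close>; below the result there is a minimal \<open>f\<close>, and
  pinching \<open>f\<close> at any \<open>y\<close> must return \<open>f\<close> itself, which is
  superadditivity.\<close>

theorem Hahn_Banach:
  fixes q :: "'v::real_vector \<Rightarrow> real"
  assumes q: "sublinear q"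
  obtains f where "linear f" "\<And>x. f x \<le> q x" "f p = q p"
proof -
  obtain q' where q': "sublinear q'" "q' \<le> q" "\<And>x. q' x \<le> q (x + p) - q p"
    using sublinear_pinch[OF q] by metis
  obtain f where f: "sublinear f" "f \<le> q'" "\<And>g. sublinear g \<Longrightarrow> g \<le> f \<Longrightarrow> g = f"
    using minimal_sublinear[OF q'(1)] by metis
  have f_add: "f (x + y) = f x + f y" for x y
  proof -
    obtain g where g: "sublinear g" "g \<le> f" "\<And>x. g x \<le> f (x + y) - f y"
      using sublinear_pinch[OF f(1)] by metis
    have "f x + f y \<le> f (x + y)" using f(3)[OF g(1,2)] g(3)[of x] by simp
    then show ?thesis using f(1) unfolding sublinear_def by (meson antisym)
  qed
  have f0: "f 0 = 0" using f(1) by (simp add: sublinear_def)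
  have f_neg: "f (- x) = - f x" for x using f_add[of x "- x"] by (simp add: f0)
  have f_scale: "f (r *\<^sub>R x) = r * f x" for r x
  proof (cases r "0 :: real" rule: linorder_cases)
    case less
    then have "f ((- r) *\<^sub>R x) = (- r) * f x" using f(1) unfolding sublinear_def by (metis neg_0_less_iff_less)
    then show ?thesis by (simp add: f_neg)
  qed (use f(1) in \<open>auto simp: sublinear_def\<close>)
  have le: "f x \<le> q x" for x using f(2) q'(2) by (auto simp: le_fun_def intro: order_trans)
  have "f (- p) \<le> q' (- p)" using f(2) by (simp add: le_fun_def)
  also have "\<dots> \<le> - q p" using q'(3)[of "- p"] q by (simp add: sublinear_def)
  finally have "f p = q p" using le[of p] by (simp add: f_neg)
  moreover have "linear f" by (rule linearI) (simp_all add: f_add f_scale)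
  ultimately show thesis using that le by blast
qed

section \<open>Positive functionals on unital algebras\<close>

definition positive_functional :: "('t::complex_vector \<Rightarrow> 't \<Rightarrow> 't) \<Rightarrow> ('t \<Rightarrow> 't) \<Rightarrow> ('t \<Rightarrow> complex) \<Rightarrow> bool"
  where "positive_functional mul ast \<omega> \<longleftrightarrow> clinear \<omega> \<and> (\<forall>x. Im (\<omega> (mul (ast x) x)) = 0 \<and> 0 \<le> Re (\<omega> (mul (ast x) x)))"

text \<open>The functional \<open>q\<close> is the infimum of the scalar upper bounds of the real
  part in the order given by \<open>cpos\<close>. A real-linear \<open>f\<close> below
  \<open>q\<close> is automatically nonnegative on every \<open>star x * x\<close> and zero on skew
  elements, and it can be made to attain \<open>q\<close> at \<open>star a * a\<close>.\<close>

lemma exists_positive_functional_unital: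
  fixes a :: "'a::{cstar_algebra,real_normed_algebra_1}"
  assumes a: "a \<noteq> 0"
  obtains \<phi> :: "'a \<Rightarrow> complex" where "positive_functional (*) star \<phi>" "\<phi> (star a * a) \<noteq> 0"
proof -
  define re where "re x = (1/2) *\<^sub>R (x + star x)" for x :: 'a
  have re: "star (re x) = re x" "re (x + y) = re x + re y" "re (r *\<^sub>R x) = r *\<^sub>R re x" for x y r
    by (simp_all add: re_def star_scaleR star_add star_star algebra_simps)
  have re_sa: "re x = x" if "star x = x" for x
    using that by (simp add: re_def scaleR_2[symmetric])
  define S where "S x = {t. cpos (of_real t - re x)}" for x
  define q where "q x = Inf (S x)" for x
  \<comment> \<open>The infimum of a set of reals is meaningful only if the set is bounded below.
    Adding the positive elements \<open>t - re x\<close> and \<open>norm (re x) + re x\<close> shows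
    that their scalar sum is nonnegative.\<close>
  have lower: "- norm (re x) \<le> t" if "t \<in> S x" for t x
  proof -
    have "cpos (of_real (norm (- re x)) - (- re x))" by (intro cpos_norm) (simp add: re star_minus)
    then have "cpos ((of_real t - re x) + (of_real (norm (- re x)) - (- re x)))"
      using that by (intro cpos_add) (auto simp: S_def)
    then have "cpos (of_real (t + norm (re x)) :: 'a)" by (simp add: algebra_simps)
    then show ?thesis by (simp only: cpos_of_real_iff)
  qed
  have ne: "norm (re x) \<in> S x" for x
    unfolding S_def using cpos_norm[OF re(1)] by simp
  have q_le: "q x \<le> t" if "t \<in> S x" for t x
    unfolding q_def using that lower by (intro cInf_lower) (auto intro!: bdd_belowI)
  have q_ge: "c \<le> q x" if "\<And>t. t \<in> S x \<Longrightarrow> c \<le> t" for c x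
    unfolding q_def using that ne by (intro cInf_greatest) auto
  have "sublinear q"
    unfolding sublinear_def
  proof (intro conjI allI impI)
    fix x y
    have "s + t \<in> S (x + y)" if "s \<in> S x" "t \<in> S y" for s t
    proof -
      have "cpos ((of_real s - re x) + (of_real t - re y))"
        using that by (intro cpos_add) (auto simp: S_def)
      then show ?thesis by (simp add: S_def re algebra_simps)
    qed
    then have st: "q (x + y) \<le> s + t" if "s \<in> S x" "t \<in> S y" for s t
      using that by (intro q_le)
    have "q (x + y) - t \<le> q x" if "t \<in> S y" for t
      using st that by (intro q_ge) (simp add: diff_le_eq)
    then have "q (x + y) - q x \<le> q y"
      by (intro q_ge) (simp add: diff_le_eq add.commute)
    then show "q (x + y) \<le> q x + q y" by simp
  next
    fix r :: real and x assume r: "0 < r"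
    have S_scale: "s * t \<in> S (s *\<^sub>R x)" if "t \<in> S x" "0 < s" for s t x
    proof -
      have "cpos (s *\<^sub>R (of_real t - re x))" using that by (intro cpos_scaleR) (auto simp: S_def)
      then show ?thesis by (simp add: S_def re of_real_def algebra_simps)
    qed
    have le: "q (s *\<^sub>R x) \<le> s * q x" if s: "0 < s" for s x
    proof -
      have "q (s *\<^sub>R x) / s \<le> q x"
        using s q_le[OF S_scale[OF _ s]] by (intro q_ge) (simp add: field_simps)
      then show ?thesis using s by (simp add: field_simps)
    qed
    show "q (r *\<^sub>R x) = r * q x"
      using le[of r x] le[of "1 / r" "r *\<^sub>R x"] r by (simp add: field_simps)
  next
    have "re 0 = 0" by (simp add: re_def)
    then have "S 0 = {0..}" by (auto simp: S_def cpos_of_real_iff)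
    then show "q 0 = 0" by (simp add: q_def)
  qed
  define p where "p = star a * a"
  have sp: "star p = p" by (simp add: p_def star_mult star_star)
  obtain f where f: "linear f" "\<And>x. f x \<le> q x" "f p = q p"
    using Hahn_Banach[OF \<open>sublinear q\<close>] by metis
  have f_add: "f (x + y) = f x + f y" and f_scale: "f (r *\<^sub>R x) = r * f x" and f_neg: "f (- x) = - f x" for x y r
    using f(1) by (simp_all add: linear_add linear_scale linear_neg)
  have q_neg: "q (- (star x * x)) \<le> 0" for x
  proof (rule q_le)
    have "re (- (star x * x)) = - (star x * x)" by (intro re_sa) (simp add: star_minus star_mult star_star)
    then show "0 \<in> S (- (star x * x))" using cpos_star_mult[of x] by (simp add: S_def)
  qed
  have pos: "0 \<le> f (star x * x)" for x
    using f(2)[of "- (star x * x)"] q_neg[of x] by (simp add: f_neg)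
  have skew: "f x = 0" if "star x = - x" for x
  proof -
    have le0: "f y \<le> 0" if "star y = - y" for y
    proof -
      have "0 \<in> S y" using that cpos_of_real[of 0] by (simp add: S_def re_def)
      then show ?thesis using f(2)[of y] q_le by (meson order_trans)
    qed
    show ?thesis using le0[of x] le0[of "- x"] that by (simp add: f_neg star_minus)
  qed
  \<comment> \<open>With \<open>q p = 0\<close>, both \<open>e - p\<close> and \<open>e + p\<close>
    would be positive for every e > 0, the second by Kaplansky's theorem; then \<open>p\<close> and
    hence \<open>a\<close> would vanish.\<close>
  have "q p \<noteq> 0"
  proof
    assume "q p = 0"
    have "norm p \<le> e" if e: "0 < e" for e
    proof (rule norm_le_of_cpos)
      obtain t where t: "t \<in> S p" "t < e"
        using q_ge[of p e] \<open>q p = 0\<close> e by force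
      have "cpos ((of_real t - p) + of_real (e - t))"
        using t re_sa[OF sp] by (intro cpos_add cpos_of_real) (auto simp: S_def)
      then show "cpos (of_real e - p)" by (simp add: algebra_simps)
      show "cpos (of_real e + p)"
        unfolding p_def using e by (intro cpos_add cpos_of_real cpos_star_mult) auto
      show "0 \<le> e" using e by simp
    qed
    then have "norm p \<le> 0" using field_le_epsilon[of "norm p" 0] by auto
    then show False using a by (simp add: p_def norm_star_mult_self)
  qed
  \<comment> \<open>This is the usual complexification of a real-linear functional. It is real on
    selfadjoint \<open>x\<close> because \<open>\<i> *\<^sub>C x\<close> is then skew.\<close>
  define \<phi> where "\<phi> x = Complex (f x) (- f (\<i> *\<^sub>C x))" for x
  have i_sa: "f (\<i> *\<^sub>C x) = 0" if "star x = x" for x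
    using that by (intro skew) (simp add: star_scaleC)
  have "clinear \<phi>"
    unfolding clinear_iff
  proof (intro conjI allI)
    fix x y show "\<phi> (x + y) = \<phi> x + \<phi> y"
      by (simp add: \<phi>_def f_add scaleC_add_right complex_eq_iff)
  next
    fix z and x :: 'a
    have z: "z *\<^sub>C x = Re z *\<^sub>R x + Im z *\<^sub>R (\<i> *\<^sub>C x)" for z and x :: 'a
      unfolding scaleR_scaleC scaleC_scaleC scaleC_add_left[symmetric]
      by (rule arg_cong[where f = "\<lambda>z. z *\<^sub>C x"]) (simp add: complex_eq_iff)
    have iz: "\<i> *\<^sub>C (z *\<^sub>C x) = (- Im z) *\<^sub>R x + Re z *\<^sub>R (\<i> *\<^sub>C x)"
      using z[of "\<i> * z" x] by (simp add: scaleC_scaleC)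
    show "\<phi> (z *\<^sub>C x) = z *\<^sub>C \<phi> x"
      unfolding \<phi>_def iz unfolding z[of z x]
      by (simp add: f_add f_scale f_neg linear_diff[OF f(1)] scaleC_complex_def complex_eq_iff)
  qed
  moreover have "\<phi> (star x * x) = of_real (f (star x * x))" for x
    by (simp add: \<phi>_def i_sa star_mult star_star complex_eq_iff)
  ultimately show thesis
    using pos \<open>q p \<noteq> 0\<close> f(3) by (intro that[of \<phi>]) (auto simp: positive_functional_def p_def)
qed

section \<open>The unitization as a unital C*-algebra\<close>

datatype 'a unitization = Unitization (uscalar: complex) (uelem: 'a)

lemma unitization_eq_iff: "u = v \<longleftrightarrow> uscalar u = uscalar v \<and> uelem u = uelem v"
  by (cases u; cases v) auto

instantiation unitization :: (cstar_algebra) "{ring_1, complex_vector}"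
begin
definition "0 = Unitization 0 0"
definition "1 = Unitization 1 0"
definition "u + v = Unitization (uscalar u + uscalar v) (uelem u + uelem v)"
definition "u - v = Unitization (uscalar u - uscalar v) (uelem u - uelem v)"
definition "- u = Unitization (- uscalar u) (- uelem u)"
definition "u * v = Unitization (uscalar u * uscalar v)
  (uscalar u *\<^sub>C uelem v + uscalar v *\<^sub>C uelem u + uelem u * uelem v)"
definition "z *\<^sub>C u = Unitization (z * uscalar u) (z *\<^sub>C uelem u)"
instance
  by standard
    (simp_all add: unitization_eq_iff zero_unitization_def one_unitization_def plus_unitization_def
      minus_unitization_def uminus_unitization_def times_unitization_def scaleC_unitization_def
      algebra_simps scaleC_add_left scaleC_add_right scaleC_scaleC scaleC_one mult_scaleC_left mult_scaleC_right)
end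

text \<open>Left multiplication by scalar plus element on the ideal \<open>'a\<close>. Its operator
  norm is the part of the unitization norm that satisfies the C*-identity for the nonscalar
  component.\<close>

definition uaction :: "'a::cstar_algebra unitization \<Rightarrow> 'a \<Rightarrow> 'a"
  where "uaction u x = uscalar u *\<^sub>C x + uelem u * x"

lemmas unitization_defs = zero_unitization_def one_unitization_def plus_unitization_def
  minus_unitization_def uminus_unitization_def times_unitization_def scaleC_unitization_def

lemma bounded_linear_uaction: "bounded_linear (uaction u)"
proof (rule bounded_linear_intro[where K = "cmod (uscalar u) + norm (uelem u)"])
  show "uaction u (x + y) = uaction u x + uaction u y" for x y
    by (simp add: uaction_def scaleC_add_right distrib_left)
  show "uaction u (r *\<^sub>R x) = r *\<^sub>R uaction u x" for r x
    by (simp add: uaction_def scaleR_scaleC scaleC_add_right scaleC_scaleC mult_scaleC_right mult.commute)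
  show "norm (uaction u x) \<le> norm x * (cmod (uscalar u) + norm (uelem u))" for x
  proof -
    have "norm (uaction u x) \<le> norm (uscalar u *\<^sub>C x) + norm (uelem u * x)"
      unfolding uaction_def by (rule norm_triangle_ineq)
    also have "\<dots> \<le> cmod (uscalar u) * norm x + norm (uelem u) * norm x"
      by (intro add_mono norm_mult_ineq) (simp add: norm_scaleC)
    finally show ?thesis by (simp add: algebra_simps)
  qed
qed

lemma uaction_simps: "uaction (u + v) x = uaction u x + uaction v x" "uaction (u * v) x = uaction u (uaction v x)"
  "uaction (z *\<^sub>C u) x = z *\<^sub>C uaction u x" "uaction 1 x = x" "uaction (Unitization 0 a) x = a * x"
  "uaction (Unitization z 0) x = z *\<^sub>C x"
  by (simp_all add: uaction_def unitization_defs scaleC_add_left scaleC_add_right scaleC_scaleC scaleC_one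
      distrib_left distrib_right mult_scaleC_left mult_scaleC_right mult.assoc add_ac)

instantiation unitization :: (cstar_algebra) real_algebra_1
begin
definition "r *\<^sub>R u = complex_of_real r *\<^sub>C (u :: 'a unitization)"
instance
  by standard
    (simp_all add: scaleR_unitization_def scaleC_add_left scaleC_add_right scaleC_scaleC scaleC_one
      unitization_eq_iff unitization_defs mult_scaleC_left mult_scaleC_right mult_ac distrib_left distrib_right)
end

text \<open>The operator norm alone vanishes on \<open>(-1, 1)\<close> if the algebra already has a unit.\<close>

instantiation unitization :: (cstar_algebra) real_normed_algebra_1
begin
definition norm_unitization_def: "norm u = max (cmod (uscalar u)) (onorm (uaction u))"
definition sgn_unitization_def: "sgn u = (u :: 'a unitization) /\<^sub>R norm u"
definition dist_unitization_def: "dist u v = norm (u - v :: 'a unitization)"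
definition uniformity_unitization_def: "(uniformity :: ('a unitization \<times> 'a unitization) filter) =
  (INF e\<in>{0 <..}. principal {(x, y). dist x y < e})"
definition open_unitization_def: "open (U :: 'a unitization set) \<longleftrightarrow> (\<forall>x\<in>U. eventually (\<lambda>(x', y). x' = x \<longrightarrow> y \<in> U) uniformity)"
instance
proof
  fix u v :: "'a unitization" and r s :: real

  show "dist u v = norm (u - v)" "sgn u = u /\<^sub>R norm u"
    by (simp_all add: dist_unitization_def sgn_unitization_def)
  show "(uniformity :: ('a unitization \<times> 'a unitization) filter) = (INF e\<in>{0 <..}. principal {(x, y). dist x y < e})"
    by (rule uniformity_unitization_def)
  show "open U \<longleftrightarrow> (\<forall>x\<in>U. eventually (\<lambda>(x', y). x' = x \<longrightarrow> y \<in> U) uniformity)" for U :: "'a unitization set"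
    by (rule open_unitization_def)
  note bl = bounded_linear_uaction
  show "norm u = 0 \<longleftrightarrow> u = 0"
  proof
    assume u: "norm u = 0"
    have "0 \<le> onorm (uaction u)" by (rule onorm_pos_le[OF bl])
    then have "cmod (uscalar u) = 0" "onorm (uaction u) = 0"
      using u norm_ge_zero[of "uscalar u"] by (auto simp: norm_unitization_def max_def split: if_splits)
    then have z: "uscalar u = 0" and "uaction u x = 0" for x
      using onorm[OF bl, of u x] by auto
    then have "uaction u (star (uelem u)) = 0" by blast
    then have "star (star (uelem u)) * star (uelem u) = 0" by (simp add: uaction_def z star_star)
    then have "norm (star (uelem u)) = 0"
      using norm_star_mult_self[of "star (uelem u)"] by simp
    then have "uelem u = 0" by (simp only: norm_star) simp
    then show "u = 0" using z by (simp add: unitization_eq_iff zero_unitization_def)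
  next
    assume "u = 0"
    then have "uaction u = (\<lambda>x. 0)" by (simp add: uaction_def unitization_defs fun_eq_iff)
    then show "norm u = 0" using \<open>u = 0\<close> by (simp add: norm_unitization_def unitization_defs onorm_zero)
  qed
  show "norm (u + v) \<le> norm u + norm v"
  proof -
    have "onorm (uaction (u + v)) \<le> onorm (uaction u) + onorm (uaction v)"
      using onorm_triangle[OF bl bl, of u v] by (simp add: uaction_simps[abs_def])
    moreover have "cmod (uscalar (u + v)) \<le> cmod (uscalar u) + cmod (uscalar v)"
      by (simp add: unitization_defs norm_triangle_ineq)
    ultimately show ?thesis by (auto simp: norm_unitization_def)
  qed
  show "norm (r *\<^sub>R u) = \<bar>r\<bar> * norm u"
  proof -
    have "onorm (uaction (r *\<^sub>R u)) = \<bar>r\<bar> * onorm (uaction u)"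
      using onorm_scaleR[OF bl, of r u]
      by (simp add: scaleR_unitization_def uaction_simps[abs_def] scaleR_scaleC)
    then show ?thesis
      by (simp add: norm_unitization_def) (simp add: scaleR_unitization_def unitization_defs norm_mult max_mult_distrib_left)
  qed
  show "norm (u * v) \<le> norm u * norm v"
  proof -
    have "onorm (uaction (u * v)) \<le> onorm (uaction u) * onorm (uaction v)"
      using onorm_compose[OF bl bl, of u v] by (simp add: uaction_simps[abs_def] comp_def)
    also have "\<dots> \<le> norm u * norm v"
      by (intro mult_mono) (auto simp: norm_unitization_def onorm_pos_le[OF bl] le_max_iff_disj)
    finally have "onorm (uaction (u * v)) \<le> norm u * norm v" .
    moreover have "cmod (uscalar (u * v)) \<le> norm u * norm v"
      unfolding norm_unitization_def by (auto simp: unitization_defs norm_mult le_max_iff_disj intro!: mult_mono)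
    ultimately show ?thesis by (simp add: norm_unitization_def)
  qed
  show "norm (1 :: 'a unitization) = 1"
  proof -
    have "uaction 1 = (\<lambda>x :: 'a. x)" by (simp add: uaction_simps fun_eq_iff)
    moreover have "onorm (\<lambda>x :: 'a. x) \<le> 1" by (rule onorm_id_le)
    ultimately show ?thesis by (simp add: norm_unitization_def) (simp add: unitization_defs)
  qed
qed
end

lemma norm_unitization_ge: "cmod (uscalar u) \<le> norm u" "norm (uaction u x) \<le> norm u * norm x"
proof -
  show "cmod (uscalar u) \<le> norm u" by (simp add: norm_unitization_def)
  have "norm (uaction u x) \<le> onorm (uaction u) * norm x" by (rule onorm[OF bounded_linear_uaction])
  also have "\<dots> \<le> norm u * norm x" by (intro mult_right_mono) (auto simp: norm_unitization_def)
  finally show "norm (uaction u x) \<le> norm u * norm x" .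
qed

lemma norm_unitization_le:
  assumes "cmod (uscalar u) \<le> c" "\<And>x. norm (uaction u x) \<le> c * norm x"
  shows "norm u \<le> c"
  using assms by (simp add: norm_unitization_def) (meson norm_ge_zero onorm_bound order_trans)

text \<open>The operator norm of left multiplication by \<open>a\<close> is attained in the
  direction of \<open>star a\<close>, by the C*-identity.\<close>

lemma norm_Unitization_0: "norm (Unitization 0 a) = norm a"
proof (rule antisym)
  show "norm (Unitization 0 a) \<le> norm a"
    by (rule norm_unitization_le) (simp_all add: uaction_simps norm_mult_ineq)
  have "(norm a)\<^sup>2 = norm (uaction (Unitization 0 a) (star a))"
    using norm_star_mult_self[of "star a"] by (simp add: uaction_simps star_star norm_star)
  also have "\<dots> \<le> norm (Unitization 0 a) * norm a"
    using norm_unitization_ge(2)[of "Unitization 0 a" "star a"] by (simp add: norm_star)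
  finally show "norm a \<le> norm (Unitization 0 a)"
    by (cases "norm a = 0") (simp_all add: power2_eq_square)
qed

lemma norm_Unitization_scalar: "norm (Unitization z (0 :: 'a::cstar_algebra)) = cmod z"
  using norm_unitization_ge(1)[of "Unitization z (0 :: 'a)"]
  by (intro antisym norm_unitization_le) (simp_all add: uaction_simps norm_scaleC)

text \<open>The norm controls both components, with factors 1 and 2, so a Cauchy sequence converges
  componentwise.\<close>

instance unitization :: (cstar_algebra) banach
proof
  fix X :: "nat \<Rightarrow> 'a unitization" assume X: "Cauchy X"
  have split: "u = Unitization (uscalar u) 0 + Unitization 0 (uelem u)" for u :: "'a unitization"
    by (simp add: unitization_eq_iff unitization_defs)
  have z_le: "cmod (uscalar u) \<le> norm u" for u :: "'a unitization" by (rule norm_unitization_ge)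
  have a_le: "norm (uelem u) \<le> 2 * norm u" for u :: "'a unitization"
  proof -
    have "Unitization 0 (uelem u) = u - Unitization (uscalar u) 0" by (simp add: unitization_eq_iff unitization_defs)
    then have "norm (uelem u) \<le> norm u + cmod (uscalar u)"
      by (metis norm_Unitization_0 norm_Unitization_scalar norm_triangle_ineq4)
    then show ?thesis using z_le[of u] by simp
  qed
  have diff: "uscalar (u - v) = uscalar u - uscalar v" "uelem (u - v) = uelem u - uelem v" for u v :: "'a unitization"
    by (simp_all add: unitization_defs)
  have "Cauchy (\<lambda>n. uscalar (X n))"
  proof (rule metric_CauchyI)
    fix e :: real assume "0 < e"
    then obtain M where "\<And>m n. m \<ge> M \<Longrightarrow> n \<ge> M \<Longrightarrow> dist (X m) (X n) < e" using metric_CauchyD[OF X] by blast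
    then show "\<exists>M. \<forall>m\<ge>M. \<forall>n\<ge>M. dist (uscalar (X m)) (uscalar (X n)) < e"
      using z_le by (metis diff(1) dist_norm order_le_less_trans)
  qed
  then obtain z where z: "(\<lambda>n. uscalar (X n)) \<longlonglongrightarrow> z" using Cauchy_convergent convergent_def by blast
  have "Cauchy (\<lambda>n. uelem (X n))"
  proof (rule metric_CauchyI)
    fix e :: real assume "0 < e"
    then obtain M where M: "\<And>m n. m \<ge> M \<Longrightarrow> n \<ge> M \<Longrightarrow> dist (X m) (X n) < e / 2"
      using metric_CauchyD[OF X, of "e / 2"] by auto
    have "dist (uelem (X m)) (uelem (X n)) < e" if "m \<ge> M" "n \<ge> M" for m n
      using M[OF that] a_le[of "X m - X n"] by (simp add: dist_norm diff)
    then show "\<exists>M. \<forall>m\<ge>M. \<forall>n\<ge>M. dist (uelem (X m)) (uelem (X n)) < e" by blast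
  qed
  then obtain a where a: "(\<lambda>n. uelem (X n)) \<longlonglongrightarrow> a" using Cauchy_convergent convergent_def by blast
  have "X \<longlonglongrightarrow> Unitization z a"
  proof (rule tendsto_dist_iff[THEN iffD2], rule tendsto_sandwich[where f = "\<lambda>_. 0"])
    show "\<forall>\<^sub>F n in sequentially. dist (X n) (Unitization z a) \<le> dist (uscalar (X n)) z + dist (uelem (X n)) a"
    proof (rule always_eventually, rule allI)
      fix n
      have "norm (X n - Unitization z a) \<le> norm (Unitization (uscalar (X n) - z) (0 :: 'a)) + norm (Unitization 0 (uelem (X n) - a))"
        by (subst split) (auto simp: diff intro: norm_triangle_ineq)
      then show "dist (X n) (Unitization z a) \<le> dist (uscalar (X n)) z + dist (uelem (X n)) a"
        by (simp add: dist_norm norm_Unitization_0 norm_Unitization_scalar)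
    qed
    show "(\<lambda>n. dist (uscalar (X n)) z + dist (uelem (X n)) a) \<longlonglongrightarrow> 0"
      using tendsto_add[OF tendsto_dist_iff[THEN iffD1, OF z] tendsto_dist_iff[THEN iffD1, OF a]] by simp
  qed auto
  then show "convergent X" by (auto simp: convergent_def)
qed

instantiation unitization :: (cstar_algebra) cstar_algebra
begin
definition "star u = Unitization (cnj (uscalar u)) (star (uelem u))"
instance
proof
  fix u v :: "'a unitization" and z :: complex and r :: real
  show "r *\<^sub>R u = complex_of_real r *\<^sub>C u" by (rule scaleR_unitization_def)
  show "norm (z *\<^sub>C u) = cmod z * norm u"
  proof -
    have le: "norm (z *\<^sub>C u) \<le> cmod z * norm u" for z and u :: "'a unitization"
    proof (rule norm_unitization_le)
      show "cmod (uscalar (z *\<^sub>C u)) \<le> cmod z * norm u"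
        by (simp add: unitization_defs norm_mult mult_left_mono norm_unitization_ge)
      show "norm (uaction (z *\<^sub>C u) x) \<le> cmod z * norm u * norm x" for x
        by (simp add: uaction_simps norm_scaleC mult_left_mono norm_unitization_ge mult.assoc)
    qed
    show ?thesis
    proof (cases "z = 0")
      case False
      have "norm u = norm (inverse z *\<^sub>C z *\<^sub>C u)" using False by (simp add: scaleC_scaleC scaleC_one)
      also have "\<dots> \<le> cmod (inverse z) * norm (z *\<^sub>C u)" by (rule le)
      finally have "norm u \<le> norm (z *\<^sub>C u) / cmod z" by (simp only: norm_inverse divide_inverse mult.commute)
      then have "cmod z * norm u \<le> norm (z *\<^sub>C u)" using False by (simp add: field_simps)
      then show ?thesis using le[of z u] by simp
    qed simp
  qed
  show "z *\<^sub>C u * v = z *\<^sub>C (u * v)" "u * z *\<^sub>C v = z *\<^sub>C (u * v)" "star (star u) = u"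
    "star (u + v) = star u + star v" "star (z *\<^sub>C u) = cnj z *\<^sub>C star u" "star (u * v) = star v * star u"
    by (simp_all add: unitization_eq_iff unitization_defs star_unitization_def scaleC_add_right scaleC_scaleC
        mult_scaleC_left mult_scaleC_right star_star star_add star_scaleC star_mult mult_ac add_ac)
  have adj: "star (uaction u x) * y = star x * uaction (star u) y" for u :: "'a unitization" and x y
    by (simp add: uaction_def star_unitization_def star_add star_scaleC star_mult distrib_left distrib_right
        mult_scaleC_left mult_scaleC_right mult.assoc)
  \<comment> \<open>This half of the C*-identity suffices, since it also makes the involution
    isometric. For the operator part, \<open>uaction u x\<close> is paired with itself and
    \<open>u\<close> is moved to the other side by \<open>adj\<close>, leaving the action of
    \<open>star u * u\<close>.\<close>
  have ge: "(norm u)\<^sup>2 \<le> norm (star u * u)" for u :: "'a unitization"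
  proof -
    define s where "s = sqrt (norm (star u * u))"
    have s: "s * s = norm (star u * u)" "0 \<le> s" by (simp_all add: s_def)
    have "norm u \<le> s"
    proof (rule norm_unitization_le)
      have "(cmod (uscalar u))\<^sup>2 = cmod (uscalar (star u * u))"
        by (simp add: unitization_defs star_unitization_def norm_mult power2_eq_square)
      also have "\<dots> \<le> s\<^sup>2" using norm_unitization_ge(1)[of "star u * u"] by (simp add: power2_eq_square s)
      finally show "cmod (uscalar u) \<le> s" using s(2) by (rule power2_le_imp_le)
      fix x
      have "(norm (uaction u x))\<^sup>2 = norm (star x * uaction (star u * u) x)"
        by (simp add: norm_star_mult_self[symmetric] adj uaction_simps)
      also have "\<dots> \<le> norm x * (norm (star u * u) * norm x)"
        by (rule order_trans[OF norm_mult_ineq]) (simp add: norm_star mult_left_mono norm_unitization_ge)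
      also have "\<dots> = (s * norm x)\<^sup>2" by (simp add: power2_eq_square s(1)[symmetric] mult_ac)
      finally show "norm (uaction u x) \<le> s * norm x" using s(2) by (auto intro: power2_le_imp_le)
    qed
    then have "(norm u)\<^sup>2 \<le> s\<^sup>2" by (intro power_mono) auto
    then show ?thesis by (simp add: power2_eq_square s)
  qed
  have le: "norm u \<le> norm (star u)" for u :: "'a unitization"
  proof (cases "norm u = 0")
    case False
    have "norm u * norm u \<le> norm (star u) * norm u"
      using ge[of u] norm_mult_ineq[of "star u" u] by (simp add: power2_eq_square)
    then show ?thesis using False by simp
  qed simp
  have "norm (star u) \<le> norm u"
    using le[of "star u"] by (simp add: star_unitization_def star_star)
  then have "norm (star u * u) \<le> norm u * norm u"
    by (meson norm_mult_ineq mult_right_mono norm_ge_zero order_trans)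
  then show "norm (star u * u) = (norm u)\<^sup>2" using ge[of u] by (simp add: power2_eq_square)
qed
end

theorem exists_positive_functional:
  fixes a :: "'a::cstar_algebra"
  assumes "a \<noteq> 0"
  obtains \<phi> :: "'a \<Rightarrow> complex" where "positive_functional (*) star \<phi>" "\<phi> (star a * a) \<noteq> 0"
proof -
  have "Unitization 0 a \<noteq> 0" using assms by (simp add: zero_unitization_def)
  then obtain \<psi> :: "'a unitization \<Rightarrow> complex" where \<psi>: "positive_functional (*) star \<psi>"
      "\<psi> (star (Unitization 0 a) * Unitization 0 a) \<noteq> 0"
    using exists_positive_functional_unital by blast
  have sm: "star (Unitization 0 x) * Unitization 0 x = Unitization 0 (star x * x)" for x :: 'a
    by (simp add: unitization_defs star_unitization_def)
  have add: "Unitization 0 (x + y) = Unitization 0 x + Unitization 0 y" and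
    scale: "Unitization 0 (z *\<^sub>C x) = z *\<^sub>C Unitization 0 x" for x y :: 'a and z
    by (simp_all add: unitization_defs)
  have "clinear (\<lambda>x. \<psi> (Unitization 0 x))"
    using \<psi>(1) unfolding positive_functional_def clinear_iff by (simp add: add scale)
  moreover have "Im (\<psi> (Unitization 0 (star x * x))) = 0 \<and> 0 \<le> Re (\<psi> (Unitization 0 (star x * x)))" for x
    using \<psi>(1) unfolding positive_functional_def sm[symmetric] by blast
  ultimately show thesis
    using \<psi>(2) by (intro that[of "\<lambda>x. \<psi> (Unitization 0 x)"]) (auto simp: positive_functional_def sm)
qed

section \<open>Multipliers of the Fermi tensor product\<close>

lemma positive_functionalD:
  assumes "positive_functional mul ast \<omega>"
  shows "\<omega> (x + y) = \<omega> x + \<omega> y" "\<omega> (z *\<^sub>C x) = z * \<omega> x" "\<omega> (x - y) = \<omega> x - \<omega> y" "\<omega> (- x) = - \<omega> x" "\<omega> 0 = 0"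
    "Im (\<omega> (mul (ast x) x)) = 0" "0 \<le> Re (\<omega> (mul (ast x) x))"
proof -
  interpret Vector_Spaces.linear scaleC scaleC \<omega>
    using assms by (simp add: positive_functional_def)
  show "\<omega> (x + y) = \<omega> x + \<omega> y" "\<omega> (z *\<^sub>C x) = z * \<omega> x" "\<omega> (x - y) = \<omega> x - \<omega> y" "\<omega> (- x) = - \<omega> x" "\<omega> 0 = 0"
    by (simp_all add: add scale diff neg zero scaleC_complex_def)
  show "Im (\<omega> (mul (ast x) x)) = 0" "0 \<le> Re (\<omega> (mul (ast x) x))"
    using assms by (auto simp: positive_functional_def)
qed

lemma star_algebraD:
  assumes "star_algebra mul ast"
  shows "mul (x + y) w = mul x w + mul y w" "mul w (x + y) = mul w x + mul w y"
    "mul (z *\<^sub>C x) w = z *\<^sub>C mul x w" "mul w (z *\<^sub>C x) = z *\<^sub>C mul w x"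
    "mul (x - y) w = mul x w - mul y w" "mul w (x - y) = mul w x - mul w y"
    "mul (mul x y) w = mul x (mul y w)"
    "ast (x + y) = ast x + ast y" "ast (x - y) = ast x - ast y" "ast (z *\<^sub>C x) = cnj z *\<^sub>C ast x"
    "ast (ast x) = x" "ast (mul x y) = mul (ast y) (ast x)"
proof -
  show add1: "mul (x + y) w = mul x w + mul y w" and add2: "mul w (x + y) = mul w x + mul w y" for x y w
    using assms unfolding star_algebra_def cbilinear_iff by blast+
  show "mul (z *\<^sub>C x) w = z *\<^sub>C mul x w" "mul w (z *\<^sub>C x) = z *\<^sub>C mul w x"
    using assms unfolding star_algebra_def cbilinear_iff by blast+
  show "mul (x - y) w = mul x w - mul y w" "mul w (x - y) = mul w x - mul w y"
    using add1[of "x - y" y w] add2[of w "x - y" y] by (simp_all add: algebra_simps)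
  show add3: "ast (x + y) = ast x + ast y" for x y
    using assms unfolding star_algebra_def antilinear_def by blast
  show "ast (x - y) = ast x - ast y"
    using add3[of "x - y" y] by (simp add: algebra_simps)
  show "mul (mul x y) w = mul x (mul y w)" "ast (z *\<^sub>C x) = cnj z *\<^sub>C ast x"
    "ast (ast x) = x" "ast (mul x y) = mul (ast y) (ast x)"
    using assms unfolding star_algebra_def antilinear_def by blast+
qed

text \<open>With \<open>(1 - w)\<^sup>2 = 1 - b\<^sup>*b\<close>, positivity at \<open>(1 - w) x\<close> says \<open>\<omega>((b x)\<^sup>*(b x)) \<le> \<omega>(x\<^sup>*x)\<close>.\<close>

lemma multiplier_bound:
  fixes L :: "'a::cstar_algebra \<Rightarrow> 't::complex_vector \<Rightarrow> 't"
  assumes alg: "star_algebra mul ast" and pos: "positive_functional mul ast \<omega>"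
    and add: "\<And>a b x. L (a + b) x = L a x + L b x" and scale: "\<And>z a x. L (z *\<^sub>C a) x = z *\<^sub>C L a x"
    and mult: "\<And>a b x. L (a * b) x = L a (L b x)"
    and adj: "\<And>a x y. mul (ast (L a x)) y = mul (ast x) (L (star a) y)"
  shows "Re (\<omega> (mul (ast (L a x)) (L a x))) \<le> (norm a + 1)\<^sup>2 * Re (\<omega> (mul (ast x) x))"
proof -
  note alg = star_algebraD[OF alg] and pos = positive_functionalD[OF pos]
  \<comment> \<open>The summand 1 makes \<open>norm b\<close> strictly less than 1, even for
    \<open>a = 0\<close>, as the square root requires. It is the origin of the constant in the
    bound.\<close>
  define r where "r = norm a + 1"
  have r: "0 < r" "norm a < r" by (simp_all add: r_def add_nonneg_pos)
  define b where "b = complex_of_real (1 / r) *\<^sub>C a"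
  have b: "norm b < 1" "a = complex_of_real r *\<^sub>C b"
    using r by (simp_all add: b_def norm_scaleC scaleC_scaleC scaleC_one norm_divide)
  have "norm (star b * b) < 1" using b(1) by (simp add: norm_star_mult_self power_less_one_iff)
  moreover have "star (star b * b) = star b * b" by (simp add: star_mult star_star)
  ultimately obtain w where w: "star w = w" "w + w = star b * b + w * w"
    using selfadjoint_sqrt by metis
  define y where "y = L w x"
  have "y + y = L (star b) (L b x) + L w y"
    unfolding y_def add[symmetric] w(2) by (simp add: add mult)
  then have "mul (ast x) y + mul (ast x) y = mul (ast x) (L (star b) (L b x)) + mul (ast x) (L w y)"
    unfolding alg(2)[symmetric] by simp
  moreover have "mul (ast y) v = mul (ast x) (L w v)" for v
    by (simp add: y_def adj w(1))
  ultimately have "mul (ast (x - y)) (x - y) = mul (ast x) x - mul (ast (L b x)) (L b x)"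
    by (simp add: alg adj y_def[symmetric] algebra_simps)
  then have "Re (\<omega> (mul (ast (L b x)) (L b x))) \<le> Re (\<omega> (mul (ast x) x))"
    using pos(7)[of "x - y"] by (simp add: pos)
  then have "r\<^sup>2 * Re (\<omega> (mul (ast (L b x)) (L b x))) \<le> r\<^sup>2 * Re (\<omega> (mul (ast x) x))"
    by (intro mult_left_mono) auto
  moreover have "\<omega> (mul (ast (L a x)) (L a x)) = complex_of_real (r\<^sup>2) * \<omega> (mul (ast (L b x)) (L b x))"
    unfolding b(2) scale by (simp add: alg pos power2_eq_square)
  ultimately show ?thesis by (simp add: r_def)
qed

lemma graded_induct [consumes 1, case_names homogeneous add]:
  assumes "z2_grading \<theta>" "\<And>s a. s \<in> {1, -1} \<Longrightarrow> a \<in> graded_part \<theta> s \<Longrightarrow> P a"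
    "\<And>a b. P a \<Longrightarrow> P b \<Longrightarrow> P (a + b)"
  shows "P a"
proof -
  have "P (graded_comp \<theta> 1 a + graded_comp \<theta> (-1) a)"
    using graded_comp_in[OF assms(1)] by (intro assms(3) assms(2)[of 1] assms(2)[of "-1"]) auto
  then show ?thesis by (simp only: graded_comp_sum)
qed

text \<open>Left multiplication by \<open>a \<otimes> 1\<close> and by \<open>1 \<otimes> b\<close>, in the absence of units.\<close>

definition mult_first :: "'a::cstar_algebra \<Rightarrow> ('a, 'b::complex_vector) tensor \<Rightarrow> ('a, 'b) tensor"
  where "mult_first a = (SOME g. (\<forall>x y. g (x + y) = g x + g y) \<and> (\<forall>z x. g (z *\<^sub>C x) = z *\<^sub>C g x) \<and>
    (\<forall>x y. g (x \<otimes> y) = (a * x) \<otimes> y))"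

lemma mult_first:
  fixes x y :: "('a::cstar_algebra, 'b::complex_vector) tensor" and d :: 'b
  shows "mult_first a (x + y) = mult_first a x + mult_first a y" "mult_first a (z *\<^sub>C x) = z *\<^sub>C mult_first a x"
  "mult_first a (c \<otimes> d) = (a * c) \<otimes> d"
proof -
  have "\<exists>g :: ('a, 'b) tensor \<Rightarrow> _. (\<forall>x y. g (x + y) = g x + g y) \<and> (\<forall>z x. g (z *\<^sub>C x) = id z *\<^sub>C g x) \<and>
      (\<forall>x y. g (x \<otimes> y) = (a * x) \<otimes> y)"
    by (rule tensor_extension_exists[where \<sigma> = id])
      (simp_all add: distrib_left mult_scaleC_right tensor_add_left tensor_add_right tensor_scaleC_left tensor_scaleC_right)
  then have "\<exists>g :: ('a, 'b) tensor \<Rightarrow> _. (\<forall>x y. g (x + y) = g x + g y) \<and> (\<forall>z x. g (z *\<^sub>C x) = z *\<^sub>C g x) \<and>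
      (\<forall>x y. g (x \<otimes> y) = (a * x) \<otimes> y)" by simp
  from someI_ex[OF this, folded mult_first_def]
  show "mult_first a (x + y) = mult_first a x + mult_first a y" "mult_first a (z *\<^sub>C x) = z *\<^sub>C mult_first a x"
    "mult_first a (c \<otimes> d) = (a * c) \<otimes> d" by blast+
qed

text \<open>Moving \<open>b\<close> past the first factor costs a sign only when both are odd.
  Letting the odd component of \<open>b\<close> apply \<open>\<alpha>\<close> to the first factor
  encodes this sign without restricting to homogeneous elements, so the formula is linear in all
  arguments.\<close>

definition mult_second :: "('a::cstar_algebra \<Rightarrow> 'a) \<Rightarrow> ('b::cstar_algebra \<Rightarrow> 'b) \<Rightarrow> 'b \<Rightarrow>
    ('a, 'b) tensor \<Rightarrow> ('a, 'b) tensor"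
  where "mult_second \<alpha> \<beta> b = (SOME g. (\<forall>x y. g (x + y) = g x + g y) \<and> (\<forall>z x. g (z *\<^sub>C x) = z *\<^sub>C g x) \<and>
    (\<forall>x y. g (x \<otimes> y) = x \<otimes> (graded_comp \<beta> 1 b * y) + \<alpha> x \<otimes> (graded_comp \<beta> (-1) b * y)))"

lemma mult_second:
  assumes \<alpha>: "z2_grading \<alpha>"
  shows "mult_second \<alpha> \<beta> b (x + y) = mult_second \<alpha> \<beta> b x + mult_second \<alpha> \<beta> b y"
    "mult_second \<alpha> \<beta> b (z *\<^sub>C x) = z *\<^sub>C mult_second \<alpha> \<beta> b x"
    "mult_second \<alpha> \<beta> b (c \<otimes> d) = c \<otimes> (graded_comp \<beta> 1 b * d) + \<alpha> c \<otimes> (graded_comp \<beta> (-1) b * d)"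
proof -
  have "\<exists>g :: ('a, 'b) tensor \<Rightarrow> _. (\<forall>x y. g (x + y) = g x + g y) \<and> (\<forall>z x. g (z *\<^sub>C x) = id z *\<^sub>C g x) \<and>
      (\<forall>x y. g (x \<otimes> y) = x \<otimes> (graded_comp \<beta> 1 b * y) + \<alpha> x \<otimes> (graded_comp \<beta> (-1) b * y))"
    by (rule tensor_extension_exists[where \<sigma> = id])
      (simp_all add: z2_gradingD[OF \<alpha>] distrib_left mult_scaleC_right tensor_add_left tensor_add_right
        tensor_scaleC_left tensor_scaleC_right scaleC_add_right add_ac)
  then have "\<exists>g :: ('a, 'b) tensor \<Rightarrow> _. (\<forall>x y. g (x + y) = g x + g y) \<and> (\<forall>z x. g (z *\<^sub>C x) = z *\<^sub>C g x) \<and>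
      (\<forall>x y. g (x \<otimes> y) = x \<otimes> (graded_comp \<beta> 1 b * y) + \<alpha> x \<otimes> (graded_comp \<beta> (-1) b * y))" by simp
  from someI_ex[OF this, folded mult_second_def]
  show "mult_second \<alpha> \<beta> b (x + y) = mult_second \<alpha> \<beta> b x + mult_second \<alpha> \<beta> b y"
    "mult_second \<alpha> \<beta> b (z *\<^sub>C x) = z *\<^sub>C mult_second \<alpha> \<beta> b x"
    "mult_second \<alpha> \<beta> b (c \<otimes> d) = c \<otimes> (graded_comp \<beta> 1 b * d) + \<alpha> c \<otimes> (graded_comp \<beta> (-1) b * d)" by blast+
qed

lemma tensor_zero: "a \<otimes> (0 :: 'b::complex_vector) = 0" "(0 :: 'a::complex_vector) \<otimes> b = 0"
  using tensor_scaleC_right[of a 0 "0::'b"] tensor_scaleC_left[of 0 "0::'a" b] by simp_all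

lemma mult_second_homogeneous:
  assumes \<alpha>: "z2_grading \<alpha>" and "s \<in> {1, -1}" "t \<in> {1, -1}" "b \<in> graded_part \<beta> s" "c \<in> graded_part \<alpha> t"
  shows "mult_second \<alpha> \<beta> b (c \<otimes> d) = grade_sign s t *\<^sub>C (c \<otimes> (b * d))"
proof -
  have "\<alpha> c = t *\<^sub>C c" using assms(5) by (simp add: graded_part_def)
  then show ?thesis
    using assms(2,3) graded_comp_same[OF assms(2,4)]
    by (auto simp: mult_second[OF \<alpha>] grade_sign_def tensor_zero tensor_scaleC_left scaleC_one)
qed

section \<open>Adjoints of the multipliers and bounds uniform in the functional\<close>

locale fermi =
  fixes \<alpha> :: "'a::cstar_algebra \<Rightarrow> 'a" and \<beta> :: "'b::cstar_algebra \<Rightarrow> 'b"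
  assumes \<alpha>: "z2_grading \<alpha>" and \<beta>: "z2_grading \<beta>"
begin

abbreviation "mul \<equiv> fermi_mult \<alpha> \<beta>"
abbreviation "ast \<equiv> fermi_star \<alpha> \<beta>"

lemmas alg = fermi_star_algebra[OF \<alpha> \<beta>]
lemmas algD = star_algebraD[OF alg]
lemmas mulD = is_fermi_multD[OF fermi_mult_correct[OF \<alpha> \<beta>]]
lemmas astD = is_fermi_starD[OF fermi_star_correct[OF \<alpha> \<beta>]]
lemmas graded_mult = graded_part_mult[OF \<alpha>] graded_part_mult[OF \<beta>]
lemmas graded_star = graded_part_star[OF \<alpha>] graded_part_star[OF \<beta>]
lemmas right = mult_second[OF \<alpha>, of \<beta>]
lemmas right_hom = mult_second_homogeneous[OF \<alpha>, of _ _ _ \<beta>]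

lemma sign_mult: "r \<in> {1, -1} \<Longrightarrow> s \<in> {1, -1} \<Longrightarrow> r * s \<in> {1, -1 :: complex}"
  by auto

lemma mult_first_add: "mult_first (a + b) (x :: ('a, 'b) tensor) = mult_first a x + mult_first b x"
  by (induction x rule: tensor_induct) (simp_all add: mult_first distrib_right tensor_add_left)

lemma mult_first_scale: "mult_first (z *\<^sub>C a) (x :: ('a, 'b) tensor) = z *\<^sub>C mult_first a x"
  by (induction x rule: tensor_induct) (simp_all add: mult_first mult_scaleC_left tensor_scaleC_left scaleC_add_right)

lemma mult_first_mult: "mult_first (a * b) (x :: ('a, 'b) tensor) = mult_first a (mult_first b x)"
  by (induction x rule: tensor_induct) (simp_all add: mult_first mult.assoc)

text \<open>By linearity everything may be taken homogeneous. There \<open>grade_sign\<close> is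
  symmetric and multiplicative in each argument, so the grade of \<open>a\<close> contributes the
  same sign against that of \<open>d\<close> on both sides.\<close>

lemma mult_first_adj: "mul (ast (mult_first a x)) y = mul (ast x) (mult_first (star a) y)"
  using \<alpha>
proof (induction a rule: graded_induct)
  case (homogeneous s a)
  show ?case using \<alpha> \<beta>
  proof (induction x rule: tensor_graded_induct)
    case (tensor r t c d)
    note 1 = this
    show ?case using \<alpha> \<beta>
    proof (induction y rule: tensor_graded_induct)
      case (tensor p q A B)
      note 2 = this
      have "mul (ast (mult_first a (c \<otimes> d))) (A \<otimes> B) =
          (grade_sign (s * r) t * grade_sign t p) *\<^sub>C ((star c * star a * A) \<otimes> (star d * B))"
        using astD[OF sign_mult[OF homogeneous(1) 1(1)] 1(2) graded_mult(1)[OF homogeneous(2) 1(3)] 1(4)]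
          mulD[OF sign_mult[OF homogeneous(1) 1(1)] 1(2) 2(1,2) graded_star(1)[OF sign_mult[OF homogeneous(1) 1(1)] graded_mult(1)[OF homogeneous(2) 1(3)]]
            graded_star(2)[OF 1(2,4)] 2(3,4)]
        by (simp add: mult_first algD scaleC_scaleC star_mult)
      moreover have "mul (ast (c \<otimes> d)) (mult_first (star a) (A \<otimes> B)) =
          (grade_sign r t * grade_sign t (s * p)) *\<^sub>C ((star c * (star a * A)) \<otimes> (star d * B))"
        using astD[OF 1] mulD[OF 1(1,2) sign_mult[OF homogeneous(1) 2(1)] 2(2) graded_star(1)[OF 1(1,3)] graded_star(2)[OF 1(2,4)]
            graded_mult(1)[OF graded_star(1)[OF homogeneous] 2(3)] 2(4)]
        by (simp add: mult_first algD scaleC_scaleC)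
      moreover have "grade_sign (s * r) t * grade_sign t p = grade_sign r t * grade_sign t (s * p)"
        using homogeneous(1) 1(1,2) 2(1,2) by (auto simp: grade_sign_def)
      ultimately show ?case by (simp add: mult.assoc)
    qed (simp add: mult_first algD)
  qed (simp add: mult_first algD)
qed (simp add: mult_first_add algD star_add)

lemma mult_second_add: "mult_second \<alpha> \<beta> (a + b) x = mult_second \<alpha> \<beta> a x + mult_second \<alpha> \<beta> b x"
  by (induction x rule: tensor_induct)
    (simp_all add: right graded_comp_linear[OF \<beta>] distrib_right tensor_add_right add_ac)

lemma mult_second_scale: "mult_second \<alpha> \<beta> (z *\<^sub>C a) x = z *\<^sub>C mult_second \<alpha> \<beta> a x"
  by (induction x rule: tensor_induct)
    (simp_all add: right graded_comp_linear[OF \<beta>] mult_scaleC_left tensor_scaleC_right scaleC_add_right)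

lemma mult_second_mult: "mult_second \<alpha> \<beta> (a * b) x = mult_second \<alpha> \<beta> a (mult_second \<alpha> \<beta> b x)"
  using \<beta>
proof (induction a rule: graded_induct)
  case (homogeneous s a)
  note 1 = this
  show ?case using \<beta>
  proof (induction b rule: graded_induct)
    case (homogeneous t b)
    note 2 = this
    show ?case using \<alpha> \<beta>
    proof (induction x rule: tensor_graded_induct)
      case (tensor p q c d)
      have "grade_sign (s * t) p = grade_sign s p * grade_sign t p"
        using 1(1) 2(1) tensor(1) by (auto simp: grade_sign_def)
      then show ?case
        using right_hom[OF sign_mult[OF 1(1) 2(1)] tensor(1) graded_mult(2)[OF 1(2) 2(2)] tensor(3)]
          right_hom[OF 1(1) tensor(1) 1(2) tensor(3)] right_hom[OF 2(1) tensor(1) 2(2) tensor(3)]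
        by (simp add: right(1,2) scaleC_scaleC mult.assoc mult.commute)
    qed (simp add: right)
  qed (simp add: right mult_second_add distrib_left)
qed (simp add: mult_second_add distrib_right)

text \<open>This is where the sign in the involution matters. Moving \<open>b\<close> past
  \<open>c\<close> gives the sign of the grades \<open>s\<close> and \<open>r\<close>, the
  involution of the product gives it once more, and the two cancel.\<close>

lemma mult_second_adj: "mul (ast (mult_second \<alpha> \<beta> b x)) y = mul (ast x) (mult_second \<alpha> \<beta> (star b) y)"
  using \<beta>
proof (induction b rule: graded_induct)
  case (homogeneous s b)
  note 0 = this
  show ?case using \<alpha> \<beta>
  proof (induction x rule: tensor_graded_induct)
    case (tensor r t c d)
    note 1 = this
    show ?case using \<alpha> \<beta>
    proof (induction y rule: tensor_graded_induct)
      case (tensor p q A B)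
      note 2 = this
      note st = sign_mult[OF 0(1) 1(2)] and bd = graded_mult(2)[OF 0(2) 1(4)]
      have "mul (ast (mult_second \<alpha> \<beta> b (c \<otimes> d))) (A \<otimes> B) =
          (cnj (grade_sign s r) * grade_sign r (s * t) * grade_sign (s * t) p) *\<^sub>C ((star c * A) \<otimes> (star d * star b * B))"
        using right_hom[OF 0(1) 1(1) 0(2) 1(3)] astD[OF 1(1) st 1(3) bd]
          mulD[OF 1(1) st 2(1,2) graded_star(1)[OF 1(1,3)] graded_star(2)[OF st bd] 2(3,4)]
        by (simp add: algD scaleC_scaleC star_mult mult_ac)
      moreover have "mul (ast (c \<otimes> d)) (mult_second \<alpha> \<beta> (star b) (A \<otimes> B)) =
          (grade_sign r t * grade_sign s p * grade_sign t p) *\<^sub>C ((star c * A) \<otimes> (star d * (star b * B)))"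
        using astD[OF 1] right_hom[OF 0(1) 2(1) graded_star(2)[OF 0] 2(3)]
          mulD[OF 1(1,2) 2(1) sign_mult[OF 0(1) 2(2)] graded_star(1)[OF 1(1,3)] graded_star(2)[OF 1(2,4)]
            2(3) graded_mult(2)[OF graded_star(2)[OF 0] 2(4)]]
        by (simp add: algD scaleC_scaleC mult_ac)
      moreover have "cnj (grade_sign s r) * grade_sign r (s * t) * grade_sign (s * t) p = grade_sign r t * grade_sign s p * grade_sign t p"
        using 0(1) 1(1,2) 2(1,2) by (auto simp: grade_sign_def)
      ultimately show ?case by (simp add: mult.assoc)
    qed (simp add: right algD)
  qed (simp add: right algD)
qed (simp add: mult_second_add algD star_add)

lemma mul_tensor:
  assumes "r \<in> {1, -1}" "s \<in> {1, -1}" "a \<in> graded_part \<alpha> r" "b \<in> graded_part \<beta> s"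
  shows "mul (a \<otimes> b) x = mult_first a (mult_second \<alpha> \<beta> b x)"
  using \<alpha> \<beta>
proof (induction x rule: tensor_graded_induct)
  case (tensor p q c d)
  show ?case
    using mulD[OF assms(1,2) tensor(1,2) assms(3,4) tensor(3,4)] right_hom[OF assms(2) tensor(1) assms(4) tensor(3)]
    by (simp add: mult_first)
qed (simp add: mult_first right algD)

text \<open>On a homogeneous pure tensor, left multiplication is a composition of two multipliers,
  each bounded independently of \<open>\<omega>\<close>. Sums are handled by positivity of the
  form.\<close>

lemma uniform_bound:
  obtains K where "0 \<le> K" "\<And>\<omega> x. positive_functional mul ast \<omega> \<Longrightarrow>
    Re (\<omega> (mul (ast (mul c x)) (mul c x))) \<le> K * Re (\<omega> (mul (ast x) x))"
proof -
  \<comment> \<open>The functional is quantified inside the predicate, so the induction chooses the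
    constant before \<open>\<omega>\<close> and preserves uniformity.\<close>
  define bound where "bound c K \<longleftrightarrow> 0 \<le> K \<and> (\<forall>\<omega> x. positive_functional mul ast \<omega> \<longrightarrow>
    Re (\<omega> (mul (ast (mul c x)) (mul c x))) \<le> K * Re (\<omega> (mul (ast x) x)))" for c and K :: real
  have "\<exists>K. bound c K"
    using \<alpha> \<beta>
  proof (induction c rule: tensor_graded_induct)
    case (tensor r s a b)
    show ?case
      unfolding bound_def
    proof (intro exI[of _ "(norm a + 1)\<^sup>2 * (norm b + 1)\<^sup>2"] conjI allI impI)
      fix \<omega> x assume \<omega>: "positive_functional mul ast \<omega>"
      let ?y = "mult_second \<alpha> \<beta> b x"
      have "Re (\<omega> (mul (ast (mult_first a ?y)) (mult_first a ?y))) \<le> (norm a + 1)\<^sup>2 * Re (\<omega> (mul (ast ?y) ?y))"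
        by (rule multiplier_bound[where L = mult_first, OF alg \<omega> mult_first_add mult_first_scale mult_first_mult mult_first_adj])
      also have "Re (\<omega> (mul (ast ?y) ?y)) \<le> (norm b + 1)\<^sup>2 * Re (\<omega> (mul (ast x) x))"
        by (rule multiplier_bound[where L = "mult_second \<alpha> \<beta>", OF alg \<omega> mult_second_add mult_second_scale mult_second_mult mult_second_adj])
      finally show "Re (\<omega> (mul (ast (mul (a \<otimes> b) x)) (mul (a \<otimes> b) x)))
          \<le> (norm a + 1)\<^sup>2 * (norm b + 1)\<^sup>2 * Re (\<omega> (mul (ast x) x))"
        by (simp add: mul_tensor[OF tensor] mult_left_mono mult.assoc)
    qed simp
  next
    case (add c d)
    obtain K where K: "bound c K" using add(1) by blast
    obtain L where L: "bound d L" using add(2) by blast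
    show ?case
      unfolding bound_def
    proof (intro exI[of _ "2 * K + 2 * L"] conjI allI impI)
      fix \<omega> x assume \<omega>: "positive_functional mul ast \<omega>"
      note pos = positive_functionalD[OF \<omega>]
      let ?u = "mul c x" and ?v = "mul d x"
      \<comment> \<open>Half of the parallelogram identity: positivity at the difference bounds the
        cross terms, which yields the factors 2.\<close>
      have "Re (\<omega> (mul (ast (?u + ?v)) (?u + ?v))) \<le> 2 * Re (\<omega> (mul (ast ?u) ?u)) + 2 * Re (\<omega> (mul (ast ?v) ?v))"
        using pos(7)[of "?u - ?v"] by (simp add: algD(1,2,5,6,8,9) pos)
      then show "Re (\<omega> (mul (ast (mul (c + d) x)) (mul (c + d) x))) \<le> (2 * K + 2 * L) * Re (\<omega> (mul (ast x) x))"
        using K[unfolded bound_def, THEN conjunct2, rule_format, OF \<omega>, of x]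
          L[unfolded bound_def, THEN conjunct2, rule_format, OF \<omega>, of x]
        by (simp add: algD(1) algebra_simps)
    qed (use K L in \<open>simp add: bound_def\<close>)
  qed
  then obtain K where "bound c K" by blast
  then show thesis
    unfolding bound_def by (elim conjE) (rule that[of K]; simp)
qed

end

section \<open>The GNS construction\<close>

locale psd_form =
  fixes S :: "'t::complex_vector \<Rightarrow> 't \<Rightarrow> complex"
  assumes S_add: "S (x + y) w = S x w + S y w" and S_scale: "S (z *\<^sub>C x) w = z * S x w"
    and S_commute: "S y x = cnj (S x y)" and S_nonneg: "0 \<le> Re (S x x)"
begin

lemma S_add_right: "S w (x + y) = S w x + S w y"
  using S_commute[of w "x + y"] S_commute[of w x] S_commute[of w y] by (simp add: S_add)

lemma S_scale_right: "S w (z *\<^sub>C x) = cnj z * S w x"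
  using S_commute[of w "z *\<^sub>C x"] S_commute[of w x] by (simp add: S_scale)

lemma S_zero: "S 0 x = 0" "S x 0 = 0"
  using S_scale[of 0 0 x] S_scale_right[of x 0 0] by simp_all

lemma S_diff: "S (x - y) w = S x w - S y w" "S w (x - y) = S w x - S w y"
  using S_add[of "x - y" y w] S_add_right[of w "x - y" y] by (simp_all add: algebra_simps)

lemmas S_simps = S_add S_scale S_add_right S_scale_right S_zero S_diff

lemma S_self: "S x x = complex_of_real (Re (S x x))"
  using S_commute[of x x] by (simp add: complex_eq_iff)

definition p :: "'t \<Rightarrow> real" where "p x = sqrt (Re (S x x))"

lemma p_nonneg: "0 \<le> p x" by (simp add: p_def S_nonneg)

lemma p_sq: "(p x)\<^sup>2 = Re (S x x)" by (simp add: p_def S_nonneg)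

lemma cauchy_schwarz: "cmod (S x y) \<le> p x * p y"
proof -
  let ?c = "S x y" and ?a = "Re (S x x)" and ?b = "Re (S y y)"
  have quad: "0 \<le> ?a - 2 * t * (cmod ?c)\<^sup>2 + t\<^sup>2 * (cmod ?c)\<^sup>2 * ?b" for t
  proof -
    define z where "z = complex_of_real t * ?c"
    have "S (x - z *\<^sub>C y) (x - z *\<^sub>C y) = S x x - cnj z * ?c - z * cnj ?c + z * cnj z * S y y"
      using S_commute[of x y] by (simp add: S_simps algebra_simps)
    also have "cnj z * ?c = complex_of_real t * (?c * cnj ?c)" by (simp add: z_def)
    also have "z * cnj ?c = complex_of_real t * (?c * cnj ?c)" by (simp add: z_def)
    also have "z * cnj z = complex_of_real (t\<^sup>2) * (?c * cnj ?c)" by (simp add: z_def power2_eq_square)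
    also have "?c * cnj ?c = complex_of_real ((cmod ?c)\<^sup>2)" by (rule complex_norm_square[symmetric])
    finally show ?thesis using S_nonneg[of "x - z *\<^sub>C y"] by simp
  qed
  have "(cmod ?c)\<^sup>2 \<le> ?a * ?b"
  proof (cases "?b = 0")
    case True
    have "?c = 0"
    proof (rule ccontr)
      assume "?c \<noteq> 0"
      then show False
        \<comment> \<open>The form may be degenerate. With \<open>?b = 0\<close> the quadratic is
          affine in t, and this t makes it equal to -a - 2, which is negative.\<close>
        using quad[of "(?a + 1) / (cmod ?c)\<^sup>2"] S_nonneg[of x] True by simp
    qed
    then show ?thesis using True by simp
  next
    case False
    then have "0 < ?b" using S_nonneg[of y] by simp
    then show ?thesis using quad[of "1 / ?b"] by (simp add: field_simps power2_eq_square)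
  qed
  then have "(cmod ?c)\<^sup>2 \<le> (p x * p y)\<^sup>2" by (simp add: power_mult_distrib p_sq)
  then show ?thesis by (rule power2_le_imp_le) (simp add: p_nonneg)
qed

lemma p_triangle: "p (x + y) \<le> p x + p y"
proof (rule power2_le_imp_le)
  have "(p (x + y))\<^sup>2 = (p x)\<^sup>2 + (p y)\<^sup>2 + 2 * Re (S x y)"
    using S_commute[of x y] by (simp add: p_sq S_simps)
  also have "Re (S x y) \<le> p x * p y" using cauchy_schwarz complex_Re_le_cmod order_trans by blast
  finally show "(p (x + y))\<^sup>2 \<le> (p x + p y)\<^sup>2" by (simp add: power2_eq_square algebra_simps)
qed (simp add: p_nonneg)

lemma p_scale: "p (z *\<^sub>C x) = cmod z * p x"
proof -
  have "S (z *\<^sub>C x) (z *\<^sub>C x) = (z * cnj z) * S x x"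
    by (simp add: S_simps)
  also have "z * cnj z = complex_of_real ((cmod z)\<^sup>2)" by (rule complex_norm_square[symmetric])
  finally show ?thesis by (simp add: p_def real_sqrt_mult)
qed

text \<open>The vectors of the completion are the functionals \<open>y \<mapsto> lim S (s n) y\<close> on \<open>'t\<close>, for Cauchy
  sequences \<open>s\<close>: equivalent sequences give the same functional.\<close>

definition cauchy :: "(nat \<Rightarrow> 't) \<Rightarrow> bool"
  where "cauchy s \<longleftrightarrow> (\<forall>e>0. \<exists>N. \<forall>m\<ge>N. \<forall>n\<ge>N. p (s m - s n) < e)"

definition ip :: "(nat \<Rightarrow> 't) \<Rightarrow> (nat \<Rightarrow> 't) \<Rightarrow> complex"
  where "ip s t = lim (\<lambda>n. S (s n) (t n))"

definition vec :: "(nat \<Rightarrow> 't) \<Rightarrow> 't \<Rightarrow> complex"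
  where "vec s y = ip s (\<lambda>_. y)"

text \<open>Because vectors are functions, addition and scaling are pointwise and need no
  representatives. Only the inner product chooses Cauchy sequences; \<open>hinner_vec\<close> shows
  that the choice does not matter.\<close>

definition completion :: "('t \<Rightarrow> complex) inner_space"
  where "completion = \<lparr>hcarrier = vec ` {s. cauchy s}, hzero = (\<lambda>_. 0), hadd = (\<lambda>F G y. F y + G y),
    hscale = (\<lambda>z F y. z * F y),
    hinner = (\<lambda>F G. ip (SOME s. cauchy s \<and> vec s = F) (SOME s. cauchy s \<and> vec s = G))\<rparr>"

lemma p_zero: "p 0 = 0" by (simp add: p_def S_zero)

lemma cauchy_const: "cauchy (\<lambda>_. x)" by (simp add: cauchy_def p_zero)

text \<open>Two comparison sequences cover sums; taking them equal covers scalar multiples and left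
  multiplications.\<close>

lemma cauchyI:
  assumes "\<And>m n. p (s m - s n) \<le> K * p (t m - t n) + K * p (u m - u n)" "0 \<le> K" "cauchy t" "cauchy u"
  shows "cauchy s"
  unfolding cauchy_def
proof (intro allI impI)
  fix e :: real assume e: "0 < e"
  \<comment> \<open>The denominator with \<open>K + 1\<close> also works for \<open>K = 0\<close>
    and makes the final inequality strict.\<close>
  define d where "d = e / (2 * (K + 1))"
  have d: "0 < d" "2 * (K * d) < e"
    using e assms(2) by (simp_all add: d_def field_simps)
  obtain M where M: "\<And>m n. m \<ge> M \<Longrightarrow> n \<ge> M \<Longrightarrow> p (t m - t n) < d"
    using assms(3) d(1) unfolding cauchy_def by blast
  obtain N where N: "\<And>m n. m \<ge> N \<Longrightarrow> n \<ge> N \<Longrightarrow> p (u m - u n) < d"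
    using assms(4) d(1) unfolding cauchy_def by blast
  have "p (s m - s n) < e" if "m \<ge> max M N" "n \<ge> max M N" for m n
  proof -
    have "K * p (t m - t n) \<le> K * d" "K * p (u m - u n) \<le> K * d"
      using M[of m n] N[of m n] that assms(2) by (auto intro!: mult_left_mono simp: less_imp_le)
    then show ?thesis using assms(1)[of m n] d(2) by linarith
  qed
  then show "\<exists>N. \<forall>m\<ge>N. \<forall>n\<ge>N. p (s m - s n) < e" by blast
qed

lemma cauchy_add: "cauchy s \<Longrightarrow> cauchy t \<Longrightarrow> cauchy (\<lambda>n. s n + t n)"
proof (rule cauchyI[where K = 1 and t = s and u = t])
  show "p (s m + t m - (s n + t n)) \<le> 1 * p (s m - s n) + 1 * p (t m - t n)" for m n
    using p_triangle[of "s m - s n" "t m - t n"] by (simp add: algebra_simps)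
qed auto

lemma cauchy_scale: "cauchy s \<Longrightarrow> cauchy (\<lambda>n. z *\<^sub>C s n)"
  by (rule cauchyI[where K = "cmod z" and t = s and u = s])
    (simp_all add: p_scale p_nonneg flip: complex_vector.scale_right_diff_distrib)

lemma cauchy_diff: "cauchy s \<Longrightarrow> cauchy t \<Longrightarrow> cauchy (\<lambda>n. s n - t n)"
  using cauchy_add[OF _ cauchy_scale[of t "-1"], of s] by (simp add: scaleC_minus_one)

lemma cauchy_bounded:
  assumes "cauchy s"
  obtains B where "0 < B" "\<And>n. p (s n) \<le> B"
proof -
  obtain N where N: "\<And>m n. m \<ge> N \<Longrightarrow> n \<ge> N \<Longrightarrow> p (s m - s n) < 1"
    using assms zero_less_one unfolding cauchy_def by blast
  define B where "B = (\<Sum>k\<le>N. p (s k)) + 1"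
  have s: "0 \<le> (\<Sum>k\<le>N. p (s k))" by (simp add: sum_nonneg p_nonneg)
  have le: "p (s k) \<le> (\<Sum>k\<le>N. p (s k))" if "k \<le> N" for k
    using that by (intro member_le_sum) (auto simp: p_nonneg)
  have "p (s n) \<le> B" for n
  proof (cases "n \<le> N")
    case True
    then show ?thesis using le[of n] by (simp add: B_def)
  next
    case False
    then show ?thesis
      using p_triangle[of "s n - s N" "s N"] N[of n N] le[of N] by (simp add: B_def)
  qed
  then show thesis using s by (intro that[of B]) (auto simp: B_def)
qed

lemma ip_tendsto:
  assumes s: "cauchy s" and t: "cauchy t"
  shows "(\<lambda>n. S (s n) (t n)) \<longlonglongrightarrow> ip s t"
proof -
  obtain A where A: "0 < A" "\<And>n. p (s n) \<le> A" using cauchy_bounded[OF s] by metis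
  obtain B where B: "0 < B" "\<And>n. p (t n) \<le> B" using cauchy_bounded[OF t] by metis
  have "Cauchy (\<lambda>n. S (s n) (t n))"
  proof (rule metric_CauchyI)
    fix e :: real assume e: "0 < e"
    obtain M where M: "\<And>m n. m \<ge> M \<Longrightarrow> n \<ge> M \<Longrightarrow> p (s m - s n) < e / (2 * B)"
      using s e B(1) unfolding cauchy_def by (meson divide_pos_pos mult_pos_pos zero_less_numeral)
    obtain N where N: "\<And>m n. m \<ge> N \<Longrightarrow> n \<ge> N \<Longrightarrow> p (t m - t n) < e / (2 * A)"
      using t e A(1) unfolding cauchy_def by (meson divide_pos_pos mult_pos_pos zero_less_numeral)
    have "dist (S (s m) (t m)) (S (s n) (t n)) < e" if mn: "m \<ge> max M N" "n \<ge> max M N" for m n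
    proof -
      have "S (s m) (t m) - S (s n) (t n) = S (s m - s n) (t m) + S (s n) (t m - t n)"
        by (simp add: S_simps)
      then have "dist (S (s m) (t m)) (S (s n) (t n)) \<le> cmod (S (s m - s n) (t m)) + cmod (S (s n) (t m - t n))"
        by (metis dist_norm norm_triangle_ineq)
      also have "\<dots> \<le> p (s m - s n) * p (t m) + p (s n) * p (t m - t n)"
        by (intro add_mono cauchy_schwarz)
      also have "\<dots> \<le> p (s m - s n) * B + A * p (t m - t n)"
        by (intro add_mono mult_left_mono mult_right_mono A B p_nonneg)
      also have "\<dots> < e / (2 * B) * B + A * (e / (2 * A))"
        using M[of m n] N[of m n] mn A(1) B(1) by (intro add_strict_mono mult_strict_right_mono mult_strict_left_mono) auto
      also have "\<dots> = e" using A(1) B(1) by simp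
      finally show ?thesis .
    qed
    then show "\<exists>M. \<forall>m\<ge>M. \<forall>n\<ge>M. dist (S (s m) (t m)) (S (s n) (t n)) < e" by blast
  qed
  then show ?thesis
    unfolding ip_def using Cauchy_convergent convergent_LIMSEQ_iff by blast
qed

lemma ip_eqI: "cauchy s \<Longrightarrow> cauchy t \<Longrightarrow> (\<lambda>n. S (s n) (t n)) \<longlonglongrightarrow> l \<Longrightarrow> ip s t = l"
  using ip_tendsto LIMSEQ_unique by blast

lemma ip_add: "cauchy s \<Longrightarrow> cauchy t \<Longrightarrow> cauchy u \<Longrightarrow> ip (\<lambda>n. s n + t n) u = ip s u + ip t u"
  by (intro ip_eqI cauchy_add) (auto simp: S_add intro!: tendsto_add ip_tendsto)

lemma ip_scale: "cauchy s \<Longrightarrow> cauchy t \<Longrightarrow> ip (\<lambda>n. z *\<^sub>C s n) t = z * ip s t"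
  by (intro ip_eqI cauchy_scale) (auto simp: S_scale intro!: tendsto_mult_left ip_tendsto)

lemma ip_diff: "cauchy s \<Longrightarrow> cauchy t \<Longrightarrow> cauchy u \<Longrightarrow> ip (\<lambda>n. s n - t n) u = ip s u - ip t u"
  by (intro ip_eqI cauchy_diff) (auto simp: S_diff intro!: tendsto_diff ip_tendsto)

lemma ip_commute: "cauchy s \<Longrightarrow> cauchy t \<Longrightarrow> ip t s = cnj (ip s t)"
  by (intro ip_eqI) (auto simp: S_commute[of "t _" "s _"] intro!: tendsto_cnj ip_tendsto)

lemma ip_nonneg: "cauchy s \<Longrightarrow> 0 \<le> Re (ip s s)"
  by (rule LIMSEQ_le_const[OF tendsto_Re[OF ip_tendsto]]) (auto simp: S_nonneg)

text \<open>Constant sequences are dense and \<open>d\<close> is bounded: replacing \<open>t\<close>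
  by its N-th term changes the limit by an arbitrarily small amount. Hence a vector is determined by
  its values against constants, which makes the functions \<open>vec s\<close> faithful names for
  vectors.\<close>

lemma ip_null:
  assumes d: "cauchy d" and t: "cauchy t" and null: "\<And>y. ip d (\<lambda>_. y) = 0"
  shows "ip d t = 0"
proof -
  obtain B where B: "0 < B" "\<And>n. p (d n) \<le> B" using cauchy_bounded[OF d] by metis
  have "cmod (ip d t) \<le> e" if e: "0 < e" for e
  proof -
    obtain N where N: "\<And>m n. m \<ge> N \<Longrightarrow> n \<ge> N \<Longrightarrow> p (t m - t n) < e / B"
      using t e B(1) unfolding cauchy_def by (meson divide_pos_pos)
    have "(\<lambda>n. S (d n) (t n) - S (d n) (t N)) \<longlonglongrightarrow> ip d t - 0"
      using ip_tendsto[OF d t] ip_tendsto[OF d cauchy_const[of "t N"]] null by (intro tendsto_diff) auto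
    then have "(\<lambda>n. cmod (S (d n) (t n - t N))) \<longlonglongrightarrow> cmod (ip d t)"
      by (simp add: S_diff tendsto_norm)
    moreover have "cmod (S (d n) (t n - t N)) \<le> e" if "n \<ge> N" for n
    proof -
      have "cmod (S (d n) (t n - t N)) \<le> p (d n) * p (t n - t N)" by (rule cauchy_schwarz)
      also have "\<dots> \<le> B * (e / B)"
        using N[of n N] that B p_nonneg less_imp_le by (intro mult_mono) auto
      finally show ?thesis using B(1) by simp
    qed
    ultimately show ?thesis by (intro LIMSEQ_le_const2) auto
  qed
  then have "cmod (ip d t) \<le> 0" using field_le_epsilon[of "cmod (ip d t)" 0] by auto
  then show ?thesis by simp
qed

lemma ip_cong_left:
  assumes "cauchy s" "cauchy s'" "cauchy t" "vec s = vec s'"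
  shows "ip s t = ip s' t"
proof -
  define d where "d = (\<lambda>n. s n - s' n)"
  have d: "cauchy d" unfolding d_def by (intro cauchy_diff assms)
  have ip_d: "ip d u = ip s u - ip s' u" if "cauchy u" for u
    using assms that by (simp add: d_def ip_diff)
  have "ip d t = 0"
  proof (rule ip_null[OF d assms(3)])
    show "ip d (\<lambda>_. y) = 0" for y
      using fun_cong[OF assms(4), of y] by (simp add: ip_d cauchy_const vec_def)
  qed
  then show ?thesis by (simp add: ip_d assms)
qed

lemma hinner_vec:
  assumes s: "cauchy s" and t: "cauchy t"
  shows "hinner completion (vec s) (vec t) = ip s t"
proof -
  have ex: "cauchy (SOME u. cauchy u \<and> vec u = vec v) \<and> vec (SOME u. cauchy u \<and> vec u = vec v) = vec v"
    if "cauchy v" for v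
    by (rule someI[of "\<lambda>u. cauchy u \<and> vec u = vec v" v]) (simp add: that)
  define s' t' where "s' = (SOME u. cauchy u \<and> vec u = vec s)" and "t' = (SOME u. cauchy u \<and> vec u = vec t)"
  have s': "cauchy s'" "vec s' = vec s" and t': "cauchy t'" "vec t' = vec t"
    using ex[OF s] ex[OF t] by (auto simp: s'_def t'_def)
  have "ip s' t' = ip s t'" by (intro ip_cong_left s s' t')
  also have "\<dots> = cnj (ip t' s)" by (intro ip_commute s t')
  also have "ip t' s = ip t s" by (intro ip_cong_left s t t')
  also have "cnj (ip t s) = ip s t" by (intro ip_commute[symmetric] s t)
  finally show ?thesis by (simp add: completion_def s'_def t'_def)
qed

lemma completion_sel:
  "hcarrier completion = vec ` {s. cauchy s}" "hzero completion = (\<lambda>_. 0)"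
  "hadd completion F G = (\<lambda>y. F y + G y)" "hscale completion z F = (\<lambda>y. z * F y)"
  by (simp_all add: completion_def)

lemma vec_add: "cauchy s \<Longrightarrow> cauchy t \<Longrightarrow> (\<lambda>y. vec s y + vec t y) = vec (\<lambda>n. s n + t n)"
  by (simp add: vec_def fun_eq_iff ip_add cauchy_const)

lemma vec_scale: "cauchy s \<Longrightarrow> (\<lambda>y. z * vec s y) = vec (\<lambda>n. z *\<^sub>C s n)"
  by (simp add: vec_def fun_eq_iff ip_scale cauchy_const)

lemma vec_zero: "vec (\<lambda>_. 0) = (\<lambda>_. 0)"
  by (rule ext) (auto simp: vec_def S_zero intro!: ip_eqI cauchy_const)

lemma pre_hilbert_completion: "pre_hilbert_space completion"
proof
  show "hzero completion \<in> hcarrier completion"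
    unfolding completion_sel vec_zero[symmetric] by (intro imageI) (simp add: cauchy_const)
  show "x \<in> hcarrier completion \<Longrightarrow> y \<in> hcarrier completion \<Longrightarrow> hadd completion x y \<in> hcarrier completion" for x y
    by (auto simp: completion_sel vec_add intro!: imageI cauchy_add)
  show "x \<in> hcarrier completion \<Longrightarrow> hscale completion z x \<in> hcarrier completion" for x z
    by (auto simp: completion_sel vec_scale intro!: imageI cauchy_scale)
  show "x \<in> hcarrier completion \<Longrightarrow> y \<in> hcarrier completion \<Longrightarrow> w \<in> hcarrier completion \<Longrightarrow>
      hinner completion (hadd completion x y) w = hinner completion x w + hinner completion y w" for x y w
    by (auto simp: completion_sel vec_add hinner_vec cauchy_add ip_add)
  show "x \<in> hcarrier completion \<Longrightarrow> y \<in> hcarrier completion \<Longrightarrow>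
      hinner completion (hscale completion z x) y = z * hinner completion x y" for x y z
    by (auto simp: completion_sel vec_scale hinner_vec cauchy_scale ip_scale)
  show "x \<in> hcarrier completion \<Longrightarrow> y \<in> hcarrier completion \<Longrightarrow>
      hinner completion y x = cnj (hinner completion x y)" for x y
    by (auto simp: completion_sel hinner_vec intro: ip_commute)
  show "x \<in> hcarrier completion \<Longrightarrow> 0 \<le> Re (hinner completion x x)" for x
    by (auto simp: completion_sel hinner_vec ip_nonneg)
  fix x assume "x \<in> hcarrier completion" and x0: "hinner completion x x = 0"
  then obtain s where s: "cauchy s" "x = vec s" by (auto simp: completion_sel)
  have "ip s (\<lambda>_. y) = 0" for y
  proof (rule ip_eqI[OF s(1) cauchy_const])
    have "(\<lambda>n. S (s n) (s n)) \<longlonglongrightarrow> 0"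
      using ip_tendsto[OF s(1) s(1)] x0 s by (simp add: hinner_vec)
    then have "(\<lambda>n. sqrt (Re (S (s n) (s n)))) \<longlonglongrightarrow> sqrt (Re 0)"
      by (intro tendsto_real_sqrt tendsto_Re)
    then have lim: "(\<lambda>n. p (s n) * p y) \<longlonglongrightarrow> 0"
      by (intro tendsto_mult_left_zero) (simp add: p_def)
    show "(\<lambda>n. S (s n) y) \<longlonglongrightarrow> 0"
      by (rule Lim_null_comparison[OF _ lim]) (simp add: cauchy_schwarz)
  qed
  then show "x = hzero completion" by (simp add: s completion_sel vec_def fun_eq_iff)
qed (auto simp: completion_sel algebra_simps)

interpretation pre_hilbert_space completion by (rule pre_hilbert_completion)

lemma hnorm_vec: "cauchy s \<Longrightarrow> (\<lambda>n. p (s n)) \<longlonglongrightarrow> hnorm completion (vec s)"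
  unfolding hnorm_def p_def by (simp only: hinner_vec) (intro tendsto_real_sqrt tendsto_Re ip_tendsto)

lemma hdist_vec:
  assumes "cauchy s" "cauchy t"
  shows "(\<lambda>n. p (s n - t n)) \<longlonglongrightarrow> hdist completion (vec s) (vec t)"
proof -
  have "(\<lambda>n. p (s n - t n)) \<longlonglongrightarrow> hnorm completion (vec (\<lambda>n. s n - t n))"
    using assms by (intro hnorm_vec cauchy_diff)
  moreover have "(\<lambda>y. vec s y + -1 * vec t y) = vec (\<lambda>n. s n - t n)"
    by (simp add: vec_def fun_eq_iff ip_diff cauchy_const assms)
  ultimately show ?thesis
    unfolding hdist_def completion_sel by simp
qed

lemma hdist_vec_const:
  assumes s: "cauchy s" and le: "\<And>n. n \<ge> N \<Longrightarrow> p (s n - x) \<le> e"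
  shows "hdist completion (vec s) (vec (\<lambda>_. x)) \<le> e"
  using le by (intro LIMSEQ_le_const2[OF hdist_vec[OF s cauchy_const]]) auto

text \<open>A diagonal argument: each \<open>F k\<close> is approximated within
  \<open>1 / Suc k\<close> by a constant sequence \<open>x k\<close>, and the sequence of these
  elements is itself Cauchy and represents the limit.\<close>

lemma hilbert_completion: "hilbert_space completion"
proof
  fix F :: "nat \<Rightarrow> 't \<Rightarrow> complex"
  assume F: "range F \<subseteq> hcarrier completion"
    and cauchy: "\<And>e. 0 < e \<Longrightarrow> \<exists>N. \<forall>m\<ge>N. \<forall>n\<ge>N. hdist completion (F m) (F n) < e"
  let ?\<eta> = "\<lambda>x. vec (\<lambda>_. x)"
  have mem: "F k \<in> hcarrier completion" "?\<eta> x \<in> hcarrier completion" for k x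
    using F by (auto simp: completion_sel cauchy_const)
  have "\<exists>x. hdist completion (F k) (?\<eta> x) \<le> 1 / Suc k" for k
  proof -
    obtain s where s: "cauchy s" "F k = vec s" using mem(1)[of k] by (auto simp: completion_sel)
    obtain N where "\<And>m n. m \<ge> N \<Longrightarrow> n \<ge> N \<Longrightarrow> p (s m - s n) < 1 / Suc k"
      using s(1) unfolding cauchy_def by (metis of_nat_0_less_iff zero_less_Suc zero_less_divide_1_iff)
    then have "hdist completion (F k) (?\<eta> (s N)) \<le> 1 / Suc k"
      unfolding s(2) by (intro hdist_vec_const[OF s(1), of N]) (auto intro: less_imp_le)
    then show ?thesis by blast
  qed
  then obtain x where x: "\<And>k. hdist completion (F k) (?\<eta> (x k)) \<le> 1 / Suc k" by metis
  have p_eq: "p (a - b) = hdist completion (?\<eta> a) (?\<eta> b)" for a b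
    using hdist_vec[OF cauchy_const cauchy_const, of a b] by (simp add: LIMSEQ_const_iff)
  have "cauchy x"
    unfolding cauchy_def
  proof (intro allI impI)
    fix e :: real assume e: "0 < e"
    obtain N where N: "\<And>m n. m \<ge> N \<Longrightarrow> n \<ge> N \<Longrightarrow> hdist completion (F m) (F n) < e / 3"
      using cauchy[of "e / 3"] e by auto
    obtain M where M: "1 / Suc M < e / 3" using nat_approx_posE[of "e / 3"] e by auto
    have "p (x m - x n) < e" if mn: "m \<ge> max M N" "n \<ge> max M N" for m n
    proof -
      have small: "hdist completion (F k) (?\<eta> (x k)) < e / 3" if "k \<ge> max M N" for k
      proof -
        have "1 / Suc k \<le> 1 / Suc M" using that by (simp add: frac_le)
        then show ?thesis using x[of k] M by linarith
      qed
      have "p (x m - x n) \<le> hdist completion (?\<eta> (x m)) (F m) + hdist completion (F m) (?\<eta> (x n))"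
        unfolding p_eq by (intro hdist_triangle mem)
      also have "hdist completion (F m) (?\<eta> (x n)) \<le> hdist completion (F m) (F n) + hdist completion (F n) (?\<eta> (x n))"
        by (intro hdist_triangle mem)
      also have "hdist completion (?\<eta> (x m)) (F m) = hdist completion (F m) (?\<eta> (x m))"
        by (intro hdist_commute mem)
      finally show ?thesis using small[OF mn(1)] small[OF mn(2)] N[of m n] mn by simp
    qed
    then show "\<exists>N. \<forall>m\<ge>N. \<forall>n\<ge>N. p (x m - x n) < e" by blast
  qed
  then have G: "vec x \<in> hcarrier completion" by (simp add: completion_sel)
  have "(\<lambda>n. hdist completion (F n) (vec x)) \<longlonglongrightarrow> 0"
  proof (rule LIMSEQ_I)
    fix e :: real assume e: "0 < e"
    obtain N where N: "\<And>m n. m \<ge> N \<Longrightarrow> n \<ge> N \<Longrightarrow> p (x m - x n) < e / 2"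
      using \<open>cauchy x\<close> e unfolding cauchy_def by (meson half_gt_zero)
    obtain M where M: "1 / Suc M < e / 2" using nat_approx_posE[of "e / 2"] e by auto
    have "norm (hdist completion (F n) (vec x) - 0) < e" if n: "n \<ge> max M N" for n
    proof -
      have "1 / Suc n \<le> 1 / Suc M" using n by (simp add: frac_le)
      moreover have "hdist completion (vec x) (?\<eta> (x n)) \<le> e / 2"
        using N n by (intro hdist_vec_const[OF \<open>cauchy x\<close>, of N]) (auto intro: less_imp_le)
      moreover have "hdist completion (F n) (vec x) \<le> hdist completion (F n) (?\<eta> (x n)) + hdist completion (?\<eta> (x n)) (vec x)"
        by (intro hdist_triangle mem G)
      ultimately show ?thesis
        using x[of n] M hdist_commute[OF G mem(2), of "x n"] hdist_nonneg[OF mem(1) G, of n] by simp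
    qed
    then show "\<exists>no. \<forall>n\<ge>no. norm (hdist completion (F n) (vec x) - 0) < e" by blast
  qed
  then show "\<exists>x\<in>hcarrier completion. (\<lambda>n. hdist completion (F n) x) \<longlonglongrightarrow> 0"
    using G by blast
qed

end

text \<open>Hermitian symmetry has to be derived. Reality of the form at x + y and at x + iy gives
  the imaginary and the real part of the identity.\<close>

lemma psd_form_positive_functional:
  assumes alg: "star_algebra mul ast" and pos: "positive_functional mul ast \<omega>"
  shows "psd_form (\<lambda>x y. \<omega> (mul (ast y) x))"
proof
  note alg = star_algebraD[OF alg] and pos = positive_functionalD[OF pos]
  fix x y w z
  show "\<omega> (mul (ast w) (x + y)) = \<omega> (mul (ast w) x) + \<omega> (mul (ast w) y)"
    "\<omega> (mul (ast w) (z *\<^sub>C x)) = z * \<omega> (mul (ast w) x)" "0 \<le> Re (\<omega> (mul (ast x) x))"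
    by (simp_all add: alg(2,4) pos)
  have "Im (\<omega> (mul (ast x) y)) + Im (\<omega> (mul (ast y) x)) = 0"
    using pos(6)[of "x + y"] by (simp add: alg(1,2,8) pos)
  moreover have "Re (\<omega> (mul (ast x) y)) - Re (\<omega> (mul (ast y) x)) = 0"
    using pos(6)[of "x + \<i> *\<^sub>C y"] by (simp add: alg(1-5,8,10) pos)
  ultimately show "\<omega> (mul (ast x) y) = cnj (\<omega> (mul (ast y) x))"
    by (simp add: complex_eq_iff)
qed

text \<open>In place of a cyclic vector the result supplies the map \<open>\<eta>\<close> from the
  algebra to its classes. The bound is a hypothesis because the left multiplications of a general
  star-algebra need not be bounded for the seminorm of \<open>\<omega>\<close>.\<close>

theorem GNS:
  fixes \<omega> :: "'t::complex_vector \<Rightarrow> complex"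
  assumes alg: "star_algebra mul ast" and pos: "positive_functional mul ast \<omega>"
    and bound: "\<And>c. \<exists>K\<ge>0. \<forall>x. Re (\<omega> (mul (ast (mul c x)) (mul c x))) \<le> K * Re (\<omega> (mul (ast x) x))"
  obtains H :: "('t \<Rightarrow> complex) inner_space" and \<pi> \<eta> where "representation mul ast H \<pi>"
    "\<And>x. \<eta> x \<in> hcarrier H" "\<And>x. (hnorm H (\<eta> x))\<^sup>2 = Re (\<omega> (mul (ast x) x))" "\<And>c x. \<pi> c (\<eta> x) = \<eta> (mul c x)"
proof -
  define S where "S x y = \<omega> (mul (ast y) x)" for x y
  interpret psd_form S
    unfolding S_def[abs_def] by (rule psd_form_positive_functional[OF alg pos])
  interpret hilbert_space completion by (rule hilbert_completion)
  note alg = star_algebraD[OF alg] and pos = positive_functionalD[OF pos]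
  have S_mul: "S (mul c x) y = S x (mul (ast c) y)" "S (mul (ast c) x) y = S x (mul c y)" for c x y
    by (simp_all add: S_def alg)
  have "\<exists>K\<ge>0. \<forall>x. p (mul c x) \<le> K * p x" for c
  proof -
    obtain K where K: "0 \<le> K" "\<And>x. Re (S (mul c x) (mul c x)) \<le> K * Re (S x x)"
      using bound[of c] by (auto simp: S_def)
    have "p (mul c x) \<le> sqrt K * p x" for x
      using real_sqrt_le_mono[OF K(2)[of x]] by (simp add: p_def real_sqrt_mult)
    then show ?thesis using K(1) by (intro exI[of _ "sqrt K"]) auto
  qed
  then obtain K where K: "\<And>c. 0 \<le> K c" "\<And>c x. p (mul c x) \<le> K c * p x" by metis
  have cauchy_mul: "cauchy (\<lambda>n. mul c (s n))" if s: "cauchy s" for c s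
  proof (rule cauchyI[OF _ K(1)[of c] s s])
    show "p (mul c (s m) - mul c (s n)) \<le> K c * p (s m - s n) + K c * p (s m - s n)" for m n
      using K(2)[of c "s m - s n"] mult_nonneg_nonneg[OF K(1)[of c] p_nonneg[of "s m - s n"]] by (simp add: alg)
  qed
  \<comment> \<open>A vector is the functional y to S(x, y), and S(cx, y) equals S(x, c'y) with c' =
    \<open>ast c\<close>. Defining the action by this transpose makes it well defined on functionals
    without choosing representatives.\<close>
  define \<pi> where "\<pi> c F = (\<lambda>y. F (mul (ast c) y))" for c and F :: "'t \<Rightarrow> complex"
  have \<pi>_vec: "\<pi> c (vec s) = vec (\<lambda>n. mul c (s n))" if "cauchy s" for c s
    by (simp add: \<pi>_def vec_def ip_def S_mul(1) fun_eq_iff)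
  have adj: "ip (\<lambda>n. mul (ast c) (s n)) t = ip s (\<lambda>n. mul c (t n))" for c s t
    by (simp add: ip_def S_mul(2))
  have "\<pi> c \<in> bounded_operators completion" for c
  proof -
    have "hnorm completion (\<pi> c (vec s)) \<le> K c * hnorm completion (vec s)" if s: "cauchy s" for s
      unfolding \<pi>_vec[OF s]
      by (rule LIMSEQ_le[OF hnorm_vec[OF cauchy_mul[OF s]] tendsto_mult_left[OF hnorm_vec[OF s]]])
        (auto intro: K(2))
    then show ?thesis
      unfolding bounded_operators_def completion_sel
      by (intro CollectI conjI; (simp add: \<pi>_def; fail)?) (auto simp: \<pi>_vec cauchy_mul)
  qed
  moreover have "hinner completion (\<pi> (ast c) v) w = hinner completion v (\<pi> c w)"
    if "v \<in> hcarrier completion" "w \<in> hcarrier completion" for c v w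
    using that by (auto simp: completion_sel \<pi>_vec hinner_vec cauchy_mul adj)
  moreover have lin: "\<pi> (c + d) v = hadd completion (\<pi> c v) (\<pi> d v)" "\<pi> (z *\<^sub>C c) v = hscale completion z (\<pi> c v)"
    "\<pi> (mul c d) v = \<pi> c (\<pi> d v)" if v: "v \<in> hcarrier completion" for c d v z
  proof -
    obtain s where s: "cauchy s" "v = vec s" using v by (auto simp: completion_sel)
    show "\<pi> (c + d) v = hadd completion (\<pi> c v) (\<pi> d v)" "\<pi> (z *\<^sub>C c) v = hscale completion z (\<pi> c v)"
      "\<pi> (mul c d) v = \<pi> c (\<pi> d v)"
      using s by (simp_all add: \<pi>_vec completion_sel vec_add vec_scale cauchy_mul alg)
  qed
  ultimately have rep: "representation mul ast completion \<pi>"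
    unfolding representation_def using hilbert_completion by blast
  show thesis
  proof (rule that[OF rep])
    show "vec (\<lambda>_. x) \<in> hcarrier completion" for x by (simp add: completion_sel cauchy_const)
    have "hnorm completion (vec (\<lambda>_. x)) = p x" for x
      using hnorm_vec[OF cauchy_const, of x] by (simp add: LIMSEQ_const_iff)
    then show "(hnorm completion (vec (\<lambda>_. x)))\<^sup>2 = Re (\<omega> (mul (ast x) x))" for x
      by (simp add: p_sq) (simp add: S_def)
    show "\<pi> c (vec (\<lambda>_. x)) = vec (\<lambda>_. mul c x)" for c x by (simp add: \<pi>_vec cauchy_const)
  qed
qed

section \<open>The maximal seminorm\<close>

lemma max_seminorm_le:
  fixes mul :: "'t::complex_vector \<Rightarrow> 't \<Rightarrow> 't"
  assumes M: "0 \<le> M"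
    and le: "\<And>(H :: (nat \<Rightarrow> complex \<times> 't) inner_space) \<pi> v. representation mul ast H \<pi> \<Longrightarrow> v \<in> hcarrier H \<Longrightarrow>
      hnorm H (\<pi> c v) \<le> M * hnorm H v"
  shows "max_seminorm mul ast c \<le> ennreal M"
  unfolding max_seminorm_def
proof (rule SUP_least, clarify)
  fix H :: "(nat \<Rightarrow> complex \<times> 't) inner_space" and \<pi> assume rep: "representation mul ast H \<pi>"
  then interpret hilbert_space H by (simp add: representation_def)
  have "op_norm H (\<pi> c) \<le> M"
    unfolding op_norm_def
  proof (rule cSUP_least)
    show "{v \<in> hcarrier H. hnorm H v \<le> 1} \<noteq> {}"
      using hzero_closed hnorm_zero by (metis (mono_tags, lifting) empty_iff mem_Collect_eq zero_le_one)
    fix v assume v: "v \<in> {v \<in> hcarrier H. hnorm H v \<le> 1}"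
    then have "hnorm H (\<pi> c v) \<le> M * hnorm H v" by (intro le rep) simp
    also have "\<dots> \<le> M * 1" using v M by (intro mult_left_mono) auto
    finally show "hnorm H (\<pi> c v) \<le> M" by simp
  qed
  then show "ennreal (op_norm H (\<pi> c)) \<le> ennreal M" by (rule ennreal_leI)
qed

text \<open>The vectors of \<open>H\<close> may come from any type, thanks to
  \<open>op_norm_le_max_seminorm\<close>. This lets the GNS spaces detect nonzero elements although
  the supremum does not range over their type.\<close>

lemma hnorm_le_max_seminorm:
  assumes rep: "representation mul ast H \<pi>" and fin: "max_seminorm mul ast c < \<infinity>" and v: "v \<in> hcarrier H"
  shows "hnorm H (\<pi> c v) \<le> enn2real (max_seminorm mul ast c) * hnorm H v"
proof -
  interpret hilbert_space H using rep by (simp add: representation_def)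
  have b: "\<pi> c \<in> bounded_operators H" using rep by (simp add: representation_def)
  have op: "op_norm H (\<pi> c) \<le> enn2real (max_seminorm mul ast c)"
    using op_norm_le_max_seminorm[OF rep, of c] fin
    by (cases "max_seminorm mul ast c" rule: ennreal_cases) auto
  show ?thesis
  proof (cases "hnorm H v = 0")
    case True
    then show ?thesis using b v by (auto simp: bounded_operators_def)
  next
    case False
    then have pos: "0 < hnorm H v" using hnorm_nonneg[OF v] by simp
    define u where "u = hscale H (complex_of_real (1 / hnorm H v)) v"
    have u: "u \<in> hcarrier H" "hnorm H u \<le> 1"
      using v pos by (simp_all add: u_def hnorm_scale norm_divide)
    have \<pi>v: "\<pi> c v \<in> hcarrier H" "\<pi> c u = hscale H (complex_of_real (1 / hnorm H v)) (\<pi> c v)"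
      using b v by (auto simp: bounded_operators_def u_def)
    have "hnorm H (\<pi> c u) \<le> enn2real (max_seminorm mul ast c)"
      using hnorm_le_op_norm[OF b u] op by simp
    then show ?thesis using pos by (simp add: \<pi>v hnorm_scale norm_divide field_simps)
  qed
qed

theorem cstar_norm_max_seminorm:
  fixes mul :: "'t::complex_vector \<Rightarrow> 't \<Rightarrow> 't"
  assumes alg: "star_algebra mul ast" and fin: "\<And>c. max_seminorm mul ast c < \<infinity>"
    and faithful: "\<And>c. c \<noteq> 0 \<Longrightarrow> \<exists>(H :: 'h inner_space) \<pi>. representation mul ast H \<pi> \<and> (\<exists>v\<in>hcarrier H. hnorm H (\<pi> c v) \<noteq> 0)"
  shows "cstar_norm mul ast (\<lambda>c. enn2real (max_seminorm mul ast c))"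
proof -
  define N where "N c = enn2real (max_seminorm mul ast c)" for c
  have N0: "0 \<le> N c" for c by (simp add: N_def)
  have upper: "hnorm H (\<pi> c v) \<le> N c * hnorm H v"
    if "representation mul ast H \<pi>" "v \<in> hcarrier H" for H :: "(nat \<Rightarrow> complex \<times> 't) inner_space" and \<pi> c v
    unfolding N_def by (rule hnorm_le_max_seminorm[OF that(1) fin that(2)])
  \<comment> \<open>The same estimate on the second type, to be used for the faithful
    representations only.\<close>
  have upper': "hnorm H (\<pi> c v) \<le> N c * hnorm H v"
    if "representation mul ast H \<pi>" "v \<in> hcarrier H" for H :: "'h inner_space" and \<pi> c v
    unfolding N_def by (rule hnorm_le_max_seminorm[OF that(1) fin that(2)])
  have least: "N c \<le> M" if "0 \<le> M" "\<And>(H :: (nat \<Rightarrow> complex \<times> 't) inner_space) \<pi> v. representation mul ast H \<pi> \<Longrightarrow>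
      v \<in> hcarrier H \<Longrightarrow> hnorm H (\<pi> c v) \<le> M * hnorm H v" for M c
  proof -
    have "max_seminorm mul ast c \<le> ennreal M" by (rule max_seminorm_le[OF that(1)]) (rule that(2))
    then show ?thesis unfolding N_def using that(1) by (intro enn2real_leI)
  qed
  have D: "hilbert_space H" "\<pi> c v \<in> hcarrier H" "\<pi> (c + d) v = hadd H (\<pi> c v) (\<pi> d v)"
      "\<pi> (z *\<^sub>C c) v = hscale H z (\<pi> c v)" "\<pi> (mul c d) v = \<pi> c (\<pi> d v)"
      "w \<in> hcarrier H \<Longrightarrow> hinner H (\<pi> (ast c) v) w = hinner H v (\<pi> c w)"
    if "representation mul ast H \<pi>" "v \<in> hcarrier H" for H :: "(nat \<Rightarrow> complex \<times> 't) inner_space" and \<pi> v c d z w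
    using that by (auto simp: representation_def bounded_operators_def)
  have add: "N (c + d) \<le> N c + N d" for c d
  proof (rule least)
    fix H :: "(nat \<Rightarrow> complex \<times> 't) inner_space" and \<pi> v
    assume a: "representation mul ast H \<pi>" "v \<in> hcarrier H"
    interpret hilbert_space H by (rule D(1)[OF a])
    have "hnorm H (\<pi> (c + d) v) \<le> hnorm H (\<pi> c v) + hnorm H (\<pi> d v)"
      unfolding D(3)[OF a] by (intro hnorm_add_le D(2)[OF a])
    then show "hnorm H (\<pi> (c + d) v) \<le> (N c + N d) * hnorm H v"
      using upper[OF a, of c] upper[OF a, of d] by (simp add: algebra_simps)
  qed (simp add: N0)
  have scale_le: "N (z *\<^sub>C c) \<le> cmod z * N c" for z c
  proof (rule least)
    fix H :: "(nat \<Rightarrow> complex \<times> 't) inner_space" and \<pi> v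
    assume a: "representation mul ast H \<pi>" "v \<in> hcarrier H"
    interpret hilbert_space H by (rule D(1)[OF a])
    show "hnorm H (\<pi> (z *\<^sub>C c) v) \<le> cmod z * N c * hnorm H v"
      using upper[OF a, of c] D(2)[OF a, of c]
      by (simp add: D(4)[OF a] hnorm_scale mult_left_mono mult.assoc)
  qed (simp add: N0)
  have scale: "N (z *\<^sub>C c) = cmod z * N c" for z c
  proof (cases "z = 0")
    case True
    then show ?thesis using scale_le[of z c] N0[of "z *\<^sub>C c"] by simp
  next
    case False
    have "N c = N (inverse z *\<^sub>C z *\<^sub>C c)" using False by (simp add: scaleC_scaleC scaleC_one)
    also have "\<dots> \<le> cmod (inverse z) * N (z *\<^sub>C c)" by (rule scale_le)
    finally have "N c \<le> N (z *\<^sub>C c) / cmod z" by (simp only: norm_inverse divide_inverse mult.commute)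
    then have "cmod z * N c \<le> N (z *\<^sub>C c)" using False by (simp add: field_simps)
    then show ?thesis using scale_le[of z c] by simp
  qed
  have mult: "N (mul c d) \<le> N c * N d" for c d
  proof (rule least)
    fix H :: "(nat \<Rightarrow> complex \<times> 't) inner_space" and \<pi> v
    assume a: "representation mul ast H \<pi>" "v \<in> hcarrier H"
    have "hnorm H (\<pi> (mul c d) v) \<le> N c * hnorm H (\<pi> d v)"
      unfolding D(5)[OF a] by (intro upper a D(2)[OF a])
    also have "\<dots> \<le> N c * (N d * hnorm H v)" by (intro mult_left_mono upper a N0)
    finally show "hnorm H (\<pi> (mul c d) v) \<le> N c * N d * hnorm H v" by (simp add: mult.assoc)
  qed (simp add: N0)
  \<comment> \<open>In each representation the squared norm of \<open>\<pi> c v\<close> is the inner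
    product of \<open>\<pi> (mul (ast c) c) v\<close> with \<open>v\<close>. Passing to the least
    common bound gives the hard half of the C*-identity; the other half follows once
    \<open>N\<close> is known not to increase under \<open>ast\<close>.\<close>
  have square_le: "(N c)\<^sup>2 \<le> N (mul (ast c) c)" for c
  proof -
    have "N c \<le> sqrt (N (mul (ast c) c))"
    proof (rule least)
      fix H :: "(nat \<Rightarrow> complex \<times> 't) inner_space" and \<pi> v
      assume a: "representation mul ast H \<pi>" "v \<in> hcarrier H"
      interpret hilbert_space H by (rule D(1)[OF a])
      note cv = D(2)[OF a, of c] and ccv = D(2)[OF a, of "mul (ast c) c"]
      have "(hnorm H (\<pi> c v))\<^sup>2 = Re (hinner H (\<pi> (mul (ast c) c) v) v)"
        using hnorm_sq[OF cv] Re_hinner_commute[OF a(2) ccv] D(6)[OF a(1) cv a(2), of c]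
        by (simp add: D(5)[OF a])
      also have "\<dots> \<le> hnorm H (\<pi> (mul (ast c) c) v) * hnorm H v"
        by (intro Re_hinner_le ccv a)
      also have "\<dots> \<le> N (mul (ast c) c) * hnorm H v * hnorm H v"
        by (intro mult_right_mono upper a hnorm_nonneg)
      also have "\<dots> = (sqrt (N (mul (ast c) c)) * hnorm H v)\<^sup>2"
        using N0 by (simp add: power_mult_distrib) (simp add: power2_eq_square)
      finally show "hnorm H (\<pi> c v) \<le> sqrt (N (mul (ast c) c)) * hnorm H v"
        by (rule power2_le_imp_le) (simp add: N0 hnorm_nonneg a)
    qed (simp add: N0)
    then have "(N c)\<^sup>2 \<le> (sqrt (N (mul (ast c) c)))\<^sup>2" by (intro power_mono N0)
    then show ?thesis by (simp add: N0)
  qed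
  have star_le: "N (ast c) \<le> N c" for c
  proof (cases "N (ast c) = 0")
    case False
    have "N (ast c) * N (ast c) \<le> N c * N (ast c)"
      using square_le[of "ast c"] mult[of c "ast c"] by (simp add: star_algebraD(11)[OF alg] power2_eq_square)
    then show ?thesis using False N0[of "ast c"] by simp
  qed (simp add: N0)
  have square: "N (mul (ast c) c) = (N c)\<^sup>2" for c
    using square_le[of c] mult[of "ast c" c] mult_right_mono[OF star_le[of c] N0[of c]]
    by (simp add: power2_eq_square)
  have "N c = 0 \<longleftrightarrow> c = 0" for c
  proof
    assume c: "N c = 0"
    show "c = 0"
    proof (rule ccontr)
      assume "c \<noteq> 0"
      then obtain H :: "'h inner_space" and \<pi> v where
        r: "representation mul ast H \<pi>" "v \<in> hcarrier H" "hnorm H (\<pi> c v) \<noteq> 0" using faithful by blast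
      interpret hilbert_space H using r(1) by (simp add: representation_def)
      have "\<pi> c v \<in> hcarrier H" using r by (auto simp: representation_def bounded_operators_def)
      then show False using upper'[OF r(1,2), of c] c r(3) hnorm_nonneg by fastforce
    qed
  next
    assume "c = 0"
    then show "N c = 0" using scale[of 0 c] by simp
  qed
  then show ?thesis
    unfolding cstar_norm_def N_def[symmetric] using alg N0 add scale mult square by blast
qed

section \<open>Product functionals\<close>

lemma star_algebra_cstar: "star_algebra ((*) :: 'a::cstar_algebra \<Rightarrow> 'a \<Rightarrow> 'a) star"
  by (simp add: star_algebra_def cbilinear_iff antilinear_def distrib_left distrib_right mult_scaleC_left
      mult_scaleC_right mult.assoc star_star star_add star_scaleC star_mult)

text \<open>Averaging a functional with its composition with \<open>\<theta>\<close> makes it even.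
  The value at \<open>star a * a\<close> survives because both summands are nonnegative
  there.\<close>

lemma exists_even_positive_functional:
  fixes a :: "'a::cstar_algebra"
  assumes \<theta>: "z2_grading \<theta>" and a: "a \<noteq> 0"
  obtains \<phi> :: "'a \<Rightarrow> complex" where "positive_functional (*) star \<phi>" "\<phi> (star a * a) \<noteq> 0" "\<And>x. \<phi> (\<theta> x) = \<phi> x"
proof -
  obtain \<psi> :: "'a \<Rightarrow> complex" where \<psi>: "positive_functional (*) star \<psi>" "\<psi> (star a * a) \<noteq> 0"
    using exists_positive_functional[OF a] by metis
  note pos = positive_functionalD[OF \<psi>(1)] and gr = z2_gradingD[OF \<theta>]
  have \<theta>_sq: "\<theta> (star x * x) = star (\<theta> x) * \<theta> x" for x by (simp add: gr)
  show thesis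
  proof (rule that[of "\<lambda>x. \<psi> x + \<psi> (\<theta> x)"])
    show "positive_functional (*) star (\<lambda>x. \<psi> x + \<psi> (\<theta> x))"
      unfolding positive_functional_def clinear_iff \<theta>_sq
      by (auto simp: pos gr scaleC_complex_def algebra_simps)
    have "Re (\<psi> (star a * a)) \<noteq> 0" using pos(6)[of a] \<psi>(2) by (simp add: complex_eq_iff)
    then have "0 < Re (\<psi> (star a * a) + \<psi> (star (\<theta> a) * \<theta> a))"
      using pos(7)[of a] pos(7)[of "\<theta> a"] by simp
    then show "\<psi> (star a * a) + \<psi> (\<theta> (star a * a)) \<noteq> 0"
      unfolding \<theta>_sq by (metis less_irrefl zero_complex.simps(1))
    show "\<psi> (\<theta> x) + \<psi> (\<theta> (\<theta> x)) = \<psi> x + \<psi> (\<theta> x)" for x by (simp add: gr)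
  qed
qed

lemma even_functional_odd:
  assumes "positive_functional mul ast \<phi>" "\<And>x. \<phi> (\<theta> x) = \<phi> x" "a \<in> graded_part \<theta> (-1)"
  shows "\<phi> a = 0"
  using assms(2)[of a] assms(3) by (simp add: graded_part_def positive_functionalD[OF assms(1)])

lemma product_functional:
  fixes \<phi> :: "'a::complex_vector \<Rightarrow> complex" and \<psi> :: "'b::complex_vector \<Rightarrow> complex"
  assumes "clinear \<phi>" "clinear \<psi>"
  obtains \<omega> :: "('a, 'b) tensor \<Rightarrow> complex" where "clinear \<omega>" "\<And>a b. \<omega> (a \<otimes> b) = \<phi> a * \<psi> b"
proof -
  have "\<exists>g :: ('a, 'b) tensor \<Rightarrow> complex. (\<forall>x y. g (x + y) = g x + g y) \<and> (\<forall>z x. g (z *\<^sub>C x) = id z *\<^sub>C g x) \<and>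
      (\<forall>a b. g (a \<otimes> b) = \<phi> a * \<psi> b)"
    using assms unfolding clinear_iff
    by (intro tensor_extension_exists[where \<sigma> = id]) (auto simp: scaleC_complex_def algebra_simps)
  then show thesis using that unfolding clinear_iff by auto
qed

section \<open>Normal forms of tensors\<close>

lemma tensor_sum_right: "a \<otimes> (\<Sum>i\<in>I. f i) = (\<Sum>i\<in>I. a \<otimes> f i)"
  by (induction I rule: infinite_finite_induct) (simp_all add: tensor_zero tensor_add_right)

lemma tensor_cons_induct [case_names zero cons]:
  assumes zero: "P 0" and cons: "\<And>a b x. P x \<Longrightarrow> P (x + a \<otimes> b)"
  shows "P x"
proof -
  have "P y \<longrightarrow> P (y + x)" for y
  proof (induction x arbitrary: y rule: tensor_induct)
    case (add x x')
    then show ?case by (simp flip: add.assoc)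
  qed (simp add: cons)
  from this[of 0] show ?thesis by (simp add: zero)
qed

text \<open>Gram-Schmidt in the second factor: the component of \<open>b\<close> along each
  \<open>e i\<close> is moved into the coefficient of \<open>e i\<close>, and only the remainder is
  appended. For a product functional this makes the double sum diagonal.\<close>

lemma (in psd_form) orthogonal_decomposition:
  fixes x :: "('a::complex_vector, 't) tensor"
  obtains n a e where "x = (\<Sum>i<n::nat. a i \<otimes> e i)" "\<And>i j. i < n \<Longrightarrow> j < n \<Longrightarrow> i \<noteq> j \<Longrightarrow> S (e i) (e j) = 0"
proof -
  have S_sum: "S (\<Sum>i\<in>I. f i) y = (\<Sum>i\<in>I. S (f i) y)" for f :: "nat \<Rightarrow> 't" and I y
    by (induction I rule: infinite_finite_induct) (simp_all add: S_simps)
  have "\<exists>(n::nat) a e. x = (\<Sum>i<n. a i \<otimes> e i) \<and> (\<forall>i<n. \<forall>j<n. i \<noteq> j \<longrightarrow> S (e i) (e j) = 0)"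
  proof (induction x rule: tensor_cons_induct)
    case zero
    show ?case by (intro exI[of _ 0]) simp
  next
    case (cons c b x)
    then obtain n :: nat and a e where x: "x = (\<Sum>i<n. a i \<otimes> e i)"
      and orth: "\<And>i j. i < n \<Longrightarrow> j < n \<Longrightarrow> i \<noteq> j \<Longrightarrow> S (e i) (e j) = 0" by blast
    \<comment> \<open>For a null vector \<open>e i\<close> the quotient is 0 by the convention on
      division, and this is the right coefficient because Cauchy-Schwarz then makes
      \<open>S b (e i)\<close> vanish too.\<close>
    define k where "k i = S b (e i) / S (e i) (e i)" for i
    define b' where "b' = b - (\<Sum>i<n. k i *\<^sub>C e i)"
    have b': "S b' (e j) = 0" if j: "j < n" for j
    proof -
      have "(\<Sum>i<n. k i * S (e i) (e j)) = (\<Sum>i<n. if i = j then k j * S (e j) (e j) else 0)"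
        using orth j by (intro sum.cong) auto
      also have "\<dots> = k j * S (e j) (e j)" using j by simp
      also have "\<dots> = S b (e j)"
      proof (cases "S (e j) (e j) = 0")
        case True
        then have "p (e j) = 0" by (simp add: p_def)
        then have "S b (e j) = 0" using cauchy_schwarz[of b "e j"] by simp
        then show ?thesis by (simp add: k_def)
      qed (simp add: k_def)
      finally show ?thesis by (simp add: b'_def S_simps S_sum)
    qed
    then have b'': "S (e j) b' = 0" if "j < n" for j using that S_commute[of "e j" b'] by simp
    define a' where "a' i = (if i < n then a i + k i *\<^sub>C c else c)" for i
    define e' where "e' i = (if i < n then e i else b')" for i
    have "x + c \<otimes> b = (\<Sum>i<Suc n. a' i \<otimes> e' i)"
    proof -
      have "c \<otimes> b = c \<otimes> (b' + (\<Sum>i<n. k i *\<^sub>C e i))" by (simp add: b'_def)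
      also have "\<dots> = c \<otimes> b' + (\<Sum>i<n. (k i *\<^sub>C c) \<otimes> e i)"
        by (simp add: tensor_add_right tensor_sum_right tensor_scaleC_left tensor_scaleC_right)
      finally show ?thesis
        by (simp add: x a'_def e'_def tensor_add_left sum.distrib add_ac)
    qed
    moreover have "S (e' i) (e' j) = 0" if "i < Suc n" "j < Suc n" "i \<noteq> j" for i j
      using that orth[of i j] b'[of j] b''[of i] by (auto simp: e'_def less_Suc_eq)
    ultimately show ?case by blast
  qed
  then show thesis using that by blast
qed

text \<open>An orthogonal decomposition may contain null vectors and cannot witness that a tensor is
  nonzero. With independent second factors, one nonzero coefficient keeps every linear combination
  containing it nonzero.\<close>

lemma independent_decomposition:
  fixes x :: "('a::complex_vector, 'b::complex_vector) tensor"
  obtains F a where "finite F" "complex_vector.independent F" "x = (\<Sum>f\<in>F. a f \<otimes> f)"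
proof -
  have "\<exists>F a. finite F \<and> complex_vector.independent F \<and> x = (\<Sum>f\<in>F. a f \<otimes> f)"
  proof (induction x rule: tensor_cons_induct)
    case zero
    show ?case by (intro exI[of _ "{}"]) (simp add: complex_vector.independent_empty)
  next
    case (cons c b x)
    then obtain F a where F: "finite F" "complex_vector.independent F" and x: "x = (\<Sum>f\<in>F. a f \<otimes> f)" by blast
    show ?case
    proof (cases "b \<in> complex_vector.span F")
      case True
      then obtain r where b: "b = (\<Sum>f\<in>F. r f *\<^sub>C f)"
        using complex_vector.span_finite[OF F(1)] by auto
      have "c \<otimes> b = (\<Sum>f\<in>F. (r f *\<^sub>C c) \<otimes> f)"
        unfolding b tensor_sum_right tensor_scaleC_left tensor_scaleC_right ..
      then have "x + c \<otimes> b = (\<Sum>f\<in>F. (a f + r f *\<^sub>C c) \<otimes> f)"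
        unfolding x tensor_add_left sum.distrib by simp
      then show ?thesis by (intro exI[of _ F] exI[of _ "\<lambda>f. a f + r f *\<^sub>C c"] conjI F)
    next
      case False
      then have b: "b \<notin> F" using complex_vector.span_base by blast
      have "(\<Sum>f\<in>F. (a(b := c)) f \<otimes> f) = (\<Sum>f\<in>F. a f \<otimes> f)" using b by (intro sum.cong) auto
      then have "x + c \<otimes> b = (\<Sum>f\<in>insert b F. (a(b := c)) f \<otimes> f)"
        using F(1) b by (simp add: x add.commute)
      moreover have "complex_vector.independent (insert b F)"
        by (rule complex_vector.independent_insertI[OF False F(2)])
      ultimately show ?thesis using F(1) by blast
    qed
  qed
  then show thesis using that by blast
qed

section \<open>Separation by product functionals, and the resulting properties of
  representations\<close>

context fermi
begin

text \<open>Evenness makes all the signs of the Fermi product invisible to a product functional.\<close>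

lemma product_functional_form:
  assumes \<phi>: "positive_functional (*) star \<phi>" "\<And>x. \<phi> (\<alpha> x) = \<phi> x"
    and \<psi>: "positive_functional (*) star \<psi>" "\<And>x. \<psi> (\<beta> x) = \<psi> x"
    and \<omega>: "clinear \<omega>" "\<And>a b. \<omega> (a \<otimes> b) = \<phi> a * \<psi> b"
  shows "\<omega> (mul (ast (c \<otimes> d)) (a \<otimes> b)) = \<phi> (star c * a) * \<psi> (star d * b)"
proof -
  note \<phi>D = positive_functionalD[OF \<phi>(1)] and \<psi>D = positive_functionalD[OF \<psi>(1)]
  have \<omega>D: "\<omega> (x + y) = \<omega> x + \<omega> y" "\<omega> (z *\<^sub>C x) = z * \<omega> x" for x y z
    using \<omega>(1) by (simp_all add: clinear_iff scaleC_complex_def)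
  note lin = algD(1,2,8) \<omega>D \<phi>D(1) \<psi>D(1) tensor_add_left tensor_add_right distrib_left distrib_right star_add
  have hom: "\<omega> (mul (ast (c \<otimes> d)) (a \<otimes> b)) = \<phi> (star c * a) * \<psi> (star d * b)"
    if c: "r \<in> {1, -1}" "c \<in> graded_part \<alpha> r" and d: "t \<in> {1, -1}" "d \<in> graded_part \<beta> t"
      and a: "u \<in> {1, -1}" "a \<in> graded_part \<alpha> u" and b: "v \<in> {1, -1}" "b \<in> graded_part \<beta> v" for a b c d r t u v
  proof -
    have ca: "star c * a \<in> graded_part \<alpha> (r * u)" and db: "star d * b \<in> graded_part \<beta> (t * v)"
      using c d a b by (auto intro!: graded_mult graded_star)
    have "\<omega> (mul (ast (c \<otimes> d)) (a \<otimes> b)) = grade_sign r t * grade_sign t u * (\<phi> (star c * a) * \<psi> (star d * b))"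
      using astD[OF c(1) d(1) c(2) d(2)]
        mulD[OF c(1) d(1) a(1) b(1) graded_star(1)[OF c] graded_star(2)[OF d] a(2) b(2)]
      by (simp add: algD \<omega>D \<omega>(2))
    \<comment> \<open>If the grades of \<open>c\<close> and \<open>a\<close> differ,
      \<open>star c * a\<close> is odd and both sides are 0. If they agree, the sign of the
      involution and the sign of the product coincide and multiply to 1.\<close>
    moreover have "\<phi> (star c * a) = 0" if "r \<noteq> u"
      using ca that c(1) a(1) even_functional_odd[OF \<phi>, of "star c * a"] by auto
    moreover have "grade_sign r t * grade_sign t r = 1" by (auto simp: grade_sign_def)
    ultimately show ?thesis by (cases "r = u") auto
  qed
  show ?thesis
    using \<alpha>
  proof (induction c rule: graded_induct)
    case (homogeneous r c)
    note c = this
    show ?case using \<beta>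
    proof (induction d rule: graded_induct)
      case (homogeneous t d)
      note d = this
      show ?case using \<alpha>
      proof (induction a rule: graded_induct)
        case (homogeneous u a)
        note a = this
        show ?case using \<beta>
        proof (induction b rule: graded_induct)
          case (homogeneous v b)
          then show ?case by (intro hom[OF c d a])
        qed (simp add: lin)
      qed (simp add: lin)
    qed (simp add: lin)
  qed (simp add: lin)
qed

text \<open>Orthogonalizing the second factors for \<open>\<psi>\<close> leaves only products of two
  nonnegative numbers. This replaces the argument that the entrywise product of two positive
  semidefinite matrices is positive semidefinite.\<close>

lemma positive_product_functional:
  assumes \<phi>: "positive_functional (*) star \<phi>" "\<And>x. \<phi> (\<alpha> x) = \<phi> x"
    and \<psi>: "positive_functional (*) star \<psi>" "\<And>x. \<psi> (\<beta> x) = \<psi> x"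
    and \<omega>: "clinear \<omega>" "\<And>a b. \<omega> (a \<otimes> b) = \<phi> a * \<psi> b"
  shows "positive_functional mul ast \<omega>"
  unfolding positive_functional_def
proof (intro conjI allI \<omega>(1))
  fix x :: "('a, 'b) tensor"
  interpret \<phi>: psd_form "\<lambda>x y. \<phi> (star y * x)"
    by (rule psd_form_positive_functional[OF star_algebra_cstar \<phi>(1)])
  interpret \<psi>: psd_form "\<lambda>x y. \<psi> (star y * x)"
    by (rule psd_form_positive_functional[OF star_algebra_cstar \<psi>(1)])
  have "\<omega> (0 *\<^sub>C 0) = 0 *\<^sub>C \<omega> 0" and add: "\<omega> (x + y) = \<omega> x + \<omega> y" for x y
    using \<omega>(1) unfolding clinear_iff by blast+
  then have \<omega>D: "\<omega> (x + y) = \<omega> x + \<omega> y" "\<omega> 0 = 0" for x y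
    by simp_all
  have zero: "mul 0 y = 0" "mul y 0 = 0" "ast 0 = 0" for y
    using algD(3)[of 0 0 y] algD(4)[of y 0 0] algD(10)[of 0 0] by simp_all
  obtain n :: nat and a e where x: "x = (\<Sum>i<n. a i \<otimes> e i)"
    and orth: "\<And>i j. i < n \<Longrightarrow> j < n \<Longrightarrow> i \<noteq> j \<Longrightarrow> \<psi> (star (e j) * e i) = 0"
    by (rule \<psi>.orthogonal_decomposition[of x]) (rule that)
  have sum1: "\<omega> (mul (ast y) (\<Sum>i\<in>I. f i)) = (\<Sum>i\<in>I. \<omega> (mul (ast y) (f i)))" for f :: "nat \<Rightarrow> _" and I y
    by (induction I rule: infinite_finite_induct) (simp_all add: algD \<omega>D zero)
  have sum2: "\<omega> (mul (ast (\<Sum>i\<in>I. f i)) y) = (\<Sum>i\<in>I. \<omega> (mul (ast (f i)) y))" for f :: "nat \<Rightarrow> _" and I y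
    by (induction I rule: infinite_finite_induct) (simp_all add: algD \<omega>D zero)
  have "\<omega> (mul (ast x) x) = (\<Sum>i<n. \<Sum>j<n. \<phi> (star (a i) * a j) * \<psi> (star (e i) * e j))"
    unfolding x sum1 sum2 product_functional_form[OF assms] by (rule sum.swap)
  also have "\<dots> = (\<Sum>i<n. \<Sum>j<n. if i = j then \<phi> (star (a i) * a i) * \<psi> (star (e i) * e i) else 0)"
    using orth by (intro sum.cong) auto
  also have "\<dots> = (\<Sum>i<n. complex_of_real (Re (\<phi> (star (a i) * a i)) * Re (\<psi> (star (e i) * e i))))"
    by (simp flip: \<phi>.S_self \<psi>.S_self)
  also have "\<dots> = complex_of_real (\<Sum>i<n. Re (\<phi> (star (a i) * a i)) * Re (\<psi> (star (e i) * e i)))"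
    by simp
  finally show "Im (\<omega> (mul (ast x) x)) = 0" "0 \<le> Re (\<omega> (mul (ast x) x))"
    by (auto intro!: sum_nonneg mult_nonneg_nonneg \<phi>.S_nonneg \<psi>.S_nonneg)
qed

text \<open>Applying \<open>\<phi>\<close> after multiplication by \<open>star (a f)\<close> to the
  first factors turns \<open>x\<close> into the vector \<open>b\<close>, which is nonzero because
  \<open>f\<close> has a nonzero coefficient in it. Pairing \<open>x\<close> with
  \<open>a f \<otimes> b\<close> then gives \<open>\<psi> (star b * b)\<close>, and by
  Cauchy-Schwarz a nonzero pairing prevents \<open>x\<close> from being null.\<close>

lemma exists_separating_functional:
  assumes x: "x \<noteq> 0"
  obtains \<omega> where "positive_functional mul ast \<omega>" "Re (\<omega> (mul (ast x) x)) \<noteq> 0"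
proof -
  obtain F a where F: "finite F" "complex_vector.independent F" and xF: "x = (\<Sum>f\<in>F. a f \<otimes> f)"
    using independent_decomposition by metis
  have "\<exists>f\<in>F. a f \<noteq> 0"
  proof (rule ccontr)
    assume "\<not> (\<exists>f\<in>F. a f \<noteq> 0)"
    then have "x = (\<Sum>f\<in>F. 0)" unfolding xF by (intro sum.cong) (auto simp: tensor_zero)
    then show False using x by simp
  qed
  then obtain f where f: "f \<in> F" "a f \<noteq> 0" by blast
  obtain \<phi> :: "'a \<Rightarrow> complex" where \<phi>: "positive_functional (*) star \<phi>" "\<phi> (star (a f) * a f) \<noteq> 0" "\<And>x. \<phi> (\<alpha> x) = \<phi> x"
    using exists_even_positive_functional[OF \<alpha> f(2)] by metis
  define k where "k g = \<phi> (star (a f) * a g)" for g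
  define b where "b = (\<Sum>g\<in>F. k g *\<^sub>C g)"
  have "b \<noteq> 0"
  proof
    assume "b = 0"
    then have "k f = 0"
      unfolding b_def by (rule complex_vector.independentD[OF F(2) F(1) subset_refl _ f(1)])
    then show False using \<phi>(2) by (simp add: k_def)
  qed
  then obtain \<psi> :: "'b \<Rightarrow> complex" where \<psi>: "positive_functional (*) star \<psi>" "\<psi> (star b * b) \<noteq> 0" "\<And>x. \<psi> (\<beta> x) = \<psi> x"
    using exists_even_positive_functional[OF \<beta>] by metis
  note \<psi>D = positive_functionalD[OF \<psi>(1)]
  obtain \<omega> :: "('a, 'b) tensor \<Rightarrow> complex" where \<omega>: "clinear \<omega>" "\<And>a b. \<omega> (a \<otimes> b) = \<phi> a * \<psi> b"
    using product_functional[of \<phi> \<psi>] \<phi>(1) \<psi>(1) by (auto simp: positive_functional_def)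
  have pos: "positive_functional mul ast \<omega>"
    by (rule positive_product_functional[OF \<phi>(1,3) \<psi>(1,3) \<omega>])
  interpret psd_form "\<lambda>x y. \<omega> (mul (ast y) x)"
    by (rule psd_form_positive_functional[OF alg pos])
  have S_sum: "\<omega> (mul (ast y) (\<Sum>g\<in>F. h g)) = (\<Sum>g\<in>F. \<omega> (mul (ast y) (h g)))" for y and h :: "'b \<Rightarrow> _"
    using F(1) by (induction F rule: finite_induct) (simp_all add: S_simps)
  have \<psi>_sum: "\<psi> (star b * (\<Sum>g\<in>F. h g)) = (\<Sum>g\<in>F. \<psi> (star b * h g))" for h :: "'b \<Rightarrow> 'b"
    using F(1) by (induction F rule: finite_induct) (simp_all add: \<psi>D distrib_left)
  have "\<omega> (mul (ast (a f \<otimes> b)) x) = (\<Sum>g\<in>F. k g * \<psi> (star b * g))"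
    unfolding xF S_sum product_functional_form[OF \<phi>(1,3) \<psi>(1,3) \<omega>] k_def ..
  also have "\<dots> = (\<Sum>g\<in>F. \<psi> (star b * (k g *\<^sub>C g)))"
    by (simp add: mult_scaleC_right \<psi>D)
  also have "\<dots> = \<psi> (star b * b)" by (simp only: \<psi>_sum[symmetric] b_def[symmetric])
  finally have "\<omega> (mul (ast (a f \<otimes> b)) x) \<noteq> 0" using \<psi>(2) by simp
  then have "p x \<noteq> 0" using cauchy_schwarz[where x = x and y = "a f \<otimes> b"] by auto
  then have "Re (\<omega> (mul (ast x) x)) \<noteq> 0" by (auto simp: p_def)
  then show thesis using pos that by blast
qed

text \<open>The uniform bound speaks only of vectors \<open>\<pi> x v\<close>, and an arbitrary
  \<open>v\<close> need not be approximated by such vectors. Applying it to \<open>ast c\<close> at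
  x = \<open>c\<close> bounds the action of \<open>ast c\<close> on \<open>\<pi> c v\<close>;
  pairing the result with \<open>v\<close> and cancelling one factor
  \<open>hnorm H (\<pi> c v)\<close> reaches all vectors.\<close>

lemma representation_bound:
  obtains K where "0 \<le> K" "\<And>(H :: 'h inner_space) \<pi> v. representation mul ast H \<pi> \<Longrightarrow> v \<in> hcarrier H \<Longrightarrow>
    hnorm H (\<pi> c v) \<le> K * hnorm H v"
proof -
  obtain K where K: "0 \<le> K" "\<And>\<omega> x. positive_functional mul ast \<omega> \<Longrightarrow>
      Re (\<omega> (mul (ast (mul (ast c) x)) (mul (ast c) x))) \<le> K * Re (\<omega> (mul (ast x) x))"
    using uniform_bound[of "ast c"] by metis
  have "hnorm H (\<pi> c v) \<le> sqrt K * hnorm H v" if rep: "representation mul ast H \<pi>" and v: "v \<in> hcarrier H"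
    for H :: "'h inner_space" and \<pi> v
  proof -
    interpret hilbert_space H using rep by (simp add: representation_def)
    have D: "\<pi> c v \<in> hcarrier H" "\<pi> (c + d) v = hadd H (\<pi> c v) (\<pi> d v)"
        "\<pi> (z *\<^sub>C c) v = hscale H z (\<pi> c v)" "\<pi> (mul c d) v = \<pi> c (\<pi> d v)"
        "w \<in> hcarrier H \<Longrightarrow> hinner H (\<pi> (ast c) v) w = hinner H v (\<pi> c w)" if "v \<in> hcarrier H" for v c d z w
      using rep that by (auto simp: representation_def bounded_operators_def)
    define \<omega> where "\<omega> x = hinner H (\<pi> x v) v" for x
    have \<omega>_sq: "\<omega> (mul (ast x) x) = complex_of_real ((hnorm H (\<pi> x v))\<^sup>2)" for x
    proof -
      have "\<omega> (mul (ast x) x) = hinner H (\<pi> x v) (\<pi> x v)"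
        unfolding \<omega>_def D(4)[OF v] by (intro D(5) D(1) v)
      then show ?thesis using hinner_self[OF D(1)[OF v]] by simp
    qed
    have "positive_functional mul ast \<omega>"
      unfolding positive_functional_def clinear_iff \<omega>_sq
      by (simp add: \<omega>_def D v hinner_simps scaleC_complex_def)
    from K(2)[OF this, of c] have "(hnorm H (\<pi> (mul (ast c) c) v))\<^sup>2 \<le> K * (hnorm H (\<pi> c v))\<^sup>2"
      unfolding \<omega>_sq by simp
    then have "sqrt ((hnorm H (\<pi> (mul (ast c) c) v))\<^sup>2) \<le> sqrt (K * (hnorm H (\<pi> c v))\<^sup>2)"
      by (rule real_sqrt_le_mono)
    then have le: "hnorm H (\<pi> (mul (ast c) c) v) \<le> sqrt K * hnorm H (\<pi> c v)"
      by (simp add: real_sqrt_mult hnorm_nonneg D v)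
    have "(hnorm H (\<pi> c v))\<^sup>2 = Re (\<omega> (mul (ast c) c))" by (simp add: \<omega>_sq)
    also have "\<dots> \<le> hnorm H (\<pi> (mul (ast c) c) v) * hnorm H v"
      unfolding \<omega>_def by (intro Re_hinner_le D v)
    also have "\<dots> \<le> sqrt K * hnorm H (\<pi> c v) * hnorm H v"
      using le by (intro mult_right_mono hnorm_nonneg v)
    finally have "hnorm H (\<pi> c v) * hnorm H (\<pi> c v) \<le> (sqrt K * hnorm H v) * hnorm H (\<pi> c v)"
      by (simp add: power2_eq_square mult_ac)
    then show ?thesis
      using hnorm_nonneg[OF D(1)[OF v], of c] hnorm_nonneg[OF v] K(1)
      by (cases "hnorm H (\<pi> c v) = 0") auto
  qed
  then show thesis using K(1) by (intro that[of "sqrt K"]) auto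
qed

lemma max_seminorm_finite: "max_seminorm mul ast c < \<infinity>"
proof -
  obtain K where K: "0 \<le> K" "\<And>(H :: (nat \<Rightarrow> complex \<times> ('a, 'b) tensor) inner_space) \<pi> v.
      representation mul ast H \<pi> \<Longrightarrow> v \<in> hcarrier H \<Longrightarrow> hnorm H (\<pi> c v) \<le> K * hnorm H v"
    by (rule representation_bound[of c]) (rule that)
  have "max_seminorm mul ast c \<le> ennreal K" by (rule max_seminorm_le[OF K(1)]) (rule K(2))
  then show ?thesis by (rule order_le_less_trans) simp
qed

text \<open>The operator for \<open>c\<close> sends the class of \<open>ast c\<close> to the class
  of the product of the two. Separation is therefore used twice: once to see that this product is
  nonzero, and once to find a functional for which its class is nonzero.\<close>

lemma faithful_representation:
  assumes c: "c \<noteq> 0"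
  shows "\<exists>(H :: (('a, 'b) tensor \<Rightarrow> complex) inner_space) \<pi>. representation mul ast H \<pi> \<and>
    (\<exists>v\<in>hcarrier H. hnorm H (\<pi> c v) \<noteq> 0)"
proof -
  have zero: "mul 0 y = 0" "ast 0 = 0" for y
    using algD(3)[of 0 0 y] algD(10)[of 0 0] by simp_all
  have "ast c \<noteq> 0" using c algD(11)[of c] zero by metis
  then obtain \<omega>' where \<omega>': "positive_functional mul ast \<omega>'" "Re (\<omega>' (mul (ast (ast c)) (ast c))) \<noteq> 0"
    using exists_separating_functional by metis
  then have "mul c (ast c) \<noteq> 0" using positive_functionalD(5)[OF \<omega>'(1)] by (auto simp: algD)
  then obtain \<omega> where \<omega>: "positive_functional mul ast \<omega>"
      "Re (\<omega> (mul (ast (mul c (ast c))) (mul c (ast c)))) \<noteq> 0"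
    using exists_separating_functional by metis
  have "\<exists>K\<ge>0. \<forall>x. Re (\<omega> (mul (ast (mul d x)) (mul d x))) \<le> K * Re (\<omega> (mul (ast x) x))" for d
    using uniform_bound[of d] \<omega>(1) by metis
  then obtain H :: "(('a, 'b) tensor \<Rightarrow> complex) inner_space" and \<pi> \<eta> where
    rep: "representation mul ast H \<pi>" "\<And>x. \<eta> x \<in> hcarrier H"
      "\<And>x. (hnorm H (\<eta> x))\<^sup>2 = Re (\<omega> (mul (ast x) x))" "\<And>c x. \<pi> c (\<eta> x) = \<eta> (mul c x)"
    using GNS[OF alg \<omega>(1)] by metis
  have "hnorm H (\<pi> c (\<eta> (ast c))) \<noteq> 0"
    using rep(3)[of "mul c (ast c)"] \<omega>(2) by (auto simp: rep(4))
  then show ?thesis using rep(1,2) by blast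
qed

end

theorem theorem8p1:
  fixes \<alpha> :: "'a::cstar_algebra \<Rightarrow> 'a" and \<beta> :: "'b::cstar_algebra \<Rightarrow> 'b"
  assumes "z2_grading \<alpha>" and "z2_grading \<beta>"
  shows "(\<forall>c. max_seminorm (fermi_mult \<alpha> \<beta>) (fermi_star \<alpha> \<beta>) c < \<infinity>) \<and>
    cstar_norm (fermi_mult \<alpha> \<beta>) (fermi_star \<alpha> \<beta>)
      (\<lambda>c. enn2real (max_seminorm (fermi_mult \<alpha> \<beta>) (fermi_star \<alpha> \<beta>) c))"
proof -
  interpret fermi \<alpha> \<beta> using assms by unfold_locales
  show ?thesis
    using cstar_norm_max_seminorm[OF alg max_seminorm_finite faithful_representation] max_seminorm_finite
    by blast
qed

end
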